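(* Let $\mathcal H$ be a Hilbert space, $H$ a bounded selfadjoint operator in $\mathcal H$, and $A$ a selfadjoint operator in $\mathcal H$ (possibly unbounded), with $W_t:=e^{itA}$, $t\in\mathbb R$. Assume that $H\in C^1(A;\mathcal H)$ and that $B\equiv i[H,A]=K^2$ for some bounded selfadjoint operator $K$ in $\mathcal H$. Put $\mathcal K:=\ker(K)$ and $\mathcal G:=\ker(K)^\perp$, and assume that both $H$ and $A$ are reduced by the decomposition $\mathcal H=\mathcal K\oplus\mathcal G$. Let $H_0$, $A_0$, $B_0$ be the restrictions of $H$, $A$, $B$ to $\mathcal G$, and let $\mathcal B$, $\mathcal B^*$ be the completed spaces associated with $B_0$ as defined in the context. Assume that the unitary group $\{e^{itA_0}\}_{t\in\mathbb R}$ in $\mathcal G$ extends to a $C_0$-group in $\mathcal B$ (equivalently, restricts to a $C_0$-group in $\mathcal B^*$), and that $B_0\in C^1(A_0;\mathcal B,\mathcal B^* )$. Let $\mathcal E:=\big(D(A_0,\mathcal B^* ),\mathcal B^*\big)_{1/2,1}$. Then a limiting absorption principle holds for $H_0$ uniformly on $\mathbb R$: there exists a constant $c>0$ such that $$ \left|\left\langle f,(H_0-\lambda\mp i\mu)^{-1}f\right\rangle\right|\le c\,\|f\|_{\mathcal E}^2 $$ for all $\lambda\in\mathbb R$, $\mu>0$ and $f\in\mathcal E$. In particular, the spectrum of $H_0$ is purely absolutely continuous.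
   Context: $\langle\cdot,\cdot\rangle$ denotes the scalar product of $\mathcal H$ and $\|\cdot\|$ its norm. For Hilbert spaces $\mathcal H_1,\mathcal H_2$, $\mathscr B(\mathcal H_1,\mathcal H_2)$ is the set of bounded operators from $\mathcal H_1$ to $\mathcal H_2$, and $\mathscr B(\mathcal H):=\mathscr B(\mathcal H,\mathcal H)$. **The class $C^1(A;\mathcal H)$.** A bounded selfadjoint operator $H$ belongs to $C^1(A;\mathcal H)$ if one of the following equivalent conditions holds: (i) the map $\mathbb R\ni t\mapsto W_{-t}HW_t\in\mathscr B(\mathcal H)$, with $W_t=e^{itA}$, is strongly differentiable; (ii) the sesquilinear form $D(A)\times D(A)\ni(f,g)\mapsto i\langle Hf,Ag\rangle-i\langle Af,Hg\rangle\in\mathbb C$ is continuous when $D(A)$ is endowed with the topology of $\mathcal H$. In that case $B\equiv i[H,A]$ denotes the strong derivative at $t=0$ in (i), equivalently the bounded selfadjoint operator associated with the continuous extension of the form in (ii) to $\mathcal H\times\mathcal H$. **The spaces $\mathcal B$ and $\mathcal B^*$.** Since $B=K^2$, the operator $B$ is reduced by $\mathcal H=\mathcal K\oplus\mathcal G$, and its restriction $B_0$ to $\mathcal G$ is positive and injective, i.e. $\langle f,B_0f\rangle>0$ for all $f\in\mathcal G\setminus\{0\}$. $\mathcal B$ is the completion of $\mathcal G$ with respect to the norm $\|f\|_{\mathcal B}:=\langle f,B_0f\rangle^{1/2}$. Its adjoint space $\mathcal B^*$ is identified with the completion of $B_0\mathcal G$ with respect to the norm $\|g\|_{\mathcal B^*}:=\langle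 g,B_0^{-1}g\rangle^{1/2}$. There are continuous dense embeddings $\mathcal B^*\hookrightarrow\mathcal G\hookrightarrow\mathcal B$, and $B_0$ extends to an isometric operator from $\mathcal B$ to $\mathcal B^*$ (still denoted $B_0$). The $C_0$-groups induced by $e^{itA_0}$ in $\mathcal B$ and $\mathcal B^*$ are denoted by the same symbol; $D(A_0,\mathcal B)$ and $D(A_0,\mathcal B^* )$ denote the domains of their generators (with the convention that the group is $e^{it\cdot\text{generator}}$), endowed with the graph norm. **The class $C^1(A_0;\mathcal B,\mathcal B^* )$.** $B_0\in C^1(A_0;\mathcal B,\mathcal B^* )$ means that the map $\mathbb R\ni t\mapsto e^{-itA_0}B_0e^{itA_0}\in\mathscr B(\mathcal B,\mathcal B^* )$ is strongly differentiable; equivalently, the sesquilinear form $D(A_0,\mathcal B)\times D(A_0,\mathcal B)\ni(f,g)\mapsto i\langle f,B_0A_0g\rangle-i\langle A_0f,B_0g\rangle\in\mathbb C$ is continuous when $D(A_0,\mathcal B)$ is endowed with the topology of $\mathcal B$, where here $\langle\cdot,\cdot\rangle$ denotes the duality between $\mathcal B$ and $\mathcal B^*$. **The space $\mathcal E$.** $(\cdot,\cdot)_{1/2,1}$ denotes the real interpolation space with parameters $\theta=1/2$ and $p=1$; thus $\mathcal E$ is a Banach space with $D(A_0,\mathcal B^* )\subset\mathcal E\subset\mathcal B^*\subset\mathcal G$. *)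

theory Defs
  imports "HOL-Analysis.Analysis"
begin

section \<open>Complex Banach and Hilbert spaces\<close>

class complex_normed_space = real_normed_vector +
  fixes scaleC :: "complex \<Rightarrow> 'a \<Rightarrow> 'a"  (infixr \<open>*\<^sub>C\<close> 75)
  assumes scaleC_add_right: "c *\<^sub>C (x + y) = c *\<^sub>C x + c *\<^sub>C y"
    and scaleC_add_left: "(c + d) *\<^sub>C x = c *\<^sub>C x + d *\<^sub>C x"
    and scaleC_scaleC: "c *\<^sub>C d *\<^sub>C x = (c * d) *\<^sub>C x"
    and scaleC_of_real: "complex_of_real r *\<^sub>C x = scaleR r x"
    and norm_scaleC: "norm (c *\<^sub>C x) = cmod c * norm x"

class complex_banach = complex_normed_space + complete_space

text \<open>The scalar product is antilinear in its first argument and linear in its second. The real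
  inner product of the library is required to be its real part, so that the norm of the class
  \<open>real_inner\<close> is the Hilbert space norm.\<close>

class complex_hilbert = complex_banach + real_inner +
  fixes cinner :: "'a \<Rightarrow> 'a \<Rightarrow> complex"
  assumes cinner_commute: "cinner x y = cnj (cinner y x)"
    and cinner_add_right: "cinner x (y + z) = cinner x y + cinner x z"
    and cinner_scaleC_right: "cinner x (c *\<^sub>C y) = c * cinner x y"
    and Re_cinner: "Re (cinner x y) = inner x y"

instantiation complex :: complex_hilbert
begin

definition scaleC_complex :: "complex \<Rightarrow> complex \<Rightarrow> complex" where
  "scaleC_complex = (*)"

definition cinner_complex :: "complex \<Rightarrow> complex \<Rightarrow> complex" where
  "cinner_complex x y = cnj x * y"

instance
  by standard
    (auto simp: scaleC_complex_def cinner_complex_def algebra_simps scaleR_conv_of_real norm_mult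
      inner_complex_def)

end

definition csubspace_on :: "'a::complex_normed_space set \<Rightarrow> bool" where
  "csubspace_on S \<longleftrightarrow>
     0 \<in> S \<and> (\<forall>x\<in>S. \<forall>y\<in>S. x + y \<in> S) \<and> (\<forall>c. \<forall>x\<in>S. c *\<^sub>C x \<in> S)"

definition clinear_on ::
    "'a::complex_normed_space set \<Rightarrow> ('a \<Rightarrow> 'b::complex_normed_space) \<Rightarrow> bool" where
  "clinear_on S T \<longleftrightarrow>
     (\<forall>x\<in>S. \<forall>y\<in>S. T (x + y) = T x + T y) \<and> (\<forall>c. \<forall>x\<in>S. T (c *\<^sub>C x) = c *\<^sub>C T x)"

definition bounded_clinear ::
    "('a::complex_normed_space \<Rightarrow> 'b::complex_normed_space) \<Rightarrow> bool" where
  "bounded_clinear T \<longleftrightarrow> bounded_linear T \<and> clinear_on UNIV T"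

definition orth_complement :: "'h::complex_hilbert set \<Rightarrow> 'h set" where
  "orth_complement S = {f. \<forall>g\<in>S. cinner g f = 0}"


section \<open>Selfadjoint operators and unitary groups\<close>

definition bounded_selfadjoint :: "('h::complex_hilbert \<Rightarrow> 'h) \<Rightarrow> bool" where
  "bounded_selfadjoint T \<longleftrightarrow>
     bounded_clinear T \<and> (\<forall>f g. cinner (T f) g = cinner f (T g))"

text \<open>An unbounded operator is given by its domain \<open>D\<close> and a function \<open>A\<close> that matters on
  \<open>D\<close> only. The last clause says that \<open>A\<close> coincides, domain included, with its adjoint.\<close>

definition selfadjoint_op :: "'h::complex_hilbert set \<Rightarrow> ('h \<Rightarrow> 'h) \<Rightarrow> bool" where
  "selfadjoint_op D A \<longleftrightarrow>
     csubspace_on D \<and> closure D = UNIV \<and> clinear_on D A \<and>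
     (\<forall>f h. (\<forall>g\<in>D. cinner f (A g) = cinner h g) \<longleftrightarrow> f \<in> D \<and> A f = h)"

text \<open>\<open>M\<close> and \<open>N\<close> are meant to be orthogonal complements of each other. An everywhere defined
  operator has \<open>D = UNIV\<close>.\<close>

definition reduced_by ::
    "'h::complex_hilbert set \<Rightarrow> 'h set \<Rightarrow> 'h set \<Rightarrow> ('h \<Rightarrow> 'h) \<Rightarrow> bool" where
  "reduced_by M N D A \<longleftrightarrow>
     (\<forall>x\<in>M. \<forall>y\<in>N. x + y \<in> D \<longrightarrow> x \<in> D \<and> y \<in> D \<and> A x \<in> M \<and> A y \<in> N)"

text \<open>\<open>exp_group S D A W\<close>: in the Hilbert space given by the closed subspace \<open>S\<close>, \<open>W t = exp (\<i> t A)\<close>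
  for the operator \<open>A\<close> with domain \<open>D\<close>. The group is described through Stone's theorem, as the
  strongly continuous unitary group in \<open>S\<close> whose generator is \<open>A\<close>, with equality of domains.\<close>

definition exp_group ::
    "'h::complex_hilbert set \<Rightarrow> 'h set \<Rightarrow> ('h \<Rightarrow> 'h) \<Rightarrow> (real \<Rightarrow> 'h \<Rightarrow> 'h) \<Rightarrow> bool" where
  "exp_group S D A W \<longleftrightarrow>
     (\<forall>t. W t ` S \<subseteq> S \<and> clinear_on S (W t) \<and>
          (\<forall>f\<in>S. \<forall>g\<in>S. cinner (W t f) (W t g) = cinner f g)) \<and>
     (\<forall>f\<in>S. W 0 f = f \<and> (\<forall>s t. W (s + t) f = W s (W t f))) \<and>
     (\<forall>f\<in>S. continuous_on UNIV (\<lambda>t. W t f)) \<and>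
     (\<forall>f\<in>S. \<forall>g\<in>S.
        ((\<lambda>t. W t f) has_vector_derivative \<i> *\<^sub>C g) (at 0) \<longleftrightarrow> f \<in> D \<and> A f = g)"

definition strongly_differentiable ::
    "(real \<Rightarrow> 'a \<Rightarrow> 'b::real_normed_vector) \<Rightarrow> bool" where
  "strongly_differentiable T \<longleftrightarrow> (\<forall>f t. (\<lambda>s. T s f) differentiable (at t))"

text \<open>The operator \<open>\<i>[H, A]\<close>, where \<open>W t = exp (\<i> t A)\<close>; meaningful if \<open>H\<close> is of class \<open>C\<^sup>1(A)\<close>.\<close>

definition i_commutator :: "(real \<Rightarrow> 'h \<Rightarrow> 'h) \<Rightarrow> ('h::complex_hilbert \<Rightarrow> 'h) \<Rightarrow> 'h \<Rightarrow> 'h" where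
  "i_commutator W H f = vector_derivative (\<lambda>t. W (- t) (H (W t f))) (at 0)"


section \<open>Completions and groups in Banach spaces\<close>

text \<open>\<open>j\<close> identifies the subspace \<open>S\<close>, normed by \<open>N\<close>, with a dense subspace of the Banach space
  \<open>'b\<close>. This determines \<open>'b\<close> up to isometric isomorphism.\<close>

definition completion_of ::
    "'a::complex_normed_space set \<Rightarrow> ('a \<Rightarrow> real) \<Rightarrow> ('a \<Rightarrow> 'b::complex_banach) \<Rightarrow> bool" where
  "completion_of S N j \<longleftrightarrow>
     clinear_on S j \<and> (\<forall>f\<in>S. norm (j f) = N f) \<and> closure (j ` S) = UNIV"

definition C0_group :: "(real \<Rightarrow> 'b::complex_banach \<Rightarrow> 'b) \<Rightarrow> bool" where
  "C0_group U \<longleftrightarrow>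
     (\<forall>t. bounded_clinear (U t)) \<and> (\<forall>x. U 0 x = x) \<and>
     (\<forall>s t x. U (s + t) x = U s (U t x)) \<and> (\<forall>x. continuous_on UNIV (\<lambda>t. U t x))"

definition gen_dom :: "(real \<Rightarrow> 'b::complex_banach \<Rightarrow> 'b) \<Rightarrow> 'b set" where
  "gen_dom U = {x. (\<lambda>t. U t x) differentiable (at 0)}"

text \<open>Generators are normalised by \<open>U t = exp (\<i> t generator)\<close>.\<close>

definition generator :: "(real \<Rightarrow> 'b::complex_banach \<Rightarrow> 'b) \<Rightarrow> 'b \<Rightarrow> 'b" where
  "generator U x = (- \<i>) *\<^sub>C vector_derivative (\<lambda>t. U t x) (at 0)"

definition graph_norm :: "(real \<Rightarrow> 'b::complex_banach \<Rightarrow> 'b) \<Rightarrow> 'b \<Rightarrow> real" where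
  "graph_norm U x = norm x + norm (generator U x)"

text \<open>The restriction of a group \<open>W\<close> to a space embedded by the injective map \<open>e\<close>.\<close>

definition restrict_group :: "('d \<Rightarrow> 'h) \<Rightarrow> (real \<Rightarrow> 'h \<Rightarrow> 'h) \<Rightarrow> real \<Rightarrow> 'd \<Rightarrow> 'd" where
  "restrict_group e W t x = inv e (W t (e x))"


section \<open>Real interpolation (K-method)\<close>

text \<open>The couple consists of the subspaces \<open>X0\<close>, \<open>X1\<close> of a common vector space, normed by
  \<open>N0\<close>, \<open>N1\<close>; \<open>p\<close> is finite.\<close>

definition K_functional ::
    "'x::real_vector set \<Rightarrow> ('x \<Rightarrow> real) \<Rightarrow> 'x set \<Rightarrow> ('x \<Rightarrow> real) \<Rightarrow> real \<Rightarrow> 'x \<Rightarrow> real" where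
  "K_functional X0 N0 X1 N1 t x =
     Inf {N0 y + t * N1 z | y z. y \<in> X0 \<and> z \<in> X1 \<and> x = y + z}"

definition interp_integral ::
    "'x::real_vector set \<Rightarrow> ('x \<Rightarrow> real) \<Rightarrow> 'x set \<Rightarrow> ('x \<Rightarrow> real) \<Rightarrow>
      real \<Rightarrow> real \<Rightarrow> 'x \<Rightarrow> ennreal" where
  "interp_integral X0 N0 X1 N1 \<theta> p x =
     (\<integral>\<^sup>+ t \<in> {0<..}. ennreal ((t powr (- \<theta>) * K_functional X0 N0 X1 N1 t x) powr p / t) \<partial>lborel)"

definition interp_space ::
    "'x::real_vector set \<Rightarrow> ('x \<Rightarrow> real) \<Rightarrow> 'x set \<Rightarrow> ('x \<Rightarrow> real) \<Rightarrow>
      real \<Rightarrow> real \<Rightarrow> 'x set" where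
  "interp_space X0 N0 X1 N1 \<theta> p =
     {x. (\<exists>y\<in>X0. \<exists>z\<in>X1. x = y + z) \<and> interp_integral X0 N0 X1 N1 \<theta> p x < \<infinity>}"

definition interp_norm ::
    "'x::real_vector set \<Rightarrow> ('x \<Rightarrow> real) \<Rightarrow> 'x set \<Rightarrow> ('x \<Rightarrow> real) \<Rightarrow>
      real \<Rightarrow> real \<Rightarrow> 'x \<Rightarrow> real" where
  "interp_norm X0 N0 X1 N1 \<theta> p x = enn2real (interp_integral X0 N0 X1 N1 \<theta> p x) powr (1 / p)"


section \<open>Resolvent and spectral measure of an operator in a closed subspace\<close>

definition resolvent_on ::
    "'h::complex_hilbert set \<Rightarrow> ('h \<Rightarrow> 'h) \<Rightarrow> complex \<Rightarrow> 'h \<Rightarrow> 'h" where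
  "resolvent_on S T z = inv_into S (\<lambda>g. T g - z *\<^sub>C g)"

definition projection_valued_measure_on ::
    "'h::complex_hilbert set \<Rightarrow> (real set \<Rightarrow> 'h \<Rightarrow> 'h) \<Rightarrow> bool" where
  "projection_valued_measure_on S E \<longleftrightarrow>
     (\<forall>X\<in>sets borel. E X ` S \<subseteq> S \<and> clinear_on S (E X) \<and> (\<forall>f\<in>S. E X (E X f) = E X f) \<and>
        (\<forall>f\<in>S. \<forall>g\<in>S. cinner (E X f) g = cinner f (E X g))) \<and>
     (\<forall>f\<in>S. E UNIV f = f) \<and>
     (\<forall>X. range X \<subseteq> sets borel \<longrightarrow> disjoint_family X \<longrightarrow>
        (\<forall>f\<in>S. (\<lambda>n. E (X n) f) sums E (\<Union>n. X n) f))"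

definition scalar_measure ::
    "(real set \<Rightarrow> 'h \<Rightarrow> 'h) \<Rightarrow> 'h::complex_hilbert \<Rightarrow> real measure" where
  "scalar_measure E f = measure_of UNIV (sets borel) (\<lambda>X. ennreal (Re (cinner f (E X f))))"

text \<open>\<open>T = \<integral> x dE(x)\<close> as an everywhere defined operator in \<open>S\<close>; the integrability of \<open>x\<^sup>2\<close>
  expresses that every element of \<open>S\<close> is in the domain of the integral.\<close>

definition spectral_measure_of ::
    "'h::complex_hilbert set \<Rightarrow> ('h \<Rightarrow> 'h) \<Rightarrow> (real set \<Rightarrow> 'h \<Rightarrow> 'h) \<Rightarrow> bool" where
  "spectral_measure_of S T E \<longleftrightarrow>
     projection_valued_measure_on S E \<and>
     (\<forall>f\<in>S. integrable (scalar_measure E f) (\<lambda>x. x\<^sup>2) \<and>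
        cinner f (T f) = complex_of_real (\<integral>x. x \<partial>scalar_measure E f))"

text \<open>By the spectral theorem, a bounded selfadjoint operator has exactly one spectral measure (up
  to its values outside \<open>S\<close> and on non-Borel sets).\<close>

definition purely_ac_spectrum_on :: "'h::complex_hilbert set \<Rightarrow> ('h \<Rightarrow> 'h) \<Rightarrow> bool" where
  "purely_ac_spectrum_on S T \<longleftrightarrow>
     (\<forall>E. spectral_measure_of S T E \<longrightarrow>
        (\<forall>f\<in>S. absolutely_continuous lborel (scalar_measure E f)))"

end

theory Submission
  imports Defs
begin

text \<open>The method of the weakly conjugate operator: for \<open>R \<epsilon> = (H - z - i \<epsilon> K\<^sup>2)\<inverse>\<close> on \<open>\<G>\<close>, the
  identity \<open>K\<^sup>2 = i [H, A]\<close> turns the \<open>\<epsilon>\<close>-derivative of \<open>\<langle>f, R \<epsilon> g\<rangle>\<close> into terms with \<open>A f\<close>, \<open>A g\<close> and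
  \<open>\<epsilon> [K\<^sup>2, A]\<close>, all controlled by \<open>\<parallel>K R \<epsilon> g\<parallel> \<le> (\<bar>\<langle>g, R \<epsilon> g\<rangle>\<bar> / \<epsilon>)\<^sup>1\<^sup>/\<^sup>2\<close>. Integrating first for \<open>f = g\<close> and then
  in general gives \<open>\<bar>\<langle>f, R 0 g\<rangle>\<bar> \<le> c (p\<^sub>f N\<^sub>f p\<^sub>g N\<^sub>g)\<^sup>1\<^sup>/\<^sup>2\<close>, where \<open>p\<close> is the \<open>\<B>\<close>* norm and \<open>N\<close> the graph norm,
  uniformly in \<open>z\<close>; summing over a dyadic decomposition of an element of \<open>\<E>\<close> yields the estimate. Absolute
  continuity follows since the bound forces \<open>\<parallel>E(I) f\<parallel>\<^sup>2\<close> to be \<open>O(\<bar>I\<bar>)\<close> for all \<open>f\<close> in a set that is total for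
  the spectral projections.\<close>

section \<open>Complex inner products\<close>

text \<open>The parameters of \<open>\<E>\<close> are dictated by the estimate. For
  \<open>F s = \<langle>f, R s z f\<rangle>\<close> the commutator identity bounds
  \<open>\<bar>F'\<bar>\<close> by
  \<open>2 N (\<bar>F\<bar> / s)^(1/2) + \<kappa> \<bar>F\<bar>\<close>, whose singularity at
  \<open>s = 0\<close> is integrable, while coercivity and duality alone give
  \<open>\<bar>F\<bar> \<le> p\<^sup>2 / s\<close>. The two balance at \<open>s\<close> of order
  \<open>p / N\<close> and leave \<open>p N\<close>: one geometric mean of the two norms for each
  argument, and sums of such means are what the K-method with exponents 1/2 and 1 controls. Only the
  sign of \<open>Im z\<close> enters the constants, whence the uniformity. Two obstacles shape the
  rest. \<open>A\<close> is unbounded and resolvents need not preserve its domain, so derivatives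
  are taken along orbits of the group. The completions are abstract spaces, so the estimate is kept
  inside \<open>\<G>\<close>: there the norm of \<open>\<B>\<close> is \<open>norm (K u)\<close>,
  and the dual norm of \<open>f\<close> is at most \<open>p\<close> if
  \<open>\<bar>\<langle>f, u\<rangle>\<bar> \<le> p * norm (K u)\<close> for all
  \<open>u\<close>.\<close>

lemma scaleC_one [simp]: "1 *\<^sub>C (x::'a::complex_normed_space) = x"
  using scaleC_of_real[of 1 x] by simp

lemma bounded_linear_scaleC: "bounded_linear (\<lambda>x::'a::complex_normed_space. c *\<^sub>C x)"
proof
  show "c *\<^sub>C (x + y) = c *\<^sub>C x + c *\<^sub>C y" for x y :: 'a
    by (rule scaleC_add_right)
  show "c *\<^sub>C r *\<^sub>R x = r *\<^sub>R c *\<^sub>C x" for r and x :: 'a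
    by (simp add: scaleC_of_real[symmetric] scaleC_scaleC mult.commute)
  show "\<exists>k. \<forall>x::'a. norm (c *\<^sub>C x) \<le> norm x * k"
    by (intro exI[of _ "cmod c"]) (simp add: norm_scaleC mult.commute)
qed

lemma scaleC_minus_one [simp]: "(-1) *\<^sub>C (x::'a::complex_normed_space) = - x"
  using scaleC_of_real[of "-1" x] by simp

lemma scaleC_zero_right [simp]: "c *\<^sub>C (0::'a::complex_normed_space) = 0"
  by (rule linear_0[OF bounded_linear.linear[OF bounded_linear_scaleC]])

lemma scaleC_diff_left: "(c - d) *\<^sub>C x = c *\<^sub>C x - d *\<^sub>C (x::'a::complex_normed_space)"
  using scaleC_add_left[of "c - d" d x] by (simp add: algebra_simps)

lemma cinner_add_left: "cinner (x + y) z = cinner x z + cinner (y::'a::complex_hilbert) z"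
  by (metis cinner_add_right cinner_commute complex_cnj_add)

lemma cinner_scaleC_left: "cinner (c *\<^sub>C x) y = cnj c * cinner (x::'a::complex_hilbert) y"
  by (metis cinner_commute cinner_scaleC_right complex_cnj_mult)

lemma cinner_self: "cinner x x = complex_of_real ((norm (x::'a::complex_hilbert))\<^sup>2)"
proof (rule complex_eqI)
  show "Re (cinner x x) = Re (complex_of_real ((norm x)\<^sup>2))"
    by (simp add: Re_cinner power2_norm_eq_inner)
  have "Im (cinner x x) = - Im (cinner x x)"
    by (metis cinner_commute cnj.simps(2))
  then show "Im (cinner x x) = Im (complex_of_real ((norm x)\<^sup>2))"
    by simp
qed

lemma norm_cinner_le: "cmod (cinner x y) \<le> norm (x::'a::complex_hilbert) * norm y"
proof (cases "cinner x y = 0")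
  case False
  \<comment> \<open>The unimodular factor \<open>c\<close> makes the product real and nonnegative,
    so the real Cauchy-Schwarz inequality applies to \<open>c *\<^sub>C y\<close>.\<close>
  define c where "c = cnj (sgn (cinner x y))"
  have "cmod (cinner x y) = Re (c * cinner x y)"
    using False unfolding c_def sgn_div_norm
    by (simp add: complex_mult_cnj cmod_power2[symmetric] power2_eq_square scaleR_conv_of_real)
       (simp add: cmod_def power2_eq_square divide_simps)
  also have "\<dots> = inner x (c *\<^sub>C y)"
    by (simp add: cinner_scaleC_right flip: Re_cinner)
  also have "\<dots> \<le> norm x * norm (c *\<^sub>C y)"
    by (rule norm_cauchy_schwarz)
  also have "\<dots> = norm x * norm y"
    using False by (simp add: norm_scaleC c_def norm_sgn)
  finally show ?thesis .
qed simp

lemma bounded_bilinear_cinner: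
  "bounded_bilinear (cinner :: 'a::complex_hilbert \<Rightarrow> 'a \<Rightarrow> complex)"
proof
  show "cinner (r *\<^sub>R x) y = r *\<^sub>R cinner x y" for r and x y :: 'a
    by (simp only: scaleC_of_real[symmetric] cinner_scaleC_left)
       (simp add: scaleC_of_real scaleR_conv_of_real)
  show "cinner x (r *\<^sub>R y) = r *\<^sub>R cinner x y" for r and x y :: 'a
    by (simp only: scaleC_of_real[symmetric] cinner_scaleC_right)
       (simp add: scaleC_of_real scaleR_conv_of_real)
  show "\<exists>K. \<forall>x y::'a. cmod (cinner x y) \<le> norm x * norm y * K"
    by (intro exI[of _ 1]) (simp add: norm_cinner_le)
qed (simp_all add: cinner_add_left cinner_add_right)

interpretation cinner: bounded_bilinear "cinner :: 'a::complex_hilbert \<Rightarrow> 'a \<Rightarrow> complex"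
  by (rule bounded_bilinear_cinner)

lemma cinner_eqI:
  fixes x y :: "'a::complex_hilbert"
  assumes "\<And>g. g \<in> S \<Longrightarrow> cinner g x = cinner g y" and "x - y \<in> S"
  shows "x = y"
proof -
  have "cinner (x - y) (x - y) = 0"
    using assms(1)[OF assms(2)] by (simp add: cinner.diff_right)
  then show ?thesis by (simp add: cinner_self)
qed

lemma tendsto_cinner [tendsto_intros]:
  "(f \<longlongrightarrow> a) F \<Longrightarrow> (g \<longlongrightarrow> b) F \<Longrightarrow> ((\<lambda>x. cinner (f x) (g x)) \<longlongrightarrow> cinner a (b::'a::complex_hilbert)) F"
  by (rule cinner.tendsto)

lemma csubspace_onD:
  assumes "csubspace_on S"
  shows "0 \<in> S" "x \<in> S \<Longrightarrow> y \<in> S \<Longrightarrow> x + y \<in> S" "x \<in> S \<Longrightarrow> c *\<^sub>C x \<in> S"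
    "x \<in> S \<Longrightarrow> y \<in> S \<Longrightarrow> x - y \<in> S" "x \<in> S \<Longrightarrow> r *\<^sub>R x \<in> S" "x \<in> S \<Longrightarrow> - x \<in> S"
    "subspace S"
proof -
  note S = assms[unfolded csubspace_on_def]
  show "0 \<in> S" and add: "x \<in> S \<Longrightarrow> y \<in> S \<Longrightarrow> x + y \<in> S" for x y
    using S by auto
  show scale: "x \<in> S \<Longrightarrow> c *\<^sub>C x \<in> S" for x c using S by auto
  show R: "x \<in> S \<Longrightarrow> r *\<^sub>R x \<in> S" for x r
    using scale[of x "of_real r"] by (simp add: scaleC_of_real)
  show m: "x \<in> S \<Longrightarrow> - x \<in> S" for x using scale[of x "-1"] by simp
  show "x \<in> S \<Longrightarrow> y \<in> S \<Longrightarrow> x - y \<in> S" for x y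
    using add[of x "- y"] m by simp
  show "subspace S" unfolding subspace_def using S R by auto
qed

lemma clinear_onD:
  assumes "clinear_on S T" "csubspace_on S"
  shows "x \<in> S \<Longrightarrow> y \<in> S \<Longrightarrow> T (x + y) = T x + T y"
    "x \<in> S \<Longrightarrow> T (c *\<^sub>C x) = c *\<^sub>C T x"
    "x \<in> S \<Longrightarrow> y \<in> S \<Longrightarrow> T (x - y) = T x - T y"
    "x \<in> S \<Longrightarrow> T (r *\<^sub>R x) = r *\<^sub>R T x" "T 0 = 0" "x \<in> S \<Longrightarrow> T (- x) = - T x"
proof -
  note S = csubspace_onD[OF assms(2)]
  show add: "x \<in> S \<Longrightarrow> y \<in> S \<Longrightarrow> T (x + y) = T x + T y" for x y
    using assms unfolding clinear_on_def by auto
  show sc: "x \<in> S \<Longrightarrow> T (c *\<^sub>C x) = c *\<^sub>C T x" for c x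
    using assms unfolding clinear_on_def by auto
  show "x \<in> S \<Longrightarrow> T (r *\<^sub>R x) = r *\<^sub>R T x" for r x
    using sc[of x "of_real r"] by (simp add: scaleC_of_real)
  show m: "x \<in> S \<Longrightarrow> T (- x) = - T x" for x
    using sc[of x "-1"] by simp
  show "x \<in> S \<Longrightarrow> y \<in> S \<Longrightarrow> T (x - y) = T x - T y" for x y
    using add[of x "- y"] m S(6) by simp
  show "T 0 = 0" using add[of 0 0] S(1) by simp
qed

lemma csubspace_on_UNIV: "csubspace_on UNIV"
  by (simp add: csubspace_on_def)

lemma bounded_clinearD:
  assumes "bounded_clinear T"
  shows "bounded_linear T" "clinear_on UNIV T" "T (c *\<^sub>C x) = c *\<^sub>C T x"
  using assms unfolding bounded_clinear_def clinear_on_def by auto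

lemma orth_complement_csubspace: "csubspace_on (orth_complement (S::'a::complex_hilbert set))"
  unfolding csubspace_on_def orth_complement_def
  by (auto simp: cinner_add_right cinner_scaleC_right cinner.zero_right)

lemma orth_complement_closed: "closed (orth_complement (S::'a::complex_hilbert set))"
proof -
  have "orth_complement S = (\<Inter>g\<in>S. {f. cinner g f = 0})"
    by (auto simp: orth_complement_def)
  moreover have "closed {f. cinner g f = 0}" for g :: 'a
    by (intro closed_Collect_eq continuous_intros bounded_linear.continuous_on[OF cinner.bounded_linear_right])
  ultimately show ?thesis by auto
qed

section \<open>Functional analytic tools\<close>

text \<open>Derivatives of orbits are handled as limits of difference quotients, to which linear and
  isometric operators can be applied before the limit is taken.\<close>

lemma has_vector_derivative_iff_quotient:
  "(f has_vector_derivative f') (at a) \<longleftrightarrow> ((\<lambda>h. (f (a + h) - f a) /\<^sub>R h) \<longlongrightarrow> f') (at 0)"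
proof -
  have "(f has_vector_derivative f') (at a) \<longleftrightarrow>
      ((\<lambda>h. norm (f (a + h) - f a - h *\<^sub>R f') / norm h) \<longlongrightarrow> 0) (at 0)"
    by (simp add: has_vector_derivative_def has_derivative_at bounded_linear_scaleR_left)
  also have "\<dots> \<longleftrightarrow> ((\<lambda>h. norm ((f (a + h) - f a) /\<^sub>R h - f')) \<longlongrightarrow> 0) (at 0)"
  proof (rule tendsto_cong, rule eventually_at_filter[THEN iffD2], intro always_eventually allI impI)
    fix h :: real assume "h \<noteq> 0"
    then have "(f (a + h) - f a) /\<^sub>R h - f' = (f (a + h) - f a - h *\<^sub>R f') /\<^sub>R h"
      by (simp add: scaleR_diff_right)
    then show "norm (f (a + h) - f a - h *\<^sub>R f') / norm h = norm ((f (a + h) - f a) /\<^sub>R h - f')"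
      by (simp add: divide_inverse mult.commute)
  qed
  also have "\<dots> \<longleftrightarrow> ((\<lambda>h. (f (a + h) - f a) /\<^sub>R h) \<longlongrightarrow> f') (at 0)"
    by (metis (no_types) LIM_zero_iff tendsto_norm_zero_iff)
  finally show ?thesis .
qed

lemmas has_vector_derivative_0_iff = has_vector_derivative_iff_quotient[where a = 0, simplified]

text \<open>Sokal's argument: a bounded linear map of large norm is large at one of two antipodal points
  of any given ball.\<close>

lemma bounded_linear_ball_attain:
  assumes T: "bounded_linear T" and r: "r > 0" and M: "\<not> (\<forall>x. norm (T x) \<le> M * norm x)"
  shows "\<exists>y. norm (y - x) \<le> r \<and> norm (T y) > r * M"
proof -
  interpret T: bounded_linear T by (rule T)
  obtain z where z: "norm (T z) > M * norm z" using M by (auto simp: not_le)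
  have z0: "norm z > 0" using z by (cases "z = 0") auto
  define u where "u = (r / norm z) *\<^sub>R z"
  have nu: "norm u = r" using z0 r by (simp add: u_def)
  have "r * M = (r / norm z) * (M * norm z)" using z0 by simp
  also have "\<dots> < (r / norm z) * norm (T z)" using z z0 r by (intro mult_strict_left_mono) auto
  also have "\<dots> = norm (T u)" using z0 r by (simp add: u_def T.scaleR)
  finally have u: "norm (T u) > r * M" .
  have "2 * norm (T u) = norm (T (x + u) - T (x - u))"
    by (simp add: T.add T.diff flip: scaleR_2)
  also have "\<dots> \<le> norm (T (x + u)) + norm (T (x - u))" by (rule norm_triangle_ineq4)
  finally have "norm (T (x + u)) > r * M \<or> norm (T (x - u)) > r * M"
    using u by linarith
  then show ?thesis
  proof
    assume "norm (T (x + u)) > r * M"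
    then show ?thesis using nu by (intro exI[of _ "x + u"]) simp
  next
    assume "norm (T (x - u)) > r * M"
    then show ?thesis using nu by (intro exI[of _ "x - u"]) simp
  qed
qed

text \<open>Gliding hump without Baire: consecutive points \<open>X n\<close> are at most
  \<open>(1/3)^n\<close> apart, so the limit \<open>x\<close> lies within \<open>(1/3)^n / 2\<close>
  of the point where \<open>T n\<close> is at least two thirds of
  \<open>(1/3)^n * onorm (T n)\<close>. One sixth survives the difference, and
  \<open>onorm (T n) > 4^n\<close> makes \<open>(4/3)^n / 6\<close> unbounded.\<close>

theorem banach_steinhaus:
  fixes \<F> :: "('a::banach \<Rightarrow> 'b::real_normed_vector) set"
  assumes lin: "\<And>T. T \<in> \<F> \<Longrightarrow> bounded_linear T"
    and ptw: "\<And>x. \<exists>M. \<forall>T\<in>\<F>. norm (T x) \<le> M"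
  shows "\<exists>M. \<forall>T\<in>\<F>. \<forall>x. norm (T x) \<le> M * norm x"
proof (rule ccontr)
  assume "\<not> ?thesis"
  then have ex: "\<exists>T\<in>\<F>. \<not> (\<forall>x. norm (T x) \<le> M * norm x)" for M
    by (meson less_imp_le not_le order.trans)
  define r :: "nat \<Rightarrow> real" where "r n = (1/3) ^ n" for n
  have rpos: "r n > 0" for n by (simp add: r_def)
  have "\<forall>n. \<exists>T. T \<in> \<F> \<and> \<not> (\<forall>x. norm (T x) \<le> (4 ^ n) * norm x)"
    using ex by blast
  then obtain T where T: "\<And>n. T n \<in> \<F>" "\<And>n. \<not> (\<forall>x. norm (T n x) \<le> (4 ^ n) * norm x)"
    by metis
  define q where "q n = onorm (T n)" for n
  have q: "q n > 4 ^ n" for n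
  proof (rule ccontr)
    assume "\<not> q n > 4 ^ n"
    then have "norm (T n x) \<le> 4 ^ n * norm x" for x
      using order.trans[OF onorm[OF lin[OF T(1)]] mult_right_mono] unfolding q_def
      by (meson norm_ge_zero not_le)
    with T(2) show False by blast
  qed
  have q0: "q n > 0" for n using q[of n] by (meson less_trans zero_less_numeral zero_less_power)
  have T': "\<not> (\<forall>x. norm (T n x) \<le> (2/3 * q n) * norm x)" for n
  proof
    assume "\<forall>x. norm (T n x) \<le> (2/3 * q n) * norm x"
    then have "q n \<le> 2/3 * q n" unfolding q_def by (intro onorm_bound) (use q0[of n] in \<open>auto simp: q_def\<close>)
    with q0[of n] show False by simp
  qed
  have step: "\<forall>n x. \<exists>y. norm (y - x) \<le> r n \<and> norm (T n y) > r n * (2/3 * q n)"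
    using bounded_linear_ball_attain[OF lin[OF T(1)] rpos T'] by blast
  obtain g where g: "\<And>n x. norm (g n x - x) \<le> r n" "\<And>n x. norm (T n (g n x)) > r n * (2/3 * q n)"
    using step by metis
  define X where "X = rec_nat 0 g"
  have X0: "X 0 = 0" by (simp add: X_def)
  have X: "X (Suc n) = g n (X n)" for n by (simp add: X_def)
  have Xd: "norm (X (Suc n) - X n) \<le> r n" for n using g(1) by (simp add: X)
  have "summable (\<lambda>n. X (Suc n) - X n)"
    by (rule summable_comparison_test[of _ r])
       (use Xd in \<open>auto simp: r_def[abs_def] intro!: summable_geometric\<close>)
  then have "convergent (\<lambda>n. \<Sum>i<n. X (Suc i) - X i)"
    by (simp add: summable_iff_convergent)
  moreover have "(\<Sum>i<n. X (Suc i) - X i) = X n" for n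
    using sum_lessThan_telescope[of X n] by (simp add: X0)
  ultimately obtain x where x: "X \<longlonglongrightarrow> x" by (auto simp: convergent_def)
  have tail: "norm (X (n + k) - X n) \<le> r n * (3/2) * (1 - (1/3)^k)" for n k
  proof (induction k)
    case (Suc k)
    have "norm (X (n + Suc k) - X n) \<le> norm (X (Suc (n + k)) - X (n + k)) + norm (X (n + k) - X n)"
      by (metis add_Suc_right diff_add_cancel add_diff_eq norm_triangle_ineq)
    also have "\<dots> \<le> r (n + k) + r n * (3/2) * (1 - (1/3)^k)"
      using Xd Suc by (intro add_mono) auto
    also have "\<dots> = r n * (3/2) * (1 - (1/3)^Suc k)"
      by (simp add: r_def power_add field_simps)
    finally show ?case .
  qed simp
  have xX: "norm (x - X (Suc n)) \<le> r n / 2" for n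
  proof (rule LIMSEQ_le_const2)
    show "(\<lambda>k. norm (X (k + Suc n) - X (Suc n))) \<longlonglongrightarrow> norm (x - X (Suc n))"
      by (intro tendsto_intros LIMSEQ_ignore_initial_segment x)
    have "norm (X (k + Suc n) - X (Suc n)) \<le> r n / 2" for k
    proof -
      have "norm (X (k + Suc n) - X (Suc n)) \<le> r (Suc n) * (3/2) * (1 - (1/3)^k)"
        using tail[of "Suc n" k] by (simp add: add.commute)
      also have "\<dots> \<le> r (Suc n) * (3/2) * 1"
        using rpos[of "Suc n"] by (intro mult_left_mono) auto
      finally show ?thesis by (simp add: r_def)
    qed
    then show "\<exists>N. \<forall>k\<ge>N. norm (X (k + Suc n) - X (Suc n)) \<le> r n / 2" by blast
  qed
  obtain M where M: "\<And>S. S \<in> \<F> \<Longrightarrow> norm (S x) \<le> M" using ptw[of x] by blast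
  have big: "norm (T n x) > (4/3) ^ n / 6" for n
  proof -
    interpret Tn: bounded_linear "T n" by (rule lin[OF T(1)])
    have "r n * (2/3 * q n) < norm (T n (X (Suc n)))" using g(2) by (simp add: X)
    also have "\<dots> \<le> norm (T n x) + norm (T n (x - X (Suc n)))"
      using norm_triangle_ineq4[of "T n x" "T n (x - X (Suc n))"] by (simp add: Tn.diff)
    also have "norm (T n (x - X (Suc n))) \<le> q n * norm (x - X (Suc n))"
      unfolding q_def by (rule onorm[OF lin[OF T(1)]])
    also have "\<dots> \<le> q n * (r n / 2)" using xX q0[of n] by (intro mult_left_mono) auto
    finally have "norm (T n x) > r n * q n / 6" by (simp add: mult.commute[of "q n"])
    moreover have "r n * q n > r n * 4 ^ n" using q[of n] rpos[of n] by simp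
    moreover have "r n * 4 ^ n = (4/3) ^ n"
      by (simp add: r_def power_mult_distrib[symmetric])
    ultimately show ?thesis by linarith
  qed
  obtain n where "(4/3::real) ^ n > 6 * M" using real_arch_pow[of "4/3" "6 * M"] by auto
  with big[of n] M[OF T(1), of n] show False by linarith
qed

text \<open>The Riesz representation theorem for the completion of \<open>M\<close> in the seminorm \<open>norm (T f)\<close>,
  by minimising \<open>(norm (T f))\<^sup>2 / 2 - \<phi> f\<close>.\<close>

lemma riesz_seminorm:
  fixes T :: "'a::real_vector \<Rightarrow> 'b::{real_inner,complete_space}"
  assumes M: "subspace M"
    and Tadd: "\<And>f g. f \<in> M \<Longrightarrow> g \<in> M \<Longrightarrow> T (f + g) = T f + T g"
    and Tsc: "\<And>f r. f \<in> M \<Longrightarrow> T (r *\<^sub>R f) = r *\<^sub>R T f"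
    and padd: "\<And>f g. f \<in> M \<Longrightarrow> g \<in> M \<Longrightarrow> \<phi> (f + g) = \<phi> f + (\<phi> g :: real)"
    and psc: "\<And>f r. f \<in> M \<Longrightarrow> \<phi> (r *\<^sub>R f) = r * \<phi> f"
    and bd: "\<And>f. f \<in> M \<Longrightarrow> \<bar>\<phi> f\<bar> \<le> c * norm (T f)"
  obtains w k where "range w \<subseteq> M" "(\<lambda>n. T (w n)) \<longlonglongrightarrow> k" "\<And>f. f \<in> M \<Longrightarrow> inner (T f) k = \<phi> f"
proof -
  define J where "J f = (norm (T f))\<^sup>2 / 2 - \<phi> f" for f
  have J0: "J f \<ge> - (c\<^sup>2 / 2)" if "f \<in> M" for f
  proof -
    have "0 \<le> (norm (T f) - c)\<^sup>2" by simp
    then show ?thesis using bd[OF that] unfolding J_def by (simp add: power2_diff algebra_simps)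
  qed
  define m where "m = Inf (J ` M)"
  have Mne: "M \<noteq> {}" using M by (auto simp: subspace_def)
  have bb: "bdd_below (J ` M)" using J0 by (auto intro!: bdd_belowI)
  have m: "m \<le> J f" if "f \<in> M" for f unfolding m_def using bb that by (auto intro: cInf_lower)
  have "\<exists>f\<in>M. J f < m + 1 / Suc n" for n
    using cInf_lessD[of "J ` M" "m + 1 / Suc n"] Mne by (auto simp: m_def)
  then obtain w where w: "\<And>n. w n \<in> M" "\<And>n. J (w n) < m + 1 / Suc n" by metis
  \<comment> \<open>The midpoint lies in \<open>M\<close>, so its value of \<open>J\<close> is at
    least \<open>m\<close>; the parallelogram law then makes minimising sequences Cauchy.\<close>
  have para: "(norm (T f - T g))\<^sup>2 \<le> 4 * (J f - m) + 4 * (J g - m)" if fg: "f \<in> M" "g \<in> M" for f g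
  proof -
    have fg': "f + g \<in> M" using M fg by (auto simp: subspace_def)
    have "m \<le> J ((1/2) *\<^sub>R (f + g))" using M fg' by (intro m) (auto simp: subspace_def)
    also have "\<dots> = (norm (T f + T g))\<^sup>2 / 8 - (\<phi> f + \<phi> g) / 2"
      unfolding J_def by (simp add: Tsc[OF fg'] psc[OF fg'] Tadd[OF fg] padd[OF fg] power_divide)
    also have "(norm (T f + T g))\<^sup>2 = 2 * (norm (T f))\<^sup>2 + 2 * (norm (T g))\<^sup>2 - (norm (T f - T g))\<^sup>2"
      by (simp add: power2_norm_eq_inner algebra_simps)
    finally show ?thesis unfolding J_def by argo
  qed
  have "Cauchy (\<lambda>n. T (w n))"
  proof (rule CauchyI)
    fix e :: real assume e: "e > 0"
    obtain N where N: "1 / Suc N < e\<^sup>2 / 8" using e nat_approx_posE[of "e\<^sup>2/8"] by auto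
    show "\<exists>N. \<forall>a\<ge>N. \<forall>b\<ge>N. norm (T (w a) - T (w b)) < e"
    proof (intro exI allI impI)
      fix a b assume ab: "N \<le> a" "N \<le> b"
      have "J (w a) - m < e\<^sup>2/8"
        using w(2)[of a] N ab frac_le[of 1 1 "real (Suc N)" "real (Suc a)"] by simp
      moreover have "J (w b) - m < e\<^sup>2/8"
        using w(2)[of b] N ab frac_le[of 1 1 "real (Suc N)" "real (Suc b)"] by simp
      ultimately have "(norm (T (w a) - T (w b)))\<^sup>2 < e\<^sup>2"
        using para[OF w(1) w(1), of a b] by simp
      then show "norm (T (w a) - T (w b)) < e" using e by (simp add: power2_less_imp_less)
    qed
  qed
  then obtain k where k: "(\<lambda>n. T (w n)) \<longlonglongrightarrow> k" using convergent_eq_Cauchy by blast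
  have Jw: "(\<lambda>n. J (w n)) \<longlonglongrightarrow> m"
  proof (rule tendsto_sandwich[of "\<lambda>_. m"])
    show "\<forall>\<^sub>F n in sequentially. J (w n) \<le> m + inverse (real (Suc n))"
      using w(2) by (auto simp: inverse_eq_divide intro!: always_eventually less_imp_le)
    show "(\<lambda>n. m + inverse (real (Suc n))) \<longlonglongrightarrow> m"
      using tendsto_add[OF tendsto_const[of m] LIMSEQ_inverse_real_of_nat] by simp
  qed (use m w in auto)
  have "inner (T f) k = \<phi> f" if f: "f \<in> M" for f
  proof -
    define d where "d = inner (T f) k - \<phi> f"
    \<comment> \<open>Comparing \<open>J\<close> at \<open>w n + s *\<^sub>R f\<close> with its
      infimum gives, in the limit, a quadratic polynomial in \<open>s\<close> that is nonnegative
      although it vanishes at \<open>0\<close>; hence its linear coefficient \<open>d\<close> is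
      zero.\<close>
    have q: "0 \<le> s * d + s\<^sup>2 * (norm (T f))\<^sup>2 / 2" for s
    proof (rule LIMSEQ_le_const)
      show "(\<lambda>n. (J (w n) - m) + (s * (inner (T f) (T (w n)) - \<phi> f) + s\<^sup>2 * (norm (T f))\<^sup>2 / 2))
          \<longlonglongrightarrow> s * d + s\<^sup>2 * (norm (T f))\<^sup>2 / 2"
        unfolding d_def by (rule tendsto_eq_intros Jw k refl | simp)+
      show "\<exists>N. \<forall>n\<ge>N. 0 \<le> (J (w n) - m) + (s * (inner (T f) (T (w n)) - \<phi> f) + s\<^sup>2 * (norm (T f))\<^sup>2 / 2)"
      proof (intro exI allI impI)
        fix n
        have sf: "s *\<^sub>R f \<in> M" using M f by (auto simp: subspace_def)
        have "m \<le> J (w n + s *\<^sub>R f)" using M w(1) sf by (intro m) (auto simp: subspace_def)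
        also have "\<dots> = J (w n) + (s * (inner (T f) (T (w n)) - \<phi> f) + s\<^sup>2 * (norm (T f))\<^sup>2 / 2)"
          unfolding J_def Tadd[OF w(1) sf] padd[OF w(1) sf] Tsc[OF f] psc[OF f]
          by (simp only: power2_norm_eq_inner)
             (simp add: inner_add inner_commute power2_eq_square algebra_simps)
        finally show "0 \<le> (J (w n) - m) + (s * (inner (T f) (T (w n)) - \<phi> f) + s\<^sup>2 * (norm (T f))\<^sup>2 / 2)"
          by simp
      qed
    qed
    have "d = 0"
    proof (rule ccontr)
      assume d: "d \<noteq> 0"
      \<comment> \<open>Adding 1 keeps the trial value \<open>s = - d / a\<close> meaningful when
        \<open>T f = 0\<close>.\<close>
      define a where "a = (norm (T f))\<^sup>2 + 1"
      have a: "a > 0" by (simp add: a_def add_nonneg_pos)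
      have "0 \<le> (- d / a) * d + (- d / a)\<^sup>2 * (a - 1) / 2" using q[of "- d / a"] by (simp add: a_def)
      also have "\<dots> = d\<^sup>2 / a * (- 1 / 2 - 1 / (2 * a))"
        using a by (simp add: power2_eq_square field_simps)
      also have "\<dots> < 0" using a d by (intro mult_pos_neg) (auto simp: field_simps)
      finally show False by simp
    qed
    then show ?thesis by (simp add: d_def)
  qed
  then show thesis using that[of w k] w(1) k by blast
qed

text \<open>\<open>riesz_seminorm\<close> for the identity on \<open>M\<close> yields the orthogonal
  projection, since the closed set \<open>M\<close> contains the limit. It gives real orthogonality
  only; testing with \<open>\<i> *\<^sub>C f\<close> supplies the imaginary part.\<close>

lemma orth_decomposition:
  fixes M :: "'h::complex_hilbert set"
  assumes M: "csubspace_on M" "closed M"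
  obtains g where "g \<in> M" "h - g \<in> orth_complement M"
proof -
  note S = csubspace_onD[OF M(1)]
  obtain w k where w: "range w \<subseteq> M" "w \<longlonglongrightarrow> k" and k: "\<And>f. f \<in> M \<Longrightarrow> inner f k = inner f h"
    by (rule riesz_seminorm[of M "\<lambda>f. f" "\<lambda>f. inner f h" "norm h"])
       (use S(7) Cauchy_Schwarz_ineq2 in \<open>auto simp: inner_add mult.commute\<close>)
  have kM: "k \<in> M" using w M(2) closed_sequentially[of M w k] by auto
  have "cinner f (h - k) = 0" if f: "f \<in> M" for f
  proof (rule complex_eqI)
    show "Re (cinner f (h - k)) = Re 0"
      using k[OF f] by (simp add: Re_cinner inner_diff)
    have "Re (cinner (\<i> *\<^sub>C f) (h - k)) = 0"
      using k[OF S(3)[OF f, of \<i>]] by (simp add: Re_cinner inner_diff)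
    then show "Im (cinner f (h - k)) = Im 0" by (simp add: cinner_scaleC_left)
  qed
  then show thesis using that[of k] kM by (simp add: orth_complement_def)
qed

text \<open>Lax-Milgram: \<open>f \<mapsto> f - \<rho> (S f - g)\<close> is a contraction for \<open>\<rho> = \<mu> / L\<^sup>2\<close>.\<close>

lemma coercive_surj:
  fixes S :: "'h::{real_inner,complete_space} \<Rightarrow> 'h"
  assumes S: "bounded_linear S" and G: "subspace G" "closed G" and SG: "S ` G \<subseteq> G"
    and co: "\<And>f. f \<in> G \<Longrightarrow> inner f (S f) \<ge> \<mu> * (norm f)\<^sup>2" and mu: "\<mu> > 0" and g: "g \<in> G"
  shows "\<exists>f\<in>G. S f = g"
proof -
  interpret S: bounded_linear S by (rule S)
  obtain L0 where L0: "\<And>x. norm (S x) \<le> norm x * L0" using S.bounded by blast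
  \<comment> \<open>Taking the maximum with \<open>\<mu>\<close> ensures
    \<open>\<mu>\<^sup>2 / L\<^sup>2 \<le> 1\<close>, so that the contraction constant
    \<open>k\<close> is a real square root.\<close>
  define L where "L = max L0 \<mu>"
  have L: "norm (S x) \<le> L * norm x" for x
    using L0[of x] by (smt (verit) L_def max.cobounded1 mult.commute mult_left_mono norm_ge_zero)
  have Lmu: "L \<ge> \<mu>" "L > 0" using mu by (auto simp: L_def)
  define \<rho> where "\<rho> = \<mu> / L\<^sup>2"
  have rho: "\<rho> > 0" using mu Lmu by (simp add: \<rho>_def)
  define F where "F f = f - \<rho> *\<^sub>R (S f - g)" for f
  define k where "k = sqrt (1 - \<mu>\<^sup>2 / L\<^sup>2)"
  have le1: "\<mu>\<^sup>2 / L\<^sup>2 \<le> 1" using Lmu mu by (simp add: power_mono)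
  have pos: "\<mu>\<^sup>2 / L\<^sup>2 > 0" using Lmu mu by simp
  have "\<exists>!x\<in>G. F x = x"
  proof (rule Banach_fix)
    show "complete G" using G(2) by (simp add: complete_eq_closed)
    show "G \<noteq> {}" "0 \<le> k" "k < 1" using g le1 pos by (auto simp: k_def)
    show "F ` G \<subseteq> G" unfolding F_def using G(1) SG g
      by (auto intro!: subspace_diff subspace_scale)
    fix x y assume xy: "x \<in> G" "y \<in> G"
    define u where "u = x - y"
    have u: "u \<in> G" using xy G(1) by (simp add: u_def subspace_diff)
    have "F x - F y = u - \<rho> *\<^sub>R S u" by (simp add: F_def u_def S.diff algebra_simps)
    then have "(norm (F x - F y))\<^sup>2 = (norm u)\<^sup>2 - 2 * \<rho> * inner u (S u) + \<rho>\<^sup>2 * (norm (S u))\<^sup>2"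
      by (simp only: power2_norm_eq_inner)
         (simp add: inner_diff inner_commute power2_eq_square algebra_simps)
    also have "\<dots> \<le> (norm u)\<^sup>2 - 2 * \<rho> * (\<mu> * (norm u)\<^sup>2) + \<rho>\<^sup>2 * (L * norm u)\<^sup>2"
      using co[OF u] rho L[of u] by (intro add_mono diff_mono mult_left_mono power_mono) auto
    also have "\<dots> = (1 - (2 * \<rho> * \<mu> - (\<rho> * L)\<^sup>2)) * (norm u)\<^sup>2"
      by (simp add: power2_eq_square algebra_simps)
    also have "\<dots> = (1 - \<mu>\<^sup>2 / L\<^sup>2) * (norm u)\<^sup>2"
    proof -
      have "2 * \<rho> * \<mu> - (\<rho> * L)\<^sup>2 = \<mu>\<^sup>2 / L\<^sup>2"
        using Lmu by (simp add: \<rho>_def power2_eq_square)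
      then show ?thesis by simp
    qed
    also have "\<dots> = (k * norm u)\<^sup>2" using le1 by (simp add: k_def power_mult_distrib)
    finally have "norm (F x - F y) \<le> k * norm u"
      by (rule power2_le_imp_le) (use le1 in \<open>simp add: k_def\<close>)
    then show "dist (F x) (F y) \<le> k * dist x y" by (simp add: dist_norm u_def)
  qed
  then obtain x where "x \<in> G" "F x = x" by blast
  then show ?thesis using rho by (intro bexI[of _ x]) (auto simp: F_def)
qed



section \<open>The method of the weakly conjugate operator\<close>

lemma bounded_selfadjointD:
  assumes "bounded_selfadjoint T"
  shows "bounded_linear T" "clinear_on UNIV T" "cinner (T f) g = cinner f (T g)"
    "T (f + g) = T f + T g" "T (f - g) = T f - T g" "T (c *\<^sub>C f) = c *\<^sub>C T f" "T 0 = 0"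
proof -
  show T: "bounded_linear T" "clinear_on UNIV T" "cinner (T f) g = cinner f (T g)"
    using assms by (auto simp: bounded_selfadjoint_def bounded_clinear_def)
  show "T (f + g) = T f + T g" "T (f - g) = T f - T g" "T (c *\<^sub>C f) = c *\<^sub>C T f" "T 0 = 0"
    using clinear_onD[OF T(2) csubspace_on_UNIV] by auto
qed

text \<open>The majorant \<open>2 * \<alpha> * sqrt s + \<beta> * s\<close> stays continuous at
  \<open>0\<close>, where its derivative blows up. The mean value inequality asks for derivatives in
  the open interval only, so \<open>a = 0\<close> is allowed.\<close>

lemma sqrt_singular_bound:
  fixes F :: "real \<Rightarrow> 'a::real_normed_vector"
  assumes ab: "0 \<le> a" "a \<le> b" and cont: "continuous_on {a..b} F"
    and der: "\<And>s. a < s \<Longrightarrow> s < b \<Longrightarrow> (F has_vector_derivative F' s) (at s)"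
    and bnd: "\<And>s. a < s \<Longrightarrow> s < b \<Longrightarrow> norm (F' s) \<le> \<alpha> / sqrt s + \<beta>"
    and ge: "\<alpha> \<ge> 0" "\<beta> \<ge> 0"
  shows "norm (F a) \<le> norm (F b) + 2 * \<alpha> * sqrt b + \<beta> * b"
proof (cases "a = b")
  case True
  then show ?thesis using ge ab by simp
next
  case False
  then have "a < b" using ab by simp
  have "norm (F b - F a) \<le> (2 * \<alpha> * sqrt b + \<beta> * b) - (2 * \<alpha> * sqrt a + \<beta> * a)"
  proof (rule differentiable_bound_general[OF \<open>a < b\<close> cont _ der _ bnd])
    show "continuous_on {a..b} (\<lambda>s. 2 * \<alpha> * sqrt s + \<beta> * s)"
      by (intro continuous_intros)
    fix s assume s: "a < s" "s < b"
    have "((\<lambda>s. 2 * \<alpha> * sqrt s + \<beta> * s) has_real_derivative \<alpha> / sqrt s + \<beta>) (at s)"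
      using s ab by (auto intro!: derivative_eq_intros simp: field_simps)
    then show "((\<lambda>s. 2 * \<alpha> * sqrt s + \<beta> * s) has_vector_derivative \<alpha> / sqrt s + \<beta>) (at s)"
      by (simp add: has_real_derivative_iff_has_vector_derivative)
  qed
  moreover have "0 \<le> 2 * \<alpha> * sqrt a + \<beta> * a" using ge ab by simp
  moreover have "norm (F a) \<le> norm (F b) + norm (F b - F a)"
    by (metis norm_minus_commute norm_triangle_sub)
  ultimately show ?thesis by linarith
qed

text \<open>The analytic core, free of completions and of the generator: \<open>norm (K u)\<close>
  is the norm of \<open>\<B>\<close>, \<open>C\<close> is the second commutator
  \<open>\<i>[K\<^sup>2, A]\<close>, and \<open>C_bd\<close> states that it is bounded as a form on
  \<open>\<B>\<close>.\<close>

locale weakly_conjugate =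
  fixes G :: "'h::complex_hilbert set" and H K C :: "'h \<Rightarrow> 'h" and U :: "real \<Rightarrow> 'h \<Rightarrow> 'h"
    and \<kappa> :: real
  assumes G: "csubspace_on G" "closed G"
    and H: "bounded_selfadjoint H" and H_G: "f \<in> G \<Longrightarrow> H f \<in> G"
    and K: "bounded_selfadjoint K" and K_G: "f \<in> G \<Longrightarrow> K f \<in> G"
    and U_G: "f \<in> G \<Longrightarrow> U t f \<in> G" and U_lin: "clinear_on G (U t)"
    and U_iso: "f \<in> G \<Longrightarrow> g \<in> G \<Longrightarrow> cinner (U t f) (U t g) = cinner f g"
    and U_0: "f \<in> G \<Longrightarrow> U 0 f = f" and U_add: "f \<in> G \<Longrightarrow> U (s + t) f = U s (U t f)"
    and U_cont: "f \<in> G \<Longrightarrow> continuous_on UNIV (\<lambda>t. U t f)"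
    and H_deriv: "u \<in> G \<Longrightarrow> ((\<lambda>t. U (- t) (H (U t u))) has_vector_derivative K (K u)) (at 0)"
    and B_deriv: "u \<in> G \<Longrightarrow> ((\<lambda>t. U (- t) (K (K (U t u)))) has_vector_derivative C u) (at 0)"
    and C_bd: "u \<in> G \<Longrightarrow> v \<in> G \<Longrightarrow> cmod (cinner v (C u)) \<le> \<kappa> * norm (K v) * norm (K u)"
    and \<kappa>: "\<kappa> \<ge> 0"
begin

lemmas H_simps = bounded_selfadjointD[OF H]
lemmas K_simps = bounded_selfadjointD[OF K]
lemmas G_simps = csubspace_onD[OF G(1)]
lemmas U_simps = clinear_onD[OF U_lin G(1)]

section \<open>The perturbed operator and its inverse on \<open>G\<close>\<close>

definition L :: "real \<Rightarrow> complex \<Rightarrow> 'h \<Rightarrow> 'h" where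
  "L \<epsilon> z u = H u - z *\<^sub>C u - (\<i> * of_real \<epsilon>) *\<^sub>C K (K u)"

definition R :: "real \<Rightarrow> complex \<Rightarrow> 'h \<Rightarrow> 'h" where
  "R \<epsilon> z = inv_into G (L \<epsilon> z)"

text \<open>The sign condition under which \<open>L \<epsilon> z\<close> is invertible, stable under
  \<open>(\<epsilon>, z) \<mapsto> (- \<epsilon>, cnj z)\<close>, i.e. under taking adjoints.\<close>

definition adm :: "real \<Rightarrow> complex \<Rightarrow> bool" where
  "adm \<epsilon> z \<longleftrightarrow> (Im z > 0 \<and> \<epsilon> \<ge> 0) \<or> (Im z < 0 \<and> \<epsilon> \<le> 0)"

lemma adm_adj: "adm \<epsilon> z \<Longrightarrow> adm (- \<epsilon>) (cnj z)"
  by (auto simp: adm_def)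

lemma L_bounded_linear: "bounded_linear (L \<epsilon> z)"
  unfolding L_def[abs_def]
  by (intro bounded_linear_sub H_simps(1) bounded_linear_scaleC
      bounded_linear_compose[OF bounded_linear_scaleC]
      bounded_linear_compose[OF K_simps(1) K_simps(1)])

lemma L_G: "u \<in> G \<Longrightarrow> L \<epsilon> z u \<in> G"
  unfolding L_def by (intro G_simps H_G K_G)

lemma L_adj: "cinner v (L \<epsilon> z u) = cinner (L (- \<epsilon>) (cnj z) v) u"
  by (simp add: L_def cinner.diff_left cinner.diff_right cinner_scaleC_left cinner_scaleC_right
      H_simps(3) K_simps(3))

lemma cinner_L: "Im (cinner u (L \<epsilon> z u)) = - Im z * (norm u)\<^sup>2 - \<epsilon> * (norm (K u))\<^sup>2"
proof -
  have "cinner u (H u) = cnj (cinner u (H u))"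
    by (metis cinner_commute H_simps(3))
  then have H0: "Im (cinner u (H u)) = 0"
    by (metis cnj.simps(2) equal_neg_zero)
  have KK: "cinner u (K (K u)) = of_real ((norm (K u))\<^sup>2)"
    by (simp add: K_simps(3)[symmetric] cinner_self)
  show ?thesis
    by (simp add: L_def cinner.diff_right cinner_scaleC_right H0 KK cinner_self)
qed

text \<open>Under \<open>adm\<close> the two terms of \<open>cinner_L\<close> have the same sign and
  add up instead of cancelling; injectivity, surjectivity and both bounds on \<open>R\<close> come
  from this identity.\<close>

lemma L_coercive:
  assumes "adm \<epsilon> z"
  shows "\<bar>Im z\<bar> * (norm u)\<^sup>2 + \<bar>\<epsilon>\<bar> * (norm (K u))\<^sup>2 = - sgn (Im z) * Im (cinner u (L \<epsilon> z u))"
  using assms by (auto simp: adm_def cinner_L algebra_simps)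

lemma L_coercive_le:
  assumes "adm \<epsilon> z"
  shows "\<bar>Im z\<bar> * (norm u)\<^sup>2 + \<bar>\<epsilon>\<bar> * (norm (K u))\<^sup>2 \<le> cmod (cinner u (L \<epsilon> z u))"
proof -
  have "- sgn (Im z) * Im (cinner u (L \<epsilon> z u)) \<le> \<bar>Im (cinner u (L \<epsilon> z u))\<bar>"
    by (auto simp: sgn_if)
  then show ?thesis unfolding L_coercive[OF assms]
    using abs_Im_le_cmod order.trans by blast
qed

lemma L_inj: assumes "adm \<epsilon> z" shows "inj_on (L \<epsilon> z) G"
proof (rule inj_onI)
  interpret L: bounded_linear "L \<epsilon> z" by (rule L_bounded_linear)
  fix u v assume "L \<epsilon> z u = L \<epsilon> z v"
  then have "\<bar>Im z\<bar> * (norm (u - v))\<^sup>2 + \<bar>\<epsilon>\<bar> * (norm (K (u - v)))\<^sup>2 \<le> 0"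
    using L_coercive_le[OF assms, of "u - v"] by (simp add: L.diff cinner.zero_right)
  moreover have "0 \<le> \<bar>\<epsilon>\<bar> * (norm (K (u - v)))\<^sup>2" by simp
  ultimately have "\<bar>Im z\<bar> * (norm (u - v))\<^sup>2 \<le> 0" by linarith
  moreover have "\<bar>Im z\<bar> > 0" using assms by (auto simp: adm_def)
  ultimately show "u = v" by (simp add: mult_le_0_iff)
qed

lemma L_surj: assumes a: "adm \<epsilon> z" and g: "g \<in> G" shows "g \<in> L \<epsilon> z ` G"
proof -
  \<comment> \<open>The real Lax-Milgram argument sees real parts only; \<open>c\<close> turns the
    definite imaginary part of the form into a positive real part.\<close>
  define c where "c = \<i> * complex_of_real (sgn (Im z))"
  have c: "c \<noteq> 0" "\<bar>Im z\<bar> > 0" using a by (auto simp: adm_def c_def sgn_if)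
  have "\<exists>f\<in>G. c *\<^sub>C L \<epsilon> z f = c *\<^sub>C g"
  proof (rule coercive_surj[where \<mu> = "\<bar>Im z\<bar>"])
    show "bounded_linear (\<lambda>f. c *\<^sub>C L \<epsilon> z f)"
      by (rule bounded_linear_compose[OF bounded_linear_scaleC L_bounded_linear])
    show "(\<lambda>f. c *\<^sub>C L \<epsilon> z f) ` G \<subseteq> G" using L_G G_simps by auto
    show "\<bar>Im z\<bar> * (norm f)\<^sup>2 \<le> inner f (c *\<^sub>C L \<epsilon> z f)" for f
    proof -
      have "inner f (c *\<^sub>C L \<epsilon> z f) = - sgn (Im z) * Im (cinner f (L \<epsilon> z f))"
        by (simp add: Re_cinner[symmetric] cinner_scaleC_right c_def)
      then show ?thesis using L_coercive[OF a, of f] by (smt (verit) mult_nonneg_nonneg zero_le_power2 abs_ge_zero)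
    qed
  qed (use G G_simps g c in auto)
  then obtain f where "f \<in> G" "c *\<^sub>C L \<epsilon> z f = c *\<^sub>C g" by blast
  then have "(1 / c) *\<^sub>C c *\<^sub>C L \<epsilon> z f = (1 / c) *\<^sub>C c *\<^sub>C g" by simp
  then have "L \<epsilon> z f = g" using c by (simp add: scaleC_scaleC)
  with \<open>f \<in> G\<close> show ?thesis by blast
qed

context
  fixes \<epsilon> z assumes a: "adm \<epsilon> z"
begin

lemma R_G: "f \<in> G \<Longrightarrow> R \<epsilon> z f \<in> G"
  unfolding R_def by (rule inv_into_into[OF L_surj[OF a]])

lemma L_R: "f \<in> G \<Longrightarrow> L \<epsilon> z (R \<epsilon> z f) = f"
  unfolding R_def by (rule f_inv_into_f[OF L_surj[OF a]])

lemma R_eqI: "u \<in> G \<Longrightarrow> L \<epsilon> z u = f \<Longrightarrow> R \<epsilon> z f = u"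
  unfolding R_def by (rule inv_into_f_eq[OF L_inj[OF a]])

lemma R_diff: "f \<in> G \<Longrightarrow> g \<in> G \<Longrightarrow> R \<epsilon> z (f - g) = R \<epsilon> z f - R \<epsilon> z g"
  by (rule R_eqI)
     (simp_all add: R_G G_simps L_R linear_diff[OF bounded_linear.linear[OF L_bounded_linear]])

lemma R_add: "f \<in> G \<Longrightarrow> g \<in> G \<Longrightarrow> R \<epsilon> z (f + g) = R \<epsilon> z f + R \<epsilon> z g"
  by (rule R_eqI)
     (simp_all add: R_G G_simps L_R linear_add[OF bounded_linear.linear[OF L_bounded_linear]])

text \<open>The second bound does not degenerate as \<open>Im z\<close> tends to \<open>0\<close>
  and carries all uniform estimates; the first depends on \<open>Im z\<close> and enters only limits
  and continuity.\<close>

lemma R_bounds: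
  assumes f: "f \<in> G"
  shows "\<bar>Im z\<bar> * norm (R \<epsilon> z f) \<le> norm f"
    and "\<bar>\<epsilon>\<bar> * (norm (K (R \<epsilon> z f)))\<^sup>2 \<le> cmod (cinner f (R \<epsilon> z f))"
proof -
  let ?u = "R \<epsilon> z f"
  have le: "\<bar>Im z\<bar> * (norm ?u)\<^sup>2 + \<bar>\<epsilon>\<bar> * (norm (K ?u))\<^sup>2 \<le> cmod (cinner ?u f)"
    using L_coercive_le[OF a, of ?u] by (simp add: L_R f)
  have ge: "0 \<le> \<bar>Im z\<bar> * (norm ?u)\<^sup>2" "0 \<le> \<bar>\<epsilon>\<bar> * (norm (K ?u))\<^sup>2" by simp_all
  have "cmod (cinner ?u f) = cmod (cinner f ?u)" by (subst cinner_commute) simp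
  then show "\<bar>\<epsilon>\<bar> * (norm (K ?u))\<^sup>2 \<le> cmod (cinner f ?u)" using le ge by linarith
  have "norm ?u * (\<bar>Im z\<bar> * norm ?u) \<le> norm ?u * norm f"
  proof -
    have "norm ?u * (\<bar>Im z\<bar> * norm ?u) = \<bar>Im z\<bar> * (norm ?u)\<^sup>2"
      by (simp add: power2_eq_square)
    then show ?thesis using norm_cinner_le[of ?u f] le ge by linarith
  qed
  then show "\<bar>Im z\<bar> * norm ?u \<le> norm f"
    by (cases "norm ?u = 0") auto
qed

lemma R_adj:
  assumes "f \<in> G" "g \<in> G"
  shows "cinner f (R \<epsilon> z g) = cinner (R (- \<epsilon>) (cnj z) f) g"
proof -
  have "f = L (- \<epsilon>) (cnj z) (R (- \<epsilon>) (cnj z) f)"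
    using adm_adj[OF a] assms(1) by (simp add: weakly_conjugate.L_R[OF weakly_conjugate_axioms])
  then show ?thesis using L_adj[of "R (- \<epsilon>) (cnj z) f" \<epsilon> z "R \<epsilon> z g"] L_R[OF assms(2)] by metis
qed

lemma R_tendsto:
  assumes f: "(f \<longlongrightarrow> l) F" "\<And>x. f x \<in> G" "l \<in> G"
  shows "((\<lambda>x. R \<epsilon> z (f x)) \<longlongrightarrow> R \<epsilon> z l) F"
proof (rule LIM_zero_cancel, rule Lim_null_comparison)
  have "Im z \<noteq> 0" using a by (auto simp: adm_def)
  then have "norm (R \<epsilon> z (f x) - R \<epsilon> z l) \<le> norm (f x - l) / \<bar>Im z\<bar>" for x
    using R_bounds(1)[of "f x - l"] f by (simp add: R_diff G_simps field_simps)
  then show "\<forall>\<^sub>F x in F. norm (R \<epsilon> z (f x) - R \<epsilon> z l) \<le> norm (f x - l) / \<bar>Im z\<bar>"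
    by simp
  show "((\<lambda>x. norm (f x - l) / \<bar>Im z\<bar>) \<longlongrightarrow> 0) F"
    using tendsto_divide_zero[OF tendsto_norm_zero[OF LIM_zero[OF f(1)]]] by simp
qed

end

section \<open>The unitary group and the commutator identity\<close>

lemma U_norm: "f \<in> G \<Longrightarrow> norm (U t f) = norm f"
  using arg_cong[OF U_iso[of f f t], of Re] by (simp add: cinner_self)

lemma U_inv: "f \<in> G \<Longrightarrow> U (- t) (U t f) = f" "f \<in> G \<Longrightarrow> U t (U (- t) f) = f"
  using U_add[of f "-t" t] U_add[of f t "-t"] U_0 by auto

lemma U_adj: "f \<in> G \<Longrightarrow> g \<in> G \<Longrightarrow> cinner (U (- t) f) g = cinner f (U t g)"
  using U_iso[of "U (- t) f" g t] by (simp add: U_G U_inv)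

lemma U_tendsto: "f \<in> G \<Longrightarrow> ((\<lambda>t. U t f) \<longlongrightarrow> f) (at 0)"
  using U_cont[of f] by (metis U_0 UNIV_I continuous_on_def)

text \<open>The derivative at \<open>t = 0\<close> of \<open>\<langle>U t f, R (U t g)\<rangle> = \<langle>f, (U (- t) L (U t))\<inverse> g\<rangle>\<close>,
  computed from either side; this replaces the formal commutator \<open>[A, R]\<close>.\<close>

lemma commutator_identity:
  assumes a: "adm \<epsilon> z" and fg: "f \<in> G" "g \<in> G" "f' \<in> G" "g' \<in> G"
    and f': "((\<lambda>t. U t f) has_vector_derivative f') (at 0)"
    and g': "((\<lambda>t. U t g) has_vector_derivative g') (at 0)"
  defines "u \<equiv> R \<epsilon> z g" and "v \<equiv> R (- \<epsilon>) (cnj z) f"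
  shows "cinner v (K (K u)) = (\<i> * of_real \<epsilon>) * cinner v (C u) - cinner f' u - cinner v g'"
proof -
  note a' = adm_adj[OF a]
  let ?S = "R (- \<epsilon>) (cnj z)"
  have uv: "u \<in> G" "v \<in> G" using fg by (simp_all add: u_def v_def R_G a a')
  define x where "x t = U (- t) (?S (U t f))" for t
  define Lt where "Lt t = U (- t) (L \<epsilon> z (U t u))" for t
  have xG: "x t \<in> G" for t unfolding x_def using fg by (intro U_G R_G[OF a'])
  have Lt: "Lt t = U (- t) (H (U t u)) - z *\<^sub>C u - (\<i> * of_real \<epsilon>) *\<^sub>C U (- t) (K (K (U t u)))" for t
    unfolding Lt_def L_def using uv by (simp add: U_simps G_simps H_G K_G U_G U_inv)
  have "(Lt has_vector_derivative K (K u) - 0 - (\<i> * of_real \<epsilon>) *\<^sub>C C u) (at 0)"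
    unfolding Lt[abs_def] using uv
    by (intro has_vector_derivative_diff has_vector_derivative_const H_deriv
        bounded_linear.has_vector_derivative[OF bounded_linear_scaleC] B_deriv)
  then have dL: "((\<lambda>t. (Lt t - L \<epsilon> z u) /\<^sub>R t) \<longlongrightarrow> K (K u) - (\<i> * of_real \<epsilon>) *\<^sub>C C u) (at 0)"
    using uv by (simp add: has_vector_derivative_0_iff Lt_def U_0 L_G)
  \<comment> \<open>Continuity of \<open>x\<close> is enough, because \<open>x t\<close> is only
    paired with the difference quotient of \<open>Lt\<close>; no resolvent is differentiated in
    \<open>t\<close>.\<close>
  have xlim: "(x \<longlongrightarrow> v) (at 0)"
  proof -
    have Uf: "((\<lambda>t. U t f) \<longlongrightarrow> f) (at 0)" by (rule U_tendsto[OF fg(1)])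
    have S: "((\<lambda>t. ?S (U t f)) \<longlongrightarrow> v) (at 0)" unfolding v_def
      by (rule R_tendsto[OF a' Uf]) (simp_all add: fg U_G)
    have "((\<lambda>t. U (- t) v) \<longlongrightarrow> v) (at 0)"
    proof (rule filterlim_compose[OF U_tendsto[OF uv(2)]])
      show "filterlim uminus (at 0) (at (0::real))"
        unfolding filterlim_at using tendsto_minus[OF tendsto_ident_at[of 0 UNIV]]
        by (auto simp: eventually_at_filter)
    qed
    moreover have "((\<lambda>t. x t - U (- t) v) \<longlongrightarrow> 0) (at 0)"
    proof (rule tendsto_norm_zero_cancel)
      have "norm (x t - U (- t) v) = norm (?S (U t f) - v)" for t
        unfolding x_def using fg uv
        by (simp add: U_simps(3)[symmetric] R_G[OF a'] U_G U_norm G_simps)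
      then show "((\<lambda>t. norm (x t - U (- t) v)) \<longlongrightarrow> 0) (at 0)"
        using tendsto_norm_zero[OF LIM_zero[OF S]] by simp
    qed
    ultimately have "((\<lambda>t. (x t - U (- t) v) + U (- t) v) \<longlongrightarrow> 0 + v) (at 0)"
      by (intro tendsto_add)
    then show ?thesis by simp
  qed
  have lim1: "((\<lambda>t. cinner (x t) ((Lt t - L \<epsilon> z u) /\<^sub>R t)) \<longlongrightarrow>
      cinner v (K (K u) - (\<i> * of_real \<epsilon>) *\<^sub>C C u)) (at 0)"
    by (intro tendsto_cinner xlim dL)
  \<comment> \<open>The isometry cancels \<open>U\<close> in \<open>cinner (x t) (Lt t)\<close>,
    leaving the constant \<open>cinner f u\<close>. What remains depends on \<open>t\<close> only
    through \<open>U t f\<close> and \<open>U t g\<close> next to a fixed resolvent, so its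
    difference quotients involve just \<open>f'\<close> and \<open>g'\<close> in the limit.\<close>
  have id: "cinner (x t) (Lt t - L \<epsilon> z u) = - (cinner (U t f - f) (R \<epsilon> z (U t g)) + cinner v (U t g - g))"
    for t
  proof -
    have Utf: "U t f \<in> G" and Utg: "U t g \<in> G" using fg by (auto simp: U_G)
    have "cinner (x t) (Lt t) = cinner (?S (U t f)) (L \<epsilon> z (U t u))"
      unfolding x_def Lt_def using uv Utf by (simp add: U_iso R_G[OF a'] L_G U_G)
    also have "\<dots> = cinner (U t f) (U t u)" using L_R[OF a' Utf] by (simp add: L_adj)
    finally have 1: "cinner (x t) (Lt t) = cinner f u" using fg uv by (simp add: U_iso)
    have "cinner (x t) (L \<epsilon> z u) = cinner (x t) g" using fg by (simp add: u_def L_R[OF a])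
    also have "\<dots> = cinner (?S (U t f)) (U t g)"
      unfolding x_def using fg Utf by (simp add: U_adj R_G[OF a'])
    also have "\<dots> = cinner (U t f) (R \<epsilon> z (U t g))" using R_adj[OF a Utf Utg] by simp
    finally have 2: "cinner (x t) (L \<epsilon> z u) = cinner (U t f) (R \<epsilon> z (U t g))" .
    have "cinner v (U t g - g) = cinner f (R \<epsilon> z (U t g - g))"
      unfolding v_def using R_adj[OF a fg(1)] fg Utg by (simp add: G_simps)
    then have 3: "cinner v (U t g - g) = cinner f (R \<epsilon> z (U t g)) - cinner f u"
      using fg Utg by (simp add: R_diff[OF a] cinner.diff_right u_def)
    show ?thesis by (simp add: cinner.diff_left cinner.diff_right 1 2 3[unfolded cinner.diff_right])
  qed
  have RU: "((\<lambda>t. R \<epsilon> z (U t g)) \<longlongrightarrow> u) (at 0)" unfolding u_def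
    by (rule R_tendsto[OF a U_tendsto]) (simp_all add: fg U_G)
  have lim2: "((\<lambda>t. - (cinner ((U t f - f) /\<^sub>R t) (R \<epsilon> z (U t g)) + cinner v ((U t g - g) /\<^sub>R t))) \<longlongrightarrow>
      - (cinner f' u + cinner v g')) (at 0)"
    using f' g' fg by (intro tendsto_intros RU) (simp_all add: has_vector_derivative_0_iff U_0)
  have "(\<lambda>t. cinner (x t) ((Lt t - L \<epsilon> z u) /\<^sub>R t)) =
      (\<lambda>t. - (cinner ((U t f - f) /\<^sub>R t) (R \<epsilon> z (U t g)) + cinner v ((U t g - g) /\<^sub>R t)))"
    by (rule ext) (simp only: cinner.scaleR_right cinner.scaleR_left id scaleR_minus_right scaleR_add_right)
  then have "cinner v (K (K u) - (\<i> * of_real \<epsilon>) *\<^sub>C C u) = - (cinner f' u + cinner v g')"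
    using lim1 lim2 by (intro tendsto_unique[OF trivial_limit_at]) simp_all
  then show ?thesis by (simp add: cinner.diff_right cinner_scaleC_right algebra_simps)
qed

section \<open>Dependence on the perturbation parameter and the differential inequality\<close>

lemma R_param_diff:
  assumes a: "adm \<epsilon> z" "adm \<delta> z" and fg: "f \<in> G" "g \<in> G"
  shows "cinner f (R \<delta> z g) - cinner f (R \<epsilon> z g) =
    (\<i> * of_real (\<delta> - \<epsilon>)) * cinner (R (- \<delta>) (cnj z) f) (K (K (R \<epsilon> z g)))"
proof -
  let ?u = "R \<epsilon> z g" and ?v = "R (- \<delta>) (cnj z) f"
  have "cinner f ?u = cinner ?v (L \<delta> z ?u)"
    using L_adj[of ?v \<delta> z ?u] by (simp add: L_R[OF adm_adj[OF a(2)]] fg)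
  also have "L \<delta> z ?u = L \<epsilon> z ?u - (\<i> * of_real (\<delta> - \<epsilon>)) *\<^sub>C K (K ?u)"
    by (simp add: L_def scaleC_diff_left algebra_simps)
  also have "\<dots> = g - (\<i> * of_real (\<delta> - \<epsilon>)) *\<^sub>C K (K ?u)" by (simp add: L_R[OF a(1)] fg)
  finally show ?thesis
    by (simp add: R_adj[OF a(2)] fg cinner.diff_right cinner_scaleC_right)
qed

text \<open>The weak resolvent identity is tested with the difference
  \<open>R \<delta> z g - R \<epsilon> z g\<close> itself, and one factor of its norm is divided
  out.\<close>

lemma R_param_cont:
  assumes a: "adm \<epsilon> z" "adm \<delta> z" and g: "g \<in> G"
  shows "(Im z)\<^sup>2 * norm (R \<delta> z g - R \<epsilon> z g) \<le> \<bar>\<delta> - \<epsilon>\<bar> * (onorm (\<lambda>x. K (K x)) * norm g)"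
proof -
  let ?w = "R \<delta> z g - R \<epsilon> z g" and ?k = "onorm (\<lambda>x. K (K x))"
  have w: "?w \<in> G" using g by (intro G_simps R_G a)
  have Kb: "bounded_linear (\<lambda>x. K (K x))"
    by (rule bounded_linear_compose[OF K_simps(1) K_simps(1)])
  let ?v = "R (- \<delta>) (cnj z) ?w"
  have "cinner ?w ?w = (\<i> * of_real (\<delta> - \<epsilon>)) * cinner ?v (K (K (R \<epsilon> z g)))"
    using R_param_diff[OF a w g] by (simp add: cinner.diff_right)
  then have "cmod (cinner ?w ?w) = \<bar>\<delta> - \<epsilon>\<bar> * cmod (cinner ?v (K (K (R \<epsilon> z g))))"
    by (simp only: norm_mult norm_of_real norm_ii mult_1)
  then have "(norm ?w)\<^sup>2 = \<bar>\<delta> - \<epsilon>\<bar> * cmod (cinner ?v (K (K (R \<epsilon> z g))))"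
    by (simp add: cinner_self norm_power)
  also have "\<dots> \<le> \<bar>\<delta> - \<epsilon>\<bar> * (norm ?v * (?k * norm (R \<epsilon> z g)))"
    by (intro mult_left_mono order.trans[OF norm_cinner_le] onorm[OF Kb]) auto
  finally have "(Im z)\<^sup>2 * (norm ?w)\<^sup>2 \<le>
      (Im z)\<^sup>2 * (\<bar>\<delta> - \<epsilon>\<bar> * (norm ?v * (?k * norm (R \<epsilon> z g))))"
    by (intro mult_left_mono) auto
  also have "\<dots> = \<bar>\<delta> - \<epsilon>\<bar> * ?k * ((\<bar>Im z\<bar> * norm ?v) * (\<bar>Im z\<bar> * norm (R \<epsilon> z g)))"
    by (simp add: power2_eq_square algebra_simps)
  also have "\<dots> \<le> \<bar>\<delta> - \<epsilon>\<bar> * ?k * (norm ?w * norm g)"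
    using R_bounds(1)[OF adm_adj[OF a(2)] w] R_bounds(1)[OF a(1) g]
    by (intro mult_left_mono mult_mono) (auto simp: onorm_pos_le[OF Kb])
  finally have "norm ?w * ((Im z)\<^sup>2 * norm ?w) \<le> norm ?w * (\<bar>\<delta> - \<epsilon>\<bar> * (?k * norm g))"
    by (simp add: power2_eq_square algebra_simps)
  then show ?thesis
    using onorm_pos_le[OF Kb] by (cases "norm ?w = 0") auto
qed

lemma R_param_tendsto:
  assumes a: "adm \<epsilon> z" and ev: "\<forall>\<^sub>F x in F. adm (d x) z" and d: "(d \<longlongrightarrow> \<epsilon>) F" and g: "g \<in> G"
  shows "((\<lambda>x. R (d x) z g) \<longlongrightarrow> R \<epsilon> z g) F"
proof (rule LIM_zero_cancel, rule Lim_null_comparison)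
  let ?k = "onorm (\<lambda>x. K (K x)) * norm g / (Im z)\<^sup>2"
  have "(Im z)\<^sup>2 > 0" using a by (auto simp: adm_def)
  then show "\<forall>\<^sub>F x in F. norm (R (d x) z g - R \<epsilon> z g) \<le> \<bar>d x - \<epsilon>\<bar> * ?k"
    using ev R_param_cont[OF a _ g] by (auto elim!: eventually_mono simp: field_simps)
  show "((\<lambda>x. \<bar>d x - \<epsilon>\<bar> * ?k) \<longlongrightarrow> 0) F"
    using d by (intro tendsto_mult_left_zero tendsto_rabs_zero LIM_zero)
qed

text \<open>\<open>f'\<close> is the derivative of the orbit, formally \<open>\<i> A f\<close>. The
  two inequalities bound the dual norms of \<open>f\<close> and \<open>f'\<close> relative to
  \<open>norm (K u)\<close> by \<open>p\<close> and \<open>N\<close>. Strict positivity of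
  \<open>p\<close> allows cutting off at \<open>p / N\<close>, and \<open>p \<le> N\<close> keeps
  this ratio at most 1; the vector \<open>0\<close> is treated apart.\<close>

definition datum :: "'h \<Rightarrow> real \<Rightarrow> real \<Rightarrow> bool" where
  "datum f p N \<longleftrightarrow> f \<in> G \<and> 0 < p \<and> p \<le> N \<and>
     (\<exists>f'\<in>G. ((\<lambda>t. U t f) has_vector_derivative f') (at 0) \<and>
        (\<forall>u\<in>G. cmod (cinner f u) \<le> p * norm (K u) \<and> cmod (cinner f' u) \<le> N * norm (K u)))"

text \<open>The derivative is \<open>\<i> \<langle>v, K\<^sup>2 u\<rangle>\<close> with
  \<open>u = R s z g\<close> and \<open>v\<close> the adjoint resolvent applied to \<open>f\<close>.
  Estimating it directly costs two factors of order \<open>s\<close> to the power -1/2, hence a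
  non-integrable \<open>1 / s\<close>. The commutator identity trades it for terms with a single
  such factor and one term with two factors compensated by \<open>s\<close>.\<close>

lemma F_derivative:
  assumes z: "Im z > 0" and f: "datum f pf Nf" and g: "datum g pg Ng"
  obtains F' where
    "\<And>s. s > 0 \<Longrightarrow> ((\<lambda>s. cinner f (R s z g)) has_vector_derivative F' s) (at s)"
    "\<And>s. s > 0 \<Longrightarrow> cmod (F' s) \<le> Nf * norm (K (R s z g)) + Ng * norm (K (R (- s) (cnj z) f))
        + s * \<kappa> * norm (K (R (- s) (cnj z) f)) * norm (K (R s z g))"
proof
  obtain f' g' where fG: "f \<in> G" "g \<in> G" "f' \<in> G" "g' \<in> G"
    and f': "((\<lambda>t. U t f) has_vector_derivative f') (at 0)"
    and g': "((\<lambda>t. U t g) has_vector_derivative g') (at 0)"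
    and bf: "\<And>u. u \<in> G \<Longrightarrow> cmod (cinner f' u) \<le> Nf * norm (K u)"
    and bg: "\<And>u. u \<in> G \<Longrightarrow> cmod (cinner g' u) \<le> Ng * norm (K u)"
    using f g unfolding datum_def by blast
  define F' where "F' s = \<i> * cinner (R (- s) (cnj z) f) (K (K (R s z g)))" for s
  fix s :: real assume s: "s > 0"
  have a: "adm s z" using z s by (simp add: adm_def)
  show "((\<lambda>s. cinner f (R s z g)) has_vector_derivative F' s) (at s)"
    unfolding has_vector_derivative_iff_quotient
  proof (rule Lim_transform_eventually)
    have ev: "\<forall>\<^sub>F h in at 0. h > - s \<and> h \<noteq> 0"
      using s by (intro eventually_conj) (auto simp: eventually_at intro!: exI[of _ s])
    then have "\<forall>\<^sub>F h in at 0. adm (- (s + h)) (cnj z)"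
      by eventually_elim (use z in \<open>auto simp: adm_def\<close>)
    then have "((\<lambda>h. R (- (s + h)) (cnj z) f) \<longlongrightarrow> R (- s) (cnj z) f) (at 0)"
      by (rule R_param_tendsto[OF adm_adj[OF a]]) (auto intro!: tendsto_eq_intros simp: fG)
    then show "((\<lambda>h. \<i> * cinner (R (- (s + h)) (cnj z) f) (K (K (R s z g)))) \<longlongrightarrow> F' s) (at 0)"
      unfolding F'_def by (intro tendsto_intros)
    show "\<forall>\<^sub>F h in at 0. \<i> * cinner (R (- (s + h)) (cnj z) f) (K (K (R s z g))) =
        (cinner f (R (s + h) z g) - cinner f (R s z g)) /\<^sub>R h"
      using ev
    proof eventually_elim
      fix h assume h: "- s < h \<and> h \<noteq> 0"
      then have "adm (s + h) z" using z by (simp add: adm_def)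
      then show "\<i> * cinner (R (- (s + h)) (cnj z) f) (K (K (R s z g))) =
        (cinner f (R (s + h) z g) - cinner f (R s z g)) /\<^sub>R h"
        using R_param_diff[OF a _ fG(1,2)] h by (simp add: scaleR_conv_of_real)
    qed
  qed
  let ?u = "R s z g" and ?v = "R (- s) (cnj z) f"
  have uv: "?u \<in> G" "?v \<in> G" using fG by (auto intro: R_G a adm_adj)
  have "cmod (F' s) = cmod (cinner ?v (K (K ?u)))" by (simp add: F'_def norm_mult)
  also have "\<dots> \<le> cmod ((\<i> * of_real s) * cinner ?v (C ?u)) + cmod (cinner f' ?u) + cmod (cinner ?v g')"
    unfolding commutator_identity[OF a fG f' g']
    by (smt (verit) norm_triangle_ineq4)
  also have "cmod ((\<i> * of_real s) * cinner ?v (C ?u)) \<le> s * (\<kappa> * norm (K ?v) * norm (K ?u))"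
    unfolding norm_mult using C_bd[OF uv] s by (simp add: mult_left_mono)
  also have "cmod (cinner ?v g') = cmod (cinner g' ?v)" by (subst cinner_commute) simp
  finally show "cmod (F' s) \<le> Nf * norm (K ?u) + Ng * norm (K ?v) + s * \<kappa> * norm (K ?v) * norm (K ?u)"
    using bf[OF uv(1)] bg[OF uv(2)] by (simp add: mult.assoc)
qed

lemma F_continuous:
  assumes "Im z > 0" "f \<in> G" "g \<in> G"
  shows "continuous_on {0..} (\<lambda>s. cinner f (R s z g))"
  unfolding continuous_on_def
proof
  fix s :: real assume "s \<in> {0..}"
  then show "((\<lambda>s. cinner f (R s z g)) \<longlongrightarrow> cinner f (R s z g)) (at s within {0..})"
    using assms by (intro tendsto_intros R_param_tendsto)
       (auto simp: adm_def eventually_at_filter intro!: always_eventually)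
qed

text \<open>\<open>e1\<close> makes \<open>\<kappa> * e1 \<le> 1 / 2\<close>, so that the
  \<open>\<kappa>\<close> term over an interval of length at most \<open>e1\<close> consumes at most
  half of the maximum of \<open>\<bar>F\<bar>\<close>. \<open>c1\<close> is what remains after
  absorption in \<open>F_diagonal\<close>; in \<open>c2\<close> one \<open>sqrt c1\<close> is the
  value at the cut-off, four come from the singular term and \<open>\<kappa> * c1\<close> from the
  second commutator.\<close>

definition e1 :: real where "e1 = 1 / (2 * \<kappa> + 2)"
definition c1 :: real where "c1 = 4 * (1 / e1 + 16 * e1)"
definition c2 :: real where "c2 = 5 * sqrt c1 + \<kappa> * c1"

lemma e1: "0 < e1" "e1 \<le> 1" "\<kappa> * e1 \<le> 1 / 2"
  using \<kappa> by (auto simp: e1_def field_simps)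

lemma c1: "c1 > 0" "c1 \<ge> 1 / e1" and c2: "c2 > 0"
proof -
  have "1 / e1 > 0" using e1 by simp
  then show "c1 > 0" "c1 \<ge> 1 / e1" using e1 unfolding c1_def by argo+
  then show "c2 > 0" using \<kappa> by (auto simp: c2_def intro!: add_pos_nonneg)
qed

lemma datum_bound:
  assumes "datum f p N" "u \<in> G"
  shows "cmod (cinner f u) \<le> p * norm (K u)"
  using assms by (auto simp: datum_def)

lemma K_R_bounds:
  assumes z: "Im z > 0" and s: "s > 0" and f: "f \<in> G"
  shows "sqrt s * norm (K (R s z f)) \<le> sqrt (cmod (cinner f (R s z f)))"
    and "sqrt s * norm (K (R (- s) (cnj z) f)) \<le> sqrt (cmod (cinner f (R s z f)))"
proof -
  have a: "adm s z" using z s by (simp add: adm_def)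
  have "sqrt s * norm (K (R s z f)) = sqrt (s * (norm (K (R s z f)))\<^sup>2)"
    by (simp add: real_sqrt_mult)
  also have "\<dots> \<le> sqrt (cmod (cinner f (R s z f)))" using R_bounds(2)[OF a f] s by simp
  finally show "sqrt s * norm (K (R s z f)) \<le> sqrt (cmod (cinner f (R s z f)))" .
  have "sqrt s * norm (K (R (- s) (cnj z) f)) = sqrt (s * (norm (K (R (- s) (cnj z) f)))\<^sup>2)"
    by (simp add: real_sqrt_mult)
  also have "\<dots> \<le> sqrt (cmod (cinner f (R (- s) (cnj z) f)))"
    using R_bounds(2)[OF adm_adj[OF a] f] s by simp
  also have "cmod (cinner f (R (- s) (cnj z) f)) = cmod (cinner f (R s z f))"
    using R_adj[OF a f f] by (metis cinner_commute complex_mod_cnj)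
  finally show "sqrt s * norm (K (R (- s) (cnj z) f)) \<le> sqrt (cmod (cinner f (R s z f)))" .
qed

text \<open>With \<open>u = R s z f\<close>, duality gives
  \<open>\<bar>F\<bar> \<le> p * norm (K u)\<close> and coercivity
  \<open>s * (norm (K u))\<^sup>2 \<le> \<bar>F\<bar>\<close>; the two inequalities close without
  any commutator.\<close>

lemma F_large:
  assumes z: "Im z > 0" and s: "s > 0" and f: "datum f p N"
  shows "cmod (cinner f (R s z f)) \<le> p\<^sup>2 / s"
proof -
  have fG: "f \<in> G" and p: "p > 0" using f by (auto simp: datum_def)
  have RG: "R s z f \<in> G" using z s by (intro R_G fG) (simp add: adm_def)
  let ?F = "cmod (cinner f (R s z f))"
  have "sqrt s * ?F \<le> p * (sqrt s * norm (K (R s z f)))"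
    using datum_bound[OF f RG] s by (simp add: mult.left_commute)
  also have "\<dots> \<le> p * sqrt ?F"
    using K_R_bounds(1)[OF z s fG] p by (intro mult_left_mono) auto
  finally have "(sqrt s * ?F)\<^sup>2 \<le> (p * sqrt ?F)\<^sup>2"
    using s by (intro power_mono) auto
  also have "(sqrt s * ?F)\<^sup>2 = ?F * (s * ?F)"
    using s by (simp add: power_mult_distrib) (simp add: power2_eq_square)
  also have "(p * sqrt ?F)\<^sup>2 = ?F * p\<^sup>2"
    by (simp add: power_mult_distrib)
  finally have "?F * (s * ?F) \<le> ?F * p\<^sup>2" .
  then have "s * ?F \<le> p\<^sup>2" by (cases "?F = 0") auto
  then show ?thesis using s by (simp add: field_simps)
qed

text \<open>The differential inequality for \<open>F s = \<langle>f, R s z f\<rangle>\<close> is integrated over \<open>[0, b]\<close> with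
  \<open>b\<close> proportional to \<open>p / N\<close>; beyond \<open>b\<close> the a priori bound \<open>p\<^sup>2 / s\<close> suffices.\<close>

lemma F_diagonal:
  assumes z: "Im z > 0" and s: "s \<ge> 0" and f: "datum f p N"
  shows "cmod (cinner f (R s z f)) \<le> c1 * (p * N)"
proof -
  have fG: "f \<in> G" and p: "0 < p" "p \<le> N" using f by (auto simp: datum_def)
  define b where "b = e1 * (p / N)"
  have N: "N > 0" using p by simp
  have b: "0 < b" "b \<le> e1" using p N e1 mult_left_le[of "p / N" e1] by (auto simp: b_def)
  define F where "F s = cinner f (R s z f)" for s
  have large: "cmod (F s) \<le> p * N / e1" if "s \<ge> b" for s
  proof -
    have "cmod (F s) \<le> p\<^sup>2 / s" using F_large[OF z _ f, of s] that b by (simp add: F_def)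
    also have "\<dots> \<le> p\<^sup>2 / b" using that b by (intro divide_left_mono) auto
    also have "\<dots> = p * N / e1" using p by (simp add: b_def power2_eq_square)
    finally show ?thesis .
  qed
  have cont: "continuous_on {0..b} F"
    unfolding F_def[abs_def] by (rule continuous_on_subset[OF F_continuous[OF z fG fG]]) auto
  \<comment> \<open>Working on \<open>[m, b]\<close> with a maximum point \<open>m\<close> replaces
    \<open>F\<close> by the constant \<open>M\<close> in the differential inequality; an inequality
    for the number \<open>M\<close> with absorbable terms takes the place of a Gronwall
    argument.\<close>
  obtain m where m: "m \<in> {0..b}" and max: "\<And>s. s \<in> {0..b} \<Longrightarrow> cmod (F s) \<le> cmod (F m)"
    using continuous_attains_sup[of "{0..b}", OF _ _ continuous_on_norm[OF cont]] b by auto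
  define M where "M = cmod (F m)"
  obtain F' where F': "\<And>s. s > 0 \<Longrightarrow> (F has_vector_derivative F' s) (at s)"
    and F'_le: "\<And>s. s > 0 \<Longrightarrow> cmod (F' s) \<le> N * norm (K (R s z f)) + N * norm (K (R (- s) (cnj z) f))
        + s * \<kappa> * norm (K (R (- s) (cnj z) f)) * norm (K (R s z f))"
    using F_derivative[OF z f f] unfolding F_def[abs_def] by blast
  have bnd: "norm (F' s) \<le> (2 * N * sqrt M) / sqrt s + \<kappa> * M" if s: "m < s" "s < b" for s
  proof -
    have s0: "s > 0" using s m by simp
    have FM: "sqrt (cmod (cinner f (R s z f))) \<le> sqrt M"
      using max[of s] s s0 by (simp add: M_def F_def)
    define x where "x = norm (K (R s z f))"
    define y where "y = norm (K (R (- s) (cnj z) f))"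
    have xy: "sqrt s * x \<le> sqrt M" "sqrt s * y \<le> sqrt M" "0 \<le> x" "0 \<le> y"
      using K_R_bounds[OF z s0 fG, THEN order.trans, OF FM] by (simp_all add: x_def y_def)
    have "(sqrt s * y) * (sqrt s * x) \<le> sqrt M * sqrt M"
      using xy s0 by (intro mult_mono) (auto simp: M_def)
    also have "(sqrt s * y) * (sqrt s * x) = (sqrt s * sqrt s) * (y * x)"
      by (simp add: algebra_simps)
    finally have "s * (y * x) \<le> M" using s0 by (simp add: M_def)
    then have "\<kappa> * (s * (y * x)) \<le> \<kappa> * M" using \<kappa> by (intro mult_left_mono)
    moreover have "N * x \<le> N * (sqrt M / sqrt s)" "N * y \<le> N * (sqrt M / sqrt s)"
      using xy s0 N by (intro mult_left_mono; simp add: field_simps)+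
    moreover have "norm (F' s) \<le> N * x + N * y + s * \<kappa> * y * x"
      using F'_le[OF s0] by (simp add: x_def y_def)
    moreover have "(2 * N * sqrt M) / sqrt s = N * (sqrt M / sqrt s) + N * (sqrt M / sqrt s)"
      by simp
    moreover have "\<kappa> * (s * (y * x)) = s * \<kappa> * y * x" by simp
    ultimately show ?thesis by linarith
  qed
  have "cmod (F m) \<le> cmod (F b) + 2 * (2 * N * sqrt M) * sqrt b + \<kappa> * M * b"
    by (rule sqrt_singular_bound[where F' = F'])
       (use m b N \<kappa> bnd F' in \<open>auto simp: M_def intro: continuous_on_subset[OF cont]\<close>)
  moreover have "cmod (F b) \<le> p * N / e1" by (rule large) simp
  moreover have "\<kappa> * M * b \<le> M / 2"
  proof -
    have "\<kappa> * b \<le> 1 / 2" using b \<kappa> e1(3) mult_left_mono[of b e1 \<kappa>] by linarith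
    then have "M * (\<kappa> * b) \<le> M * (1 / 2)" by (intro mult_left_mono) (auto simp: M_def)
    then show ?thesis by (simp add: algebra_simps)
  qed
  \<comment> \<open>The weights of the arithmetic-geometric mean inequality spend only
    \<open>M / 4\<close> here; with \<open>M / 2\<close> for the \<open>\<kappa>\<close> term, a
    quarter of \<open>M\<close> remains on the left, which is the factor 4 in
    \<open>c1\<close>.\<close>
  moreover have "2 * (2 * N * sqrt M) * sqrt b \<le> M / 4 + 16 * (e1 * (p * N))"
  proof -
    have "N * sqrt b = sqrt (N\<^sup>2 * b)" using N by (simp add: real_sqrt_mult)
    also have "N\<^sup>2 * b = e1 * (p * N)" using N by (simp add: b_def power2_eq_square)
    finally have *: "N * sqrt b = sqrt (e1 * (p * N))" .
    have "0 \<le> (sqrt M / 2 - 4 * sqrt (e1 * (p * N)))\<^sup>2" by simp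
    also have "\<dots> = M / 4 + 16 * (e1 * (p * N)) - 4 * (sqrt M * sqrt (e1 * (p * N)))"
      using p N e1 by (simp add: power2_diff power_mult_distrib power_divide M_def)
    finally have "4 * (sqrt M * (N * sqrt b)) \<le> M / 4 + 16 * (e1 * (p * N))"
      unfolding * by simp
    then show ?thesis by (simp add: mult_ac)
  qed
  ultimately have "M \<le> 4 * (p * N / e1) + 64 * (e1 * (p * N))" unfolding M_def by linarith
  also have "\<dots> = c1 * (p * N)" by (simp add: c1_def algebra_simps)
  finally have M: "M \<le> c1 * (p * N)" .
  show ?thesis
  proof (cases "s \<le> b")
    case True
    then show ?thesis using max[of s] s M by (simp add: M_def F_def)
  next
    case False
    then have "cmod (F s) \<le> p * N * (1 / e1)" using large[of s] by simp
    also have "\<dots> \<le> p * N * c1" using c1 p N by (intro mult_left_mono) auto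
    finally show ?thesis by (simp add: F_def algebra_simps)
  qed
qed

text \<open>The diagonal bound has made \<open>norm (K (R s z g))\<close> and its adjoint
  counterpart explicit, of order \<open>s\<close> to the power -1/2, so the derivative is integrated
  directly and nothing is absorbed.\<close>

lemma F_bilinear:
  assumes z: "Im z > 0" and f: "datum f pf Nf" and g: "datum g pg Ng"
  shows "cmod (cinner f (R 0 z g)) \<le> c2 * (sqrt (pf * Nf) * sqrt (pg * Ng))"
proof -
  have fG: "f \<in> G" "g \<in> G" and pf: "0 < pf" "pf \<le> Nf" and pg: "0 < pg" "pg \<le> Ng"
    using f g by (auto simp: datum_def)
  define qf where "qf = sqrt (pf * Nf)"
  define qg where "qg = sqrt (pg * Ng)"
  have q: "qf > 0" "qg > 0" using pf pg by (auto simp: qf_def qg_def)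
  \<comment> \<open>With the smaller ratio, \<open>Nf * sqrt b\<close> and
    \<open>Ng * sqrt b\<close> are both dominated by the geometric means \<open>qf\<close> and
    \<open>qg\<close>.\<close>
  define b where "b = min (pf / Nf) (pg / Ng)"
  have b: "0 < b" "b \<le> 1" using pf pg by (auto simp: b_def min_def)
  have Nb: "Nf * sqrt b \<le> qf" "Ng * sqrt b \<le> qg"
  proof -
    have *: "N * sqrt b \<le> sqrt (p * N)" if "b \<le> p / N" "0 < N" for p N
    proof -
      have "N * sqrt b = sqrt (N\<^sup>2 * b)" using that by (simp add: real_sqrt_mult)
      also have "N\<^sup>2 * b \<le> N\<^sup>2 * (p / N)" using that by (intro mult_left_mono) auto
      then have "sqrt (N\<^sup>2 * b) \<le> sqrt (p * N)"
        using that by (simp add: power2_eq_square mult.commute)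
      finally show ?thesis .
    qed
    show "Nf * sqrt b \<le> qf" "Ng * sqrt b \<le> qg"
      using pf pg by (auto simp: qf_def qg_def b_def intro!: *[unfolded b_def])
  qed
  define x where "x s = norm (K (R s z g))" for s
  define y where "y s = norm (K (R (- s) (cnj z) f))" for s
  have x: "sqrt s * x s \<le> sqrt c1 * qg" and y: "sqrt s * y s \<le> sqrt c1 * qf" if s: "s > 0" for s
  proof -
    have "sqrt (cmod (cinner g (R s z g))) \<le> sqrt (c1 * (pg * Ng))"
      using F_diagonal[OF z _ g, of s] s by simp
    then show "sqrt s * x s \<le> sqrt c1 * qg"
      using K_R_bounds(1)[OF z s fG(2)] by (simp add: x_def qg_def real_sqrt_mult)
    have "sqrt (cmod (cinner f (R s z f))) \<le> sqrt (c1 * (pf * Nf))"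
      using F_diagonal[OF z _ f, of s] s by simp
    then show "sqrt s * y s \<le> sqrt c1 * qf"
      using K_R_bounds(2)[OF z s fG(1)] by (simp add: y_def qf_def real_sqrt_mult)
  qed
  have xy0: "0 \<le> x s" "0 \<le> y s" for s by (simp_all add: x_def y_def)
  define F where "F s = cinner f (R s z g)" for s
  define \<alpha> where "\<alpha> = sqrt c1 * (Nf * qg + Ng * qf)"
  define \<beta> where "\<beta> = \<kappa> * c1 * (qf * qg)"
  obtain F' where F': "\<And>s. s > 0 \<Longrightarrow> (F has_vector_derivative F' s) (at s)"
    and F'_le: "\<And>s. s > 0 \<Longrightarrow> cmod (F' s) \<le> Nf * x s + Ng * y s + s * \<kappa> * y s * x s"
    using F_derivative[OF z f g] unfolding F_def[abs_def] x_def y_def by blast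
  have "norm (F 0) \<le> norm (F b) + 2 * \<alpha> * sqrt b + \<beta> * b"
  proof (rule sqrt_singular_bound[where F' = F'])
    show "continuous_on {0..b} F"
      unfolding F_def[abs_def] by (rule continuous_on_subset[OF F_continuous[OF z fG]]) auto
    fix s assume s: "0 < s" "s < b"
    have "(sqrt s * y s) * (sqrt s * x s) \<le> (sqrt c1 * qf) * (sqrt c1 * qg)"
      by (rule mult_mono[OF y[OF s(1)] x[OF s(1)]]) (use xy0 s q c1 in auto)
    also have "(sqrt s * y s) * (sqrt s * x s) = (sqrt s * sqrt s) * (y s * x s)"
      by (simp add: algebra_simps)
    also have "\<dots> = s * (y s * x s)" using s by simp
    also have "(sqrt c1 * qf) * (sqrt c1 * qg) = (sqrt c1 * sqrt c1) * (qf * qg)"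
      by (simp add: algebra_simps)
    also have "\<dots> = c1 * (qf * qg)" using c1 by simp
    finally have "\<kappa> * (s * (y s * x s)) \<le> \<kappa> * (c1 * (qf * qg))" using \<kappa> by (intro mult_left_mono)
    moreover have "Nf * x s \<le> Nf * ((sqrt c1 * qg) / sqrt s)"
      using x[OF s(1)] s pf by (intro mult_left_mono) (auto simp: field_simps)
    moreover have "Ng * y s \<le> Ng * ((sqrt c1 * qf) / sqrt s)"
      using y[OF s(1)] s pg by (intro mult_left_mono) (auto simp: field_simps)
    moreover have "\<alpha> / sqrt s = Nf * ((sqrt c1 * qg) / sqrt s) + Ng * ((sqrt c1 * qf) / sqrt s)"
      by (simp add: \<alpha>_def add_divide_distrib algebra_simps)
    ultimately show "norm (F' s) \<le> \<alpha> / sqrt s + \<beta>"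
      using F'_le[OF s(1)] by (simp add: \<beta>_def algebra_simps)
  qed (use b F' pf pg q c1 \<kappa> in \<open>auto simp: \<alpha>_def \<beta>_def\<close>)
  moreover have "\<beta> * b \<le> \<kappa> * c1 * (qf * qg)"
    using b \<kappa> c1 q by (auto simp: \<beta>_def intro!: mult_left_le)
  moreover have "2 * \<alpha> * sqrt b \<le> 4 * sqrt c1 * (qf * qg)"
  proof -
    have "(Nf * sqrt b) * qg + (Ng * sqrt b) * qf \<le> qf * qg + qg * qf"
      using Nb q by (intro add_mono mult_right_mono) auto
    then have "sqrt c1 * ((Nf * sqrt b) * qg + (Ng * sqrt b) * qf) \<le> sqrt c1 * (qf * qg + qg * qf)"
      using c1 by (intro mult_left_mono) auto
    then show ?thesis by (simp add: \<alpha>_def algebra_simps)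
  qed
  moreover have "norm (F b) \<le> sqrt c1 * (qf * qg)"
  proof -
    have a: "adm b z" using b z by (simp add: adm_def)
    have RG: "R b z g \<in> G" "R (- b) (cnj z) f \<in> G"
      using fG by (auto intro: R_G a adm_adj)
    have *: "p * w \<le> sqrt c1 * (sqrt (p * N) * q)"
      if "b = p / N" "0 < p" "0 < N" "sqrt b * w \<le> sqrt c1 * q" for p N w q
    proof -
      have "p = sqrt (p * N) * sqrt b"
        using that by (simp flip: real_sqrt_mult)
      then have "p * w = sqrt (p * N) * (sqrt b * w)" by simp
      also have "\<dots> \<le> sqrt (p * N) * (sqrt c1 * q)" using that by (intro mult_left_mono) auto
      finally show ?thesis by (simp add: algebra_simps)
    qed
    \<comment> \<open>At \<open>b\<close> the datum that attains the minimum is paired by duality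
      with the other resolvent vector, since for it
      \<open>p = sqrt (p * N) * sqrt b\<close>.\<close>
    consider "b = pf / Nf" | "b = pg / Ng" unfolding b_def min_def by presburger
    then show ?thesis
    proof cases
      case 1
      have "norm (F b) \<le> pf * x b" using datum_bound[OF f RG(1)] by (simp add: F_def x_def)
      also have "\<dots> \<le> sqrt c1 * (qf * qg)" unfolding qf_def
        by (rule *[OF 1]) (use pf x b in auto)
      finally show ?thesis .
    next
      case 2
      have "norm (F b) = cmod (cinner g (R (- b) (cnj z) f))"
        unfolding F_def R_adj[OF a fG] by (subst cinner_commute) simp
      also have "\<dots> \<le> pg * y b" using datum_bound[OF g RG(2)] by (simp add: y_def)
      also have "\<dots> \<le> sqrt c1 * (qg * qf)" unfolding qg_def
        by (rule *[OF 2]) (use pg y b in auto)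
      finally show ?thesis by (simp add: mult.commute)
    qed
  qed
  ultimately have "norm (F 0) \<le> c2 * (qf * qg)" by (simp add: c2_def algebra_simps)
  then show ?thesis by (simp add: F_def qf_def qg_def)
qed

end



section \<open>Spectral measures\<close>

text \<open>A null set is covered by nonoverlapping intervals, the sum of whose lengths is the measure of
  their union.\<close>

lemma null_sets_lborel_if_interval_bound:
  fixes m :: "real measure"
  assumes sets: "sets m = sets borel" and c: "c \<ge> 0"
    and bd: "\<And>a b. a < b \<Longrightarrow> emeasure m {a..b} \<le> ennreal (c * (b - a))"
    and X: "X \<in> null_sets lborel"
  shows "emeasure m X = 0"
proof -
  have Xb: "X \<in> sets borel" using X by auto
  have bounded_case: "emeasure m (X \<inter> {- real n..real n}) = 0" for n
  proof -
    let ?X = "X \<inter> {- real n..real n}"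
    have Xn: "?X \<in> null_sets lborel"
      by (rule null_sets_subset[OF X]) (use Xb in auto)
    have le: "emeasure m ?X \<le> ennreal (c * e)" if e: "e > 0" for e
    proof -
      have XL: "?X \<in> null_sets lebesgue" using Xn by (simp add: null_sets_completionI)
      have lm: "?X \<in> lmeasurable" using XL by (rule fmeasurableI_null_sets)
      have sub: "?X \<subseteq> cbox (- real n - 1) (real n + 1)" by auto
      obtain \<D> where D: "countable \<D>"
        "\<And>K. K \<in> \<D> \<Longrightarrow> K \<subseteq> cbox (- real n - 1) (real n + 1) \<and> K \<noteq> {} \<and> (\<exists>c d. K = cbox c d)"
        "pairwise (\<lambda>A B. interior A \<inter> interior B = {}) \<D>"
        "\<And>u v. cbox u v \<in> \<D> \<Longrightarrow> \<exists>k. \<forall>i\<in>Basis. v \<bullet> i - u \<bullet> i =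
          ((real n + 1) \<bullet> i - (- real n - 1) \<bullet> i) / 2 ^ k"
        "\<And>K. \<lbrakk>K \<in> \<D>; box (- real n - 1) (real n + 1) \<noteq> {}\<rbrakk> \<Longrightarrow> interior K \<noteq> {}"
        "?X \<subseteq> \<Union>\<D>" "\<Union>\<D> \<in> lmeasurable" "measure lebesgue (\<Union>\<D>) \<le> measure lebesgue ?X + e"
        by (rule measurable_outer_intervals_bounded[OF lm sub e]) (rule that)
      have meas: "measure lebesgue (\<Union>\<D>) \<le> e"
        using D(8) measure_eq_0_null_sets[OF XL] by simp
      have ivl: "\<exists>a b. a < b \<and> K = {a..b}" if K: "K \<in> \<D>" for K
      proof -
        obtain a b where ab: "K = cbox a b" using D(2)[OF K] by blast
        have "interior K \<noteq> {}" using D(5)[OF K] by simp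
        then have "a < b" by (auto simp: ab interior_cbox box_eq_empty not_less)
        then show ?thesis using ab by auto
      qed
      \<comment> \<open>\<open>\<D>\<close> may be finite: indices outside the range of the
        enumeration give the empty set, so that no interval is counted twice.\<close>
      define A where "A i = (if i \<in> to_nat_on \<D> ` \<D> then from_nat_into \<D> i else {})" for i
      have A: "A i \<in> \<D> \<or> A i = {}" for i by (auto simp: A_def D(1))
      have UA: "(\<Union>i. A i) = \<Union>\<D>"
      proof
        show "(\<Union>i. A i) \<subseteq> \<Union>\<D>" using A by blast
        show "\<Union>\<D> \<subseteq> (\<Union>i. A i)"
        proof
          fix x assume "x \<in> \<Union>\<D>"
          then obtain K where "K \<in> \<D>" "x \<in> K" by blast
          then have "x \<in> A (to_nat_on \<D> K)" using D(1) by (simp add: A_def)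
          then show "x \<in> (\<Union>i. A i)" by blast
        qed
      qed
      \<comment> \<open>The intervals may share end points; their lengths are therefore added
        through the interiors, which are disjoint.\<close>
      have disj: "disjoint_family (\<lambda>i. interior (A i))"
        unfolding disjoint_family_on_def
      proof (intro ballI impI)
        fix i k :: nat assume ik: "i \<noteq> k"
        show "interior (A i) \<inter> interior (A k) = {}"
        proof (cases "i \<in> to_nat_on \<D> ` \<D> \<and> k \<in> to_nat_on \<D> ` \<D>")
          case True
          then have "A i \<in> \<D>" "A k \<in> \<D>" "A i \<noteq> A k" using ik D(1) by (auto simp: A_def)
          then show ?thesis using D(3) by (auto simp: pairwise_def)
        qed (auto simp: A_def)
      qed
      have Ab: "A i \<in> sets borel" for i using A[of i] ivl by fastforce
      have Am: "emeasure m (A i) \<le> ennreal c * emeasure lborel (interior (A i))" for i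
      proof (cases "A i = {}")
        case False
        then obtain a b where ab: "a < b" "A i = {a..b}" using A ivl by blast
        then show ?thesis using bd[OF ab(1)] c by (simp add: ennreal_mult)
      qed simp
      have "emeasure m ?X \<le> emeasure m (\<Union>i. A i)"
        using D(6) Ab sets by (intro emeasure_mono) (auto simp: UA[symmetric])
      also have "\<dots> \<le> (\<Sum>i. emeasure m (A i))"
        using Ab sets by (intro emeasure_subadditive_countably) auto
      also have "\<dots> \<le> (\<Sum>i. ennreal c * emeasure lborel (interior (A i)))"
        using Am by (intro suminf_le) auto
      also have "\<dots> = ennreal c * emeasure lborel (\<Union>i. interior (A i))"
        using disj by (subst suminf_emeasure[symmetric]) auto
      also have "emeasure lborel (\<Union>i. interior (A i)) \<le> emeasure lborel (\<Union>i. A i)"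
        using Ab interior_subset by (intro emeasure_mono) (fastforce intro!: sets.countable_UN)+
      also have "\<dots> = emeasure lebesgue (\<Union>\<D>)"
      proof -
        have "(\<Union>i. A i) \<in> sets lborel" using Ab by (auto intro: sets.countable_UN)
        then show ?thesis by (simp add: UA)
      qed
      also have "\<dots> = ennreal (measure lebesgue (\<Union>\<D>))"
        using D(7) by (rule fmeasurableD2 emeasure_eq_measure2)
      also have "\<dots> \<le> ennreal e" using meas by (rule ennreal_leI)
      finally show ?thesis using c e by (simp add: ennreal_mult mult_left_mono)
    qed
    show ?thesis
    proof (rule antisym)
      show "emeasure m ?X \<le> 0"
      proof (rule ennreal_le_epsilon)
        fix e :: real assume e: "0 < e"
        have "emeasure m ?X \<le> ennreal (c * (e / (c + 1)))" by (rule le) (use c e in auto)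
        also have "\<dots> \<le> ennreal e" using c e by (intro ennreal_leI) (simp add: field_simps)
        finally show "emeasure m ?X \<le> 0 + ennreal e" by simp
      qed
    qed simp
  qed
  have "X = (\<Union>n. X \<inter> {- real n..real n})"
  proof -
    have "\<exists>n. x \<in> {- real n..real n}" for x :: real
    proof -
      obtain n where "\<bar>x\<bar> \<le> real n" using real_arch_simple by blast
      then show ?thesis by (intro exI[of _ n]) auto
    qed
    then show ?thesis by blast
  qed
  moreover have "emeasure m (\<Union>n. X \<inter> {- real n..real n}) = 0"
    by (rule emeasure_UN_eq_0) (use bounded_case Xb sets in auto)
  ultimately show ?thesis by simp
qed

text \<open>The numerical radius of a symmetric operator is its norm: polarise between
  \<open>x\<close> and the multiple of \<open>T x\<close> of equal norm, then use the parallelogram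
  law. The invariant subspace \<open>M\<close> will be the range of a spectral projection.\<close>

lemma symmetric_norm_le:
  fixes T :: "'a::real_inner \<Rightarrow> 'a"
  assumes T: "bounded_linear T" and sym: "\<And>x y. inner x (T y) = inner (T x) y"
    and M: "subspace M" "T ` M \<subseteq> M" and q: "\<And>x. x \<in> M \<Longrightarrow> \<bar>inner x (T x)\<bar> \<le> h * (norm x)\<^sup>2"
    and x: "x \<in> M" and h: "h \<ge> 0"
  shows "norm (T x) \<le> h * norm x"
proof (cases "T x = 0 \<or> x = 0")
  case True
  then show ?thesis using h by (auto simp: linear_0[OF bounded_linear.linear[OF T]])
next
  case False
  interpret T: bounded_linear T by (rule T)
  define y where "y = (norm x / norm (T x)) *\<^sub>R T x"
  have y: "y \<in> M" "norm y = norm x" using M x False by (auto simp: y_def subspace_scale)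
  have yT: "inner y (T x) = norm x * norm (T x)"
    using False by (simp add: y_def power2_norm_eq_inner[symmetric] power2_eq_square)
  have "4 * inner y (T x) = inner (x + y) (T (x + y)) - inner (x - y) (T (x - y))"
    using sym[of x y] by (simp add: T.add T.diff inner_add inner_diff inner_commute)
  also have "\<dots> \<le> h * (norm (x + y))\<^sup>2 + h * (norm (x - y))\<^sup>2"
    using q[of "x + y"] q[of "x - y"] M x y by (simp add: subspace_add subspace_diff abs_le_iff)
  also have "\<dots> = 2 * h * ((norm x)\<^sup>2 + (norm y)\<^sup>2)"
    by (simp add: power2_norm_eq_inner inner_add inner_diff inner_commute algebra_simps)
  finally have "norm x * norm (T x) \<le> norm x * (h * norm x)"
    by (simp add: yT y power2_eq_square algebra_simps)
  then show ?thesis using False by simp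
qed

section \<open>Algebra of the spectral projections\<close>

locale spectral_measure =
  fixes S :: "'h::complex_hilbert set" and T :: "'h \<Rightarrow> 'h" and E :: "real set \<Rightarrow> 'h \<Rightarrow> 'h"
  assumes S: "csubspace_on S" and T: "bounded_selfadjoint T" and T_S: "f \<in> S \<Longrightarrow> T f \<in> S"
    and E: "spectral_measure_of S T E"
begin

lemmas S_simps = csubspace_onD[OF S]
lemmas T_simps = bounded_selfadjointD[OF T]

lemma E_S: "X \<in> sets borel \<Longrightarrow> f \<in> S \<Longrightarrow> E X f \<in> S"
  and E_lin: "X \<in> sets borel \<Longrightarrow> clinear_on S (E X)"
  and E_idem: "X \<in> sets borel \<Longrightarrow> f \<in> S \<Longrightarrow> E X (E X f) = E X f"
  and E_sa: "X \<in> sets borel \<Longrightarrow> f \<in> S \<Longrightarrow> g \<in> S \<Longrightarrow> cinner (E X f) g = cinner f (E X g)"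
  and E_UNIV: "f \<in> S \<Longrightarrow> E UNIV f = f"
  and E_sums: "range Y \<subseteq> sets borel \<Longrightarrow> disjoint_family Y \<Longrightarrow> f \<in> S \<Longrightarrow>
    (\<lambda>n. E (Y n) f) sums E (\<Union>n. Y n) f"
  using E unfolding spectral_measure_of_def projection_valued_measure_on_def by (auto simp: image_subset_iff)

lemmas E_simps = clinear_onD[OF E_lin S]

lemma E_empty: assumes f: "f \<in> S" shows "E {} f = 0"
proof -
  have "(\<lambda>n::nat. E {} f) sums E (\<Union>n::nat. {}) f"
    by (rule E_sums) (auto simp: f disjoint_family_on_def)
  then have "(\<lambda>n::nat. E {} f) \<longlonglongrightarrow> 0" by (rule summable_LIMSEQ_zero[OF sums_summable])
  then show ?thesis by (simp add: LIMSEQ_const_iff)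
qed

lemma E_Un:
  assumes XY: "X \<in> sets borel" "Y \<in> sets borel" "X \<inter> Y = {}" and f: "f \<in> S"
  shows "E (X \<union> Y) f = E X f + E Y f"
proof -
  have "(\<lambda>n. E (binaryset X Y n) f) sums E (\<Union>n. binaryset X Y n) f"
    using XY by (intro E_sums f) (auto simp: disjoint_family_on_def binaryset_def range_binaryset_eq)
  moreover have "(\<lambda>n. E (binaryset X Y n) f) sums (\<Sum>n<2. E (binaryset X Y n) f)"
    by (rule sums_finite) (auto simp: binaryset_def E_empty f)
  ultimately have "E (\<Union>n. binaryset X Y n) f = (\<Sum>n<2. E (binaryset X Y n) f)"
    by (rule sums_unique2)
  then show ?thesis by (simp add: UN_binaryset_eq numeral_2_eq_2 binaryset_def)
qed

lemma E_compl: "X \<in> sets borel \<Longrightarrow> f \<in> S \<Longrightarrow> E X f + E (- X) f = f"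
  using E_Un[of X "- X" f] by (simp add: E_UNIV)

lemma cinner_E: "X \<in> sets borel \<Longrightarrow> f \<in> S \<Longrightarrow> cinner f (E X f) = of_real ((norm (E X f))\<^sup>2)"
  using E_sa[of X f "E X f"] by (simp add: E_S E_idem cinner_self)

lemma E_norm_le:
  assumes "X \<in> sets borel" "f \<in> S" shows "norm (E X f) \<le> norm f"
proof -
  have "(norm (E X f))\<^sup>2 = cmod (cinner f (E X f))" using cinner_E[OF assms] by (simp add: norm_power)
  also have "\<dots> \<le> norm f * norm (E X f)" by (rule norm_cinner_le)
  finally show ?thesis
    by (cases "norm (E X f) = 0") (auto simp: power2_eq_square)
qed

text \<open>Multiplicativity is derived from additivity. On \<open>g = E X f\<close> additivity
  gives \<open>(norm (E (X \<union> Y) g))\<^sup>2\<close> as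
  \<open>(norm g)\<^sup>2 + (norm (E Y g))\<^sup>2\<close>, and a projection cannot increase the
  norm.\<close>

lemma E_disjoint:
  assumes XY: "X \<in> sets borel" "Y \<in> sets borel" "X \<inter> Y = {}" and f: "f \<in> S"
  shows "E Y (E X f) = 0"
proof -
  let ?g = "E X f"
  have g: "?g \<in> S" using XY f by (simp add: E_S)
  have "cinner ?g (E (X \<union> Y) ?g) = cinner ?g (E X ?g) + cinner ?g (E Y ?g)"
    using E_Un[OF XY g] by (simp add: cinner_add_right)
  then have "complex_of_real ((norm (E (X \<union> Y) ?g))\<^sup>2) =
      complex_of_real ((norm (E X ?g))\<^sup>2 + (norm (E Y ?g))\<^sup>2)"
    using XY g by (simp only: cinner_E[OF _ g] sets.Un of_real_add)
  then have "(norm (E (X \<union> Y) ?g))\<^sup>2 = (norm ?g)\<^sup>2 + (norm (E Y ?g))\<^sup>2"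
    unfolding of_real_eq_iff using XY f by (simp add: E_idem)
  moreover have "(norm (E (X \<union> Y) ?g))\<^sup>2 \<le> (norm ?g)\<^sup>2"
    using XY g by (intro power_mono E_norm_le) auto
  ultimately show ?thesis by simp
qed

lemma E_Int:
  assumes XY: "X \<in> sets borel" "Y \<in> sets borel" and f: "f \<in> S"
  shows "E X (E Y f) = E (X \<inter> Y) f"
proof -
  have "E (Y \<inter> X \<union> (Y - X)) f = E (Y \<inter> X) f + E (Y - X) f"
    using XY f by (intro E_Un) auto
  moreover have "Y \<inter> X \<union> (Y - X) = Y" by blast
  ultimately have "E X (E Y f) = E X (E (Y \<inter> X) f) + E X (E (Y - X) f)"
    using XY f by (simp add: E_simps E_S)
  moreover have "E X (E (Y - X) f) = 0" using XY f by (intro E_disjoint) auto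
  moreover have "E (X \<inter> (Y \<inter> X) \<union> (X - Y)) (E (Y \<inter> X) f) =
      E (X \<inter> (Y \<inter> X)) (E (Y \<inter> X) f) + E (X - Y) (E (Y \<inter> X) f)"
    using XY f by (intro E_Un) (auto simp: E_S)
  moreover have "X \<inter> (Y \<inter> X) \<union> (X - Y) = X" by blast
  moreover have "E (X - Y) (E (Y \<inter> X) f) = 0" using XY f by (intro E_disjoint) auto
  moreover have "X \<inter> (Y \<inter> X) = Y \<inter> X" by blast
  ultimately show ?thesis using XY f by (simp add: E_idem Int_commute)
qed

section \<open>Scalar measures and commutation with \<open>T\<close>\<close>

abbreviation \<mu> :: "'h \<Rightarrow> real measure" where "\<mu> \<equiv> scalar_measure E"

lemma sets_\<mu> [measurable_cong, simp]: "sets (\<mu> f) = sets borel"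
  unfolding scalar_measure_def using sets.sigma_sets_eq[of "borel :: real measure"]
  by (simp add: sets_measure_of_conv)

lemma space_\<mu> [simp]: "space (\<mu> f) = UNIV"
  unfolding scalar_measure_def by (simp add: space_measure_of_conv)

lemma emeasure_\<mu>:
  assumes f: "f \<in> S" and X: "X \<in> sets borel"
  shows "emeasure (\<mu> f) X = ennreal ((norm (E X f))\<^sup>2)"
proof -
  let ?m = "\<lambda>X. ennreal (Re (cinner f (E X f)))"
  have "emeasure (\<mu> f) X = ?m X"
    unfolding scalar_measure_def
  proof (rule emeasure_measure_of_sigma)
    show "sigma_algebra UNIV (sets (borel :: real measure))"
      using sets.sigma_algebra_axioms[of "borel :: real measure"] by simp
    show "positive (sets borel) ?m" using f by (simp add: positive_def E_empty cinner.zero_right)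
    show "countably_additive (sets borel) ?m"
      unfolding countably_additive_def
    proof (intro allI impI)
      fix Y :: "nat \<Rightarrow> real set"
      assume Y: "range Y \<subseteq> sets borel" "disjoint_family Y"
      have "(\<lambda>n. Re (cinner f (E (Y n) f))) sums Re (cinner f (E (\<Union>n. Y n) f))"
        by (intro sums_Re bounded_linear.sums[OF cinner.bounded_linear_right] E_sums Y f)
      moreover have "0 \<le> Re (cinner f (E (Y n) f))" for n
      proof -
        have "Y n \<in> sets borel" using Y by auto
        then show ?thesis using f by (simp add: cinner_E)
      qed
      ultimately show "(\<Sum>n. ?m (Y n)) = ?m (\<Union>n. Y n)" by (intro suminf_ennreal_eq)
    qed
  qed (rule X)
  then show ?thesis using f X by (simp add: cinner_E)
qed

lemma finite_\<mu>: "f \<in> S \<Longrightarrow> finite_measure (\<mu> f)"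
  by (rule finite_measureI) (simp add: emeasure_\<mu>)

lemma measure_\<mu>: "f \<in> S \<Longrightarrow> X \<in> sets borel \<Longrightarrow> measure (\<mu> f) X = (norm (E X f))\<^sup>2"
  by (simp add: measure_def emeasure_\<mu>)

lemma integrable_\<mu>: assumes f: "f \<in> S" shows "integrable (\<mu> f) (\<lambda>x. x)"
proof (rule Bochner_Integration.integrable_bound)
  interpret finite_measure "\<mu> f" by (rule finite_\<mu>[OF f])
  have "integrable (\<mu> f) (\<lambda>x. x\<^sup>2)" using E f unfolding spectral_measure_of_def by blast
  then show "integrable (\<mu> f) (\<lambda>x. 1 + x\<^sup>2)" by simp
  have "\<bar>x\<bar> \<le> 1 + x\<^sup>2" for x :: real
    using sum_squares_ge_zero[of "\<bar>x\<bar> - 1" 0] zero_le_power2[of x]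
    by (simp add: power2_eq_square algebra_simps)
  then show "AE x in \<mu> f. norm x \<le> norm (1 + x\<^sup>2)" by (auto intro!: AE_I2)
qed simp

lemma cinner_T: "f \<in> S \<Longrightarrow> cinner f (T f) = complex_of_real (\<integral>x. x \<partial>\<mu> f)"
  using E unfolding spectral_measure_of_def by blast

lemma \<mu>_E:
  assumes f: "f \<in> S" and Y: "Y \<in> sets borel"
  shows "\<mu> (E Y f) = density (\<mu> f) (indicator Y)"
proof (rule measure_eqI)
  fix X assume "X \<in> sets (\<mu> (E Y f))"
  then have X: "X \<in> sets borel" by simp
  have "emeasure (density (\<mu> f) (indicator Y)) X = (\<integral>\<^sup>+x. indicator (Y \<inter> X) x \<partial>\<mu> f)"
    using X Y by (simp only: indicator_inter_arith) (subst emeasure_density; simp)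
  also have "\<dots> = emeasure (\<mu> f) (Y \<inter> X)"
    using X Y by (intro nn_integral_indicator) simp
  finally show "emeasure (\<mu> (E Y f)) X = emeasure (density (\<mu> f) (indicator Y)) X"
    using X Y f by (simp add: emeasure_\<mu> E_S E_Int Int_commute)
qed simp

lemma cinner_T_E:
  assumes f: "f \<in> S" and Y: "Y \<in> sets borel"
  shows "cinner (E Y f) (T (E Y f)) = complex_of_real (\<integral>x. indicator Y x * x \<partial>\<mu> f)"
proof -
  have "(indicator Y :: real \<Rightarrow> ennreal) = (\<lambda>x. ennreal (indicator Y x))"
    by (auto simp: indicator_def)
  then have "(\<integral>x. x \<partial>\<mu> (E Y f)) = (\<integral>x. indicator Y x *\<^sub>R x \<partial>\<mu> f)"
    using Y by (simp add: \<mu>_E[OF f Y]) (subst integral_density; simp)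
  then show ?thesis using cinner_T[OF E_S[OF Y f]] by simp
qed

text \<open>The spectral integral prescribes only the diagonal values \<open>cinner f (T f)\<close>.
  Applied to sums from the two ranges with a factor 1 or \<open>\<i>\<close>, the splitting kills
  the off-diagonal part of \<open>T\<close> in \<open>E_T_orth\<close>, and \<open>E_T\<close> then
  makes \<open>T\<close> commute with \<open>E Y\<close>.\<close>

lemma T_split:
  assumes f: "f \<in> S" and Y: "Y \<in> sets borel"
  shows "cinner f (T f) = cinner (E Y f) (T (E Y f)) + cinner (E (- Y) f) (T (E (- Y) f))"
proof -
  have int: "integrable (\<mu> f) (\<lambda>x. indicator Z x * x)" if "Z \<in> sets borel" for Z
    using integrable_mult_indicator[OF _ integrable_\<mu>[OF f], of Z] that by simp
  have "(\<integral>x. x \<partial>\<mu> f) = (\<integral>x. indicator Y x * x + indicator (- Y) x * x \<partial>\<mu> f)"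
    by (intro Bochner_Integration.integral_cong) (auto simp: indicator_def)
  also have "\<dots> = (\<integral>x. indicator Y x * x \<partial>\<mu> f) + (\<integral>x. indicator (- Y) x * x \<partial>\<mu> f)"
    using Y by (intro Bochner_Integration.integral_add int) auto
  finally show ?thesis using f Y by (simp add: cinner_T cinner_T_E)
qed

lemma E_T_orth:
  assumes f: "f \<in> S" "g \<in> S" and Y: "Y \<in> sets borel"
  shows "cinner (E Y f) (T (E (- Y) g)) = 0"
proof -
  let ?f = "E Y f" and ?g = "E (- Y) g"
  have Y': "- Y \<in> sets borel" using Y by simp
  have fg: "?f \<in> S" "?g \<in> S" using f Y by (simp_all add: E_S)
  have E0: "E Y ?g = 0" "E (- Y) ?f = 0"
    using E_disjoint[OF Y' Y _ f(2)] E_disjoint[OF Y Y' _ f(1)] by auto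
  have *: "Re (cinner ?f (T (c *\<^sub>C ?g))) = 0" for c
  proof -
    let ?h = "?f + c *\<^sub>C ?g"
    have h: "?h \<in> S" using fg by (intro S_simps)
    have "E Y ?h = ?f" "E (- Y) ?h = c *\<^sub>C ?g"
      using E_idem[OF Y f(1)] E_idem[OF Y' f(2)] Y Y' fg
      by (simp_all add: E_simps S_simps E0)
    then have "cinner ?h (T ?h) = cinner ?f (T ?f) + cinner (c *\<^sub>C ?g) (T (c *\<^sub>C ?g))"
      using T_split[OF h Y] by simp
    then have "cinner ?f (T (c *\<^sub>C ?g)) + cinner (c *\<^sub>C ?g) (T ?f) = 0"
      unfolding T_simps(4) cinner_add_left cinner_add_right by (simp add: algebra_simps)
    moreover have "cinner (c *\<^sub>C ?g) (T ?f) = cnj (cinner ?f (T (c *\<^sub>C ?g)))"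
      using T_simps(3) cinner_commute by metis
    ultimately show ?thesis by (metis complex_add_cnj mult_eq_0_iff of_real_eq_0_iff zero_neq_numeral)
  qed
  from *[of 1] *[of \<i>] show ?thesis
    by (intro complex_eqI) (simp_all add: T_simps cinner_scaleC_right)
qed

lemma E_T:
  assumes f: "f \<in> S" and Y: "Y \<in> sets borel"
  shows "E Y (T f) = T (E Y f)"
proof -
  have Y': "- Y \<in> sets borel" using Y by simp
  have 0: "E X (T (E (- X) f)) = 0" if X: "X \<in> sets borel" for X
  proof (rule cinner_eqI[where S = S])
    fix h assume h: "h \<in> S"
    have X': "- X \<in> sets borel" using X by simp
    show "cinner h (E X (T (E (- X) f))) = cinner h 0"
      using E_T_orth[OF h f X] E_sa[OF X h T_S[OF E_S[OF X' f]]] by (simp add: cinner.zero_right)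
  qed (use X f in \<open>simp add: E_S T_S\<close>)
  have "E Y (T f) = E Y (T (E Y f) + T (E (- Y) f))"
    using E_compl[OF Y f] by (simp add: T_simps(4)[symmetric])
  also have "\<dots> = E Y (T (E Y f))"
    using Y Y' f 0[OF Y] by (simp add: E_simps E_S T_S)
  also have "\<dots> = T (E Y f)"
    using E_compl[OF Y T_S[OF E_S[OF Y f]]] 0[OF Y'] by simp
  finally show ?thesis .
qed

text \<open>On the range of the projection the form of \<open>T - a\<close> is the integral of
  \<open>x - a\<close> over an interval where this function is at most \<open>h\<close> in modulus;
  \<open>symmetric_norm_le\<close> passes from the form to the norm.\<close>

lemma E_interval_norm:
  assumes f: "f \<in> S" and h: "h \<ge> 0"
  shows "norm (T (E {a-h..a+h} f) - a *\<^sub>R E {a-h..a+h} f) \<le> h * norm (E {a-h..a+h} f)"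
proof (rule symmetric_norm_le[where T = "\<lambda>x. T x - a *\<^sub>R x" and M = "E {a-h..a+h} ` S"])
  let ?Y = "{a-h..a+h}"
  have Y: "?Y \<in> sets borel" by simp
  show "bounded_linear (\<lambda>x. T x - a *\<^sub>R x)"
    by (intro bounded_linear_sub T_simps(1) bounded_linear_scaleR_right)
  show "inner x (T y - a *\<^sub>R y) = inner (T x - a *\<^sub>R x) y" for x y
    using T_simps(3)[of x y] unfolding Re_cinner[symmetric]
    by (simp add: cinner.diff_left cinner.diff_right cinner.scaleR_left cinner.scaleR_right)
  show "subspace (E ?Y ` S)"
    unfolding subspace_def
  proof (intro conjI ballI allI)
    show "0 \<in> E ?Y ` S" by (rule image_eqI[of _ _ 0]) (simp_all add: S_simps E_simps[OF Y])
    show "x + y \<in> E ?Y ` S" if xy: "x \<in> E ?Y ` S" "y \<in> E ?Y ` S" for x y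
    proof -
      obtain u v where "u \<in> S" "v \<in> S" "x = E ?Y u" "y = E ?Y v" using xy by blast
      then show ?thesis by (intro image_eqI[of _ _ "u + v"]) (simp_all add: S_simps E_simps[OF Y])
    qed
    show "c *\<^sub>R x \<in> E ?Y ` S" if x: "x \<in> E ?Y ` S" for x c
    proof -
      obtain u where "u \<in> S" "x = E ?Y u" using x by blast
      then show ?thesis by (intro image_eqI[of _ _ "c *\<^sub>R u"]) (simp_all add: S_simps E_simps[OF Y])
    qed
  qed
  show "(\<lambda>x. T x - a *\<^sub>R x) ` E ?Y ` S \<subseteq> E ?Y ` S"
  proof (clarsimp)
    fix g assume g: "g \<in> S"
    have "T (E ?Y g) - a *\<^sub>R E ?Y g = E ?Y (T g - a *\<^sub>R g)"
      using g Y by (simp add: E_simps E_T T_S S_simps)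
    then show "T (E ?Y g) - a *\<^sub>R E ?Y g \<in> E ?Y ` S" using g by (simp add: T_S S_simps)
  qed
  show "\<bar>inner x (T x - a *\<^sub>R x)\<bar> \<le> h * (norm x)\<^sup>2" if x: "x \<in> E ?Y ` S" for x
  proof -
    obtain g where g: "g \<in> S" "x = E ?Y g" using x by blast
    interpret finite_measure "\<mu> g" by (rule finite_\<mu>[OF g(1)])
    have int: "integrable (\<mu> g) (\<lambda>x. indicator ?Y x * x)"
      using integrable_mult_indicator[OF _ integrable_\<mu>[OF g(1)], of ?Y] by simp
    have intc: "integrable (\<mu> g) (\<lambda>x. indicator ?Y x * c)" for c :: real
      by (intro integrable_mult_left integrable_real_indicator) (auto simp: emeasure_finite less_top[symmetric])
    have val: "(\<integral>x. indicator ?Y x * c \<partial>\<mu> g) = (norm x)\<^sup>2 * c" for c :: real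
      using measure_\<mu>[OF g(1) Y] by (simp add: g(2))
    have "inner x (T x - a *\<^sub>R x) = (\<integral>x. indicator ?Y x * x \<partial>\<mu> g) - a * (norm x)\<^sup>2"
      using arg_cong[OF cinner_T_E[OF g(1) Y], of Re]
      by (simp add: Re_cinner g(2) inner_diff power2_norm_eq_inner)
    moreover have "(\<integral>x. indicator ?Y x * x \<partial>\<mu> g) \<le> (\<integral>x. indicator ?Y x * (a + h) \<partial>\<mu> g)"
      by (intro integral_mono int intc) (auto simp: indicator_def)
    moreover have "(\<integral>x. indicator ?Y x * (a - h) \<partial>\<mu> g) \<le> (\<integral>x. indicator ?Y x * x \<partial>\<mu> g)"
      by (intro integral_mono int intc) (auto simp: indicator_def)
    ultimately show ?thesis unfolding val by (simp add: abs_le_iff algebra_simps)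
  qed
qed (use f h in auto)

text \<open>The imaginary part of \<open>\<langle>f, R(a + ih) f\<rangle>\<close> is \<open>h \<parallel>u\<parallel>\<^sup>2\<close> with \<open>u = R(a + ih) f\<close>,
  and on the range of \<open>E [a - h, a + h]\<close> the operator \<open>T - (a + ih)\<close> has norm at most \<open>2 h\<close>.\<close>

lemma E_null:
  assumes f: "f \<in> S" and c: "c \<ge> 0"
    and lap: "\<And>a h. h > 0 \<Longrightarrow> \<exists>u\<in>S. T u - Complex a h *\<^sub>C u = f \<and> cmod (cinner f u) \<le> c"
    and X: "X \<in> null_sets lborel"
  shows "E X f = 0"
proof -
  have ivl: "(norm (E {a-h..a+h} f))\<^sup>2 \<le> 4 * c * h" if h: "h > 0" for a h
  proof -
    let ?Y = "{a-h..a+h}"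
    have Y: "?Y \<in> sets borel" by simp
    obtain u where u: "u \<in> S" "T u - Complex a h *\<^sub>C u = f" "cmod (cinner f u) \<le> c"
      using lap[OF h] by blast
    have z: "Complex a h *\<^sub>C x = a *\<^sub>R x + (\<i> * of_real h) *\<^sub>C x" for x :: 'h
      by (simp add: scaleC_of_real[symmetric] scaleC_add_left[symmetric] Complex_eq)
    have "Im (cinner u f) = Im (cinner u (T u)) - h * (norm u)\<^sup>2"
      by (simp add: u(2)[symmetric] cinner.diff_right cinner_scaleC_right cinner_self)
    moreover have "Im (cinner u (T u)) = 0"
      using T_simps(3) by (metis cinner_commute cnj.simps(2) equal_neg_zero)
    moreover have "\<bar>Im (cinner u f)\<bar> \<le> c"
      using u(3) abs_Im_le_cmod[of "cinner u f"] by (metis cinner_commute complex_mod_cnj order.trans)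
    ultimately have hu: "h * (norm u)\<^sup>2 \<le> c" by simp
    have "E ?Y f = E ?Y (T u) - Complex a h *\<^sub>C E ?Y u"
      using u Y by (simp add: u(2)[symmetric] E_simps T_S S_simps)
    then have "E ?Y f = (T (E ?Y u) - a *\<^sub>R E ?Y u) - (\<i> * of_real h) *\<^sub>C E ?Y u"
      using u Y by (simp add: E_T z)
    then have "norm (E ?Y f) \<le> norm (T (E ?Y u) - a *\<^sub>R E ?Y u) + norm ((\<i> * of_real h) *\<^sub>C E ?Y u)"
      using norm_triangle_ineq4 by metis
    also have "\<dots> \<le> h * norm (E ?Y u) + h * norm (E ?Y u)"
      using E_interval_norm[OF u(1), of h a] h by (simp add: norm_scaleC norm_mult)
    also have "\<dots> \<le> 2 * h * norm u" using E_norm_le[OF Y u(1)] h by simp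
    finally have "(norm (E ?Y f))\<^sup>2 \<le> (2 * h * norm u)\<^sup>2" by (intro power_mono) auto
    also have "\<dots> = 4 * h * (h * (norm u)\<^sup>2)" by (simp add: power2_eq_square)
    also have "\<dots> \<le> 4 * h * c" using hu h by (intro mult_left_mono) auto
    finally show ?thesis by (simp add: algebra_simps)
  qed
  have "emeasure (\<mu> f) X = 0"
  proof (rule null_sets_lborel_if_interval_bound[where c = "2 * c"])
    fix a b :: real assume ab: "a < b"
    have "emeasure (\<mu> f) {a..b} = ennreal ((norm (E {(a+b)/2 - (b-a)/2..(a+b)/2 + (b-a)/2} f))\<^sup>2)"
      by (subst emeasure_\<mu>[OF f]) (simp_all add: diff_divide_distrib[symmetric] add_divide_distrib[symmetric])
    also have "\<dots> \<le> ennreal (4 * c * ((b - a) / 2))"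
      using ab by (intro ennreal_leI ivl) simp
    also have "4 * c * ((b - a) / 2) = 2 * c * (b - a)" by simp
    finally show "emeasure (\<mu> f) {a..b} \<le> ennreal (2 * c * (b - a))" .
  qed (use c X in auto)
  moreover have "X \<in> sets borel" using X by auto
  ultimately show ?thesis using f by (simp add: emeasure_\<mu>)
qed

end



section \<open>Dyadic decompositions in the interpolation space\<close>

text \<open>A telescoping series of near-optimal splittings at \<open>t = 2 ^ k\<close>; it represents \<open>x\<close> in the form
  underlying the J-method.\<close>

lemma interp_dyadic_decomposition:
  fixes X0 :: "'d::real_normed_vector set" and N0 :: "'d \<Rightarrow> real"
  defines "I \<equiv> interp_norm X0 N0 UNIV norm (1/2) 1"
  assumes X0: "subspace X0"
    and N0: "\<And>u v. u \<in> X0 \<Longrightarrow> v \<in> X0 \<Longrightarrow> N0 (u - v) \<le> N0 u + N0 v"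
    and N0_ge: "\<And>u. u \<in> X0 \<Longrightarrow> norm u \<le> N0 u"
    and x: "x \<in> interp_space X0 N0 UNIV norm (1/2) 1"
  obtains d where "\<And>k. d k \<in> X0" "(\<lambda>n. \<Sum>k<n. d k) \<longlonglongrightarrow> x"
    "\<And>n. (\<Sum>k<n. sqrt (norm (d k) * N0 (d k))) \<le> 15 * I x"
proof (cases "x = 0")
  case True
  have "0 \<le> I x" by (simp add: I_def interp_norm_def)
  then show thesis using True X0 by (intro that[of "\<lambda>_. 0"]) (auto simp: subspace_0)
next
  case x0: False
  define \<kappa> where "\<kappa> t = K_functional X0 N0 UNIV norm t x" for t
  define A where "A t = {N0 y + t * norm z | y z. y \<in> X0 \<and> z \<in> UNIV \<and> x = y + z}" for t
  have \<kappa>: "\<kappa> t = Inf (A t)" for t by (simp add: \<kappa>_def K_functional_def A_def)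
  have N0_0: "0 \<le> N0 u" if "u \<in> X0" for u using N0_ge[OF that] norm_ge_zero order.trans by blast
  have A_ne: "A t \<noteq> {}" for t
  proof -
    have "N0 0 + t * norm x \<in> A t"
      unfolding A_def using subspace_0[OF X0] by (intro CollectI exI[of _ 0] exI[of _ x]) simp
    then show ?thesis by blast
  qed
  have A_ge: "min 1 t * norm x \<le> a" if aA: "a \<in> A t" and t0: "t \<ge> 0" for a t
  proof -
    obtain y z where yz: "y \<in> X0" "x = y + z" "a = N0 y + t * norm z"
      using aA by (auto simp: A_def)
    have "min 1 t * norm x \<le> min 1 t * (norm y + norm z)"
      using t0 yz norm_triangle_ineq by (intro mult_left_mono) auto
    also have "\<dots> \<le> 1 * norm y + t * norm z"
      unfolding distrib_left by (intro add_mono mult_right_mono) auto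
    also have "\<dots> \<le> a" using N0_ge[OF yz(1)] yz by simp
    finally show ?thesis .
  qed
  have bdd: "bdd_below (A t)" if "t \<ge> 0" for t using A_ge that by (intro bdd_belowI)
  \<comment> \<open>Strict positivity, valid since \<open>x\<close> is not zero, leaves room for
    splittings that are optimal up to the factor 2.\<close>
  have \<kappa>_pos: "\<kappa> t > 0" if "t > 0" for t
  proof -
    have "0 < min 1 t * norm x" using that x0 by simp
    also have "\<dots> \<le> \<kappa> t" unfolding \<kappa> using A_ne A_ge that by (intro cInf_greatest) auto
    finally show ?thesis .
  qed
  have \<kappa>_mono: "\<kappa> s \<le> \<kappa> t" if "0 \<le> s" "s \<le> t" for s t
    unfolding \<kappa>[of t]
  proof (rule cInf_greatest[OF A_ne])
    fix a assume "a \<in> A t"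
    then obtain y z where yz: "y \<in> X0" "x = y + z" "a = N0 y + t * norm z"
      by (auto simp: A_def)
    have "\<kappa> s \<le> N0 y + s * norm z"
      unfolding \<kappa> by (rule cInf_lower[OF _ bdd]) (use yz that in \<open>auto simp: A_def\<close>)
    also have "\<dots> \<le> a" using yz that by (simp add: mult_right_mono)
    finally show "\<kappa> s \<le> a" .
  qed
  define k where "k n = \<kappa> (2 ^ n)" for n :: nat
  have k_pos: "k n > 0" for n by (simp add: k_def \<kappa>_pos)
  have k_mono: "k n \<le> k (Suc n)" for n by (simp add: k_def \<kappa>_mono)
  have "\<exists>y\<in>X0. N0 y + 2 ^ n * norm (x - y) < 2 * k n" for n
  proof -
    have "Inf (A (2 ^ n)) < 2 * k n" using k_pos[of n] by (simp add: k_def \<kappa>)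
    then obtain a where "a \<in> A (2 ^ n)" "a < 2 * k n"
      using cInf_lessD[OF A_ne] by blast
    then obtain y z where "y \<in> X0" "x = y + z" "N0 y + 2 ^ n * norm z < 2 * k n"
      by (auto simp: A_def)
    then show ?thesis by (intro bexI[of _ y]) simp_all
  qed
  then obtain y where y: "\<And>n. y n \<in> X0" "\<And>n. N0 (y n) + 2 ^ n * norm (x - y n) < 2 * k n"
    by metis
  have y1: "N0 (y n) \<le> 2 * k n" for n
    using y(2)[of n] zero_le_mult_iff[of "2 ^ n" "norm (x - y n)"] by (smt (verit) norm_ge_zero zero_le_power)
  have y2: "2 ^ n * norm (x - y n) \<le> 2 * k n" for n using y(2)[of n] N0_0[OF y(1)[of n]] by simp

  define a where "a n = k n / sqrt (2 ^ n)" for n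
  have a0: "a n \<ge> 0" for n using k_pos[of n] by (simp add: a_def)
  let ?J = "interp_integral X0 N0 UNIV norm (1/2) 1 x"
  have J: "?J < \<infinity>" using x by (simp add: interp_space_def)
  have I: "I x = enn2real ?J" by (simp add: I_def interp_norm_def)
  have sum_a: "(\<Sum>i<n. a i) \<le> 3 * I x" for n
  proof -
    \<comment> \<open>Since \<open>\<kappa>\<close> increases, \<open>c i\<close> bounds the
      integrand \<open>\<kappa> t / (sqrt t * t)\<close> from below on
      \<open>[2^i, 2^(i+1))\<close>, an interval of length \<open>2^i\<close>. The product
      \<open>c i * 2^i\<close> is \<open>a i / (2 * sqrt 2)\<close>, and
      \<open>2 * sqrt 2 \<le> 3\<close> gives the factor 3.\<close>
    define c where "c i = k i / (sqrt (2 ^ Suc i) * 2 ^ Suc i)" for i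
    define Y where "Y i = {2 ^ i..<2 ^ Suc i :: real}" for i :: nat
    have c0: "c i \<ge> 0" for i using k_pos[of i] by (simp add: c_def)
    have Y_uniq: "i = l" if "t \<in> Y i" "t \<in> Y l" for t i l
    proof (rule ccontr)
      have no: "\<not> p < q" if t: "t \<in> Y p" "t \<in> Y q" for p q
      proof
        assume "p < q"
        then have "(2::real) ^ Suc p \<le> 2 ^ q" by (intro power_increasing) auto
        then show False using t unfolding Y_def atLeastLessThan_iff by linarith
      qed
      assume "i \<noteq> l"
      then show False using no that by (meson nat_neq_iff)
    qed
    have "ennreal (\<Sum>i<n. c i * 2 ^ i) = (\<Sum>i<n. ennreal (c i) * emeasure lborel (Y i))"
      using c0 by (simp add: Y_def ennreal_mult sum_nonneg flip: sum_ennreal)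
    also have "\<dots> = (\<integral>\<^sup>+t. (\<Sum>i<n. ennreal (c i) * indicator (Y i) t) \<partial>lborel)"
      by (subst nn_integral_sum) (auto simp: Y_def nn_integral_cmult_indicator)
    also have "\<dots> \<le> ?J"
      unfolding interp_integral_def
    proof (rule nn_integral_mono)
      fix t :: real
      let ?f = "ennreal ((t powr - (1 / 2) * K_functional X0 N0 UNIV norm t x) powr 1 / t)"
      show "(\<Sum>i<n. ennreal (c i) * indicator (Y i) t) \<le> ?f * indicator {0<..} t"
      proof (cases "\<exists>l<n. t \<in> Y l")
        case True
        then obtain l where l: "l < n" "t \<in> Y l" by blast
        have "(\<Sum>i<n. ennreal (c i) * indicator (Y i) t) = (\<Sum>i\<in>{l}. ennreal (c i) * indicator (Y i) t)"
          using l Y_uniq by (intro sum.mono_neutral_right) (auto simp: indicator_def)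
        also have "\<dots> = ennreal (c l)" using l by simp
        also have "\<dots> \<le> ?f"
        proof (rule ennreal_leI)
          have t: "t > 0" "2 ^ l \<le> t" "t \<le> 2 ^ Suc l"
            using l(2) less_le_trans[of 0 "2 ^ l" t] by (auto simp: Y_def)
          have "c l \<le> \<kappa> t / (sqrt t * t)"
            unfolding c_def k_def using t \<kappa>_pos[OF t(1)]
            by (intro frac_le \<kappa>_mono mult_mono) auto
          also have "\<dots> = (t powr - (1 / 2) * \<kappa> t) powr 1 / t"
            using t \<kappa>_pos[OF t(1)] by (simp add: powr_minus powr_half_sqrt field_simps)
          finally show "c l \<le> (t powr - (1 / 2) * K_functional X0 N0 UNIV norm t x) powr 1 / t"
            by (simp add: \<kappa>_def)
        qed
        finally show ?thesis using l(2) less_le_trans[of 0 "2 ^ l" t] by (auto simp: Y_def)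
      next
        case False
        then have "(\<Sum>i<n. ennreal (c i) * indicator (Y i) t) = 0" by (intro sum.neutral) auto
        then show ?thesis by simp
      qed
    qed
    finally have "enn2real (ennreal (\<Sum>i<n. c i * 2 ^ i)) \<le> I x"
      unfolding I using J by (intro enn2real_mono) auto
    then have "(\<Sum>i<n. c i * 2 ^ i) \<le> I x" using c0 by (simp add: sum_nonneg)
    moreover have "a i \<le> 3 * (c i * 2 ^ i)" for i
    proof -
      have "sqrt 2 \<le> 3 / 2" by (rule real_le_lsqrt) (simp_all add: power2_eq_square)
      have "c i * 2 ^ i = a i * (1 / (2 * sqrt 2))"
        by (simp add: c_def a_def real_sqrt_mult)
      moreover have "1 \<le> 3 * (1 / (2 * sqrt 2))"
        using \<open>sqrt 2 \<le> 3 / 2\<close> by (simp add: field_simps)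
      ultimately show ?thesis using mult_left_mono[OF _ a0[of i]]
        by (metis mult.left_commute mult.right_neutral)
    qed
    then have "(\<Sum>i<n. a i) \<le> 3 * (\<Sum>i<n. c i * 2 ^ i)"
      unfolding sum_distrib_left by (intro sum_mono) auto
    ultimately show ?thesis by linarith
  qed

  \<comment> \<open>The series starts at \<open>t = 1\<close> with \<open>y 0\<close> as a whole;
    because \<open>N0\<close> dominates the norm, this term is bounded like the differences.\<close>
  define d where "d n = (case n of 0 \<Rightarrow> y 0 | Suc i \<Rightarrow> y (Suc i) - y i)" for n
  have d_simps: "d 0 = y 0" "d (Suc i) = y (Suc i) - y i" for i by (simp_all add: d_def)
  have dX: "d n \<in> X0" for n by (cases n) (simp_all add: d_simps y X0 subspace_diff)
  have sum_d: "(\<Sum>i<Suc n. d i) = y n" for n by (induction n) (simp_all add: d_simps)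
  \<comment> \<open>Passing from scale \<open>n - 1\<close> to \<open>n\<close> doubles one error,
    so the norm is at most \<open>(2 * 2 + 2) * k n / 2 ^ n\<close>, and \<open>N0\<close>
    contributes \<open>2 + 2\<close>. As 6 times 4 is below 25, the root is at most
    \<open>5 * a n\<close>; with \<open>sum_a\<close> this makes the 15.\<close>
  have d_le: "sqrt (norm (d n) * N0 (d n)) \<le> 5 * a n" for n
  proof -
    have "norm (d n) * N0 (d n) \<le> (6 * k n / 2 ^ n) * (4 * k n)"
    proof (cases n)
      case 0
      have "norm (y 0) * N0 (y 0) \<le> (2 * k 0) * (2 * k 0)"
        using y1[of 0] N0_ge[OF y(1)[of 0]] N0_0[OF y(1)[of 0]] by (intro mult_mono) auto
      also have "\<dots> \<le> (6 * k 0) * (4 * k 0)" using k_pos[of 0] by simp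
      finally show ?thesis using 0 by (simp add: d_simps)
    next
      case (Suc i)
      have p: "2 ^ i * norm (x - y i) \<le> 2 * k n"
        using y2[of i] k_mono[of i] Suc by simp
      have q: "2 ^ n * norm (x - y n) \<le> 2 * k n" by (rule y2)
      have "norm (d n) \<le> norm (x - y i) + norm (x - y n)"
        using norm_triangle_ineq4[of "x - y i" "x - y n"] Suc by (simp add: d_simps)
      then have "2 ^ n * norm (d n) \<le> 2 ^ n * (norm (x - y i) + norm (x - y n))"
        by (intro mult_left_mono) auto
      also have "\<dots> = 2 * (2 ^ i * norm (x - y i)) + 2 ^ n * norm (x - y n)"
        using Suc by (simp add: algebra_simps)
      also have "\<dots> \<le> 6 * k n" using p q by linarith
      finally have 1: "norm (d n) \<le> 6 * k n / 2 ^ n" by (simp add: field_simps)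
      have "N0 (d n) \<le> N0 (y (Suc i)) + N0 (y i)" using N0[OF y(1) y(1)] Suc by (simp add: d_simps)
      also have "\<dots> \<le> 4 * k n" using y1[of "Suc i"] y1[of i] k_mono[of i] Suc by simp
      finally have 2: "N0 (d n) \<le> 4 * k n" .
      show ?thesis using 1 2 N0_0[OF dX] k_pos[of n] by (intro mult_mono) auto
    qed
    also have "\<dots> \<le> (5 * a n)\<^sup>2"
      by (simp add: a_def power_mult_distrib power_divide) (simp add: power2_eq_square field_simps)
    finally show ?thesis using a0[of n] by (intro real_le_lsqrt) (auto simp: N0_0[OF dX])
  qed
  show thesis
  proof (rule that[of d])
    show "d n \<in> X0" for n by (rule dX)
    show "(\<Sum>i<n. sqrt (norm (d i) * N0 (d i))) \<le> 15 * I x" for n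
    proof -
      have "(\<Sum>i<n. sqrt (norm (d i) * N0 (d i))) \<le> 5 * (\<Sum>i<n. a i)"
        unfolding sum_distrib_left by (intro sum_mono d_le)
      then show ?thesis using sum_a[of n] by linarith
    qed
    have lim: "(\<lambda>n. y n - x) \<longlonglongrightarrow> 0"
    proof (rule Lim_null_comparison)
      have "norm (y n - x) \<le> 6 * I x * (1 / sqrt 2) ^ n" for n
      proof -
        have "a n \<le> (\<Sum>i<Suc n. a i)" using a0 by (simp add: sum_nonneg)
        then have an: "a n \<le> 3 * I x" using sum_a[of "Suc n"] by linarith
        have "sqrt (2 ^ n) * (sqrt (2 ^ n) * norm (x - y n)) = 2 ^ n * norm (x - y n)"
          by (simp flip: mult.assoc)
        also have "\<dots> \<le> sqrt (2 ^ n) * (2 * a n)" using y2[of n] by (simp add: a_def)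
        finally have "sqrt (2 ^ n) * (sqrt (2 ^ n) * norm (x - y n)) \<le> sqrt (2 ^ n) * (2 * a n)" .
        then have "sqrt (2 ^ n) * norm (x - y n) \<le> 2 * a n" by simp
        then have "norm (x - y n) \<le> 2 * a n / sqrt (2 ^ n)" by (simp add: field_simps)
        also have "\<dots> \<le> 6 * I x / sqrt (2 ^ n)" using an by (intro divide_right_mono) auto
        finally show ?thesis by (simp add: norm_minus_commute power_divide real_sqrt_power)
      qed
      then show "\<forall>\<^sub>F n in sequentially. norm (y n - x) \<le> 6 * I x * (1 / sqrt 2) ^ n" by simp
      show "(\<lambda>n. 6 * I x * (1 / sqrt 2) ^ n) \<longlonglongrightarrow> 0"
        by (intro tendsto_mult_right_zero LIMSEQ_power_zero) simp
    qed
    have "(\<lambda>n. \<Sum>i<Suc n. d i) \<longlonglongrightarrow> x" unfolding sum_d by (rule LIM_zero_cancel[OF lim])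
    then show "(\<lambda>n. \<Sum>i<n. d i) \<longlonglongrightarrow> x" by (rule LIMSEQ_imp_Suc)
  qed
qed

section \<open>Summation of the bilinear estimate\<close>

context weakly_conjugate
begin

lemma R_sum:
  assumes a: "adm \<epsilon> z" and f: "\<And>k. f k \<in> G"
  shows "R \<epsilon> z (\<Sum>k<(n::nat). f k) = (\<Sum>k<n. R \<epsilon> z (f k))"
proof (induction n)
  case 0
  show ?case using R_diff[OF a G_simps(1) G_simps(1)] by simp
next
  case (Suc n)
  have "(\<Sum>k<n. f k) \<in> G" using f G_simps(7) by (intro subspace_sum) auto
  then show ?case using Suc by (simp add: R_add[OF a] f)
qed

text \<open>The bilinear bound factorises over the two arguments, so the double sum for a partial
  sum is the square of a single sum; continuity of the resolvent off the real axis passes to the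
  limit.\<close>

lemma resolvent_series_bound:
  assumes z: "Im z > 0" and f: "\<And>k. f k = 0 \<or> datum (f k) (p k) (N k)"
    and pN: "\<And>k. 0 \<le> p k * N k"
    and lim: "(\<lambda>n. \<Sum>k<n. f k) \<longlonglongrightarrow> g" and s: "\<And>n. (\<Sum>k<n. sqrt (p k * N k)) \<le> s"
  shows "cmod (cinner g (R 0 z g)) \<le> c2 * s\<^sup>2"
proof -
  have a: "adm 0 z" using z by (simp add: adm_def)
  have fG: "f k \<in> G" for k using f[of k] G_simps(1) by (auto simp: datum_def)
  have SG: "(\<Sum>k<n. f k) \<in> G" for n using fG G_simps(7) by (intro subspace_sum) auto
  have gG: "g \<in> G" using closed_sequentially[OF G(2) _ lim] SG by blast
  let ?q = "\<lambda>k. sqrt (p k * N k)"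
  have pair: "cmod (cinner (f k) (R 0 z (f l))) \<le> c2 * (?q k * ?q l)" for k l
  proof (cases "f k = 0 \<or> f l = 0")
    case True
    have "R 0 z 0 = 0" using R_diff[OF a G_simps(1) G_simps(1)] by simp
    then have "cinner (f k) (R 0 z (f l)) = 0"
      using True by (auto simp: cinner.zero_left cinner.zero_right)
    then show ?thesis using c2 pN by simp
  next
    case False
    then show ?thesis using F_bilinear[OF z] f by blast
  qed
  have part: "cmod (cinner (\<Sum>k<n. f k) (R 0 z (\<Sum>k<n. f k))) \<le> c2 * s\<^sup>2" for n
  proof -
    have "cmod (cinner (\<Sum>k<n. f k) (R 0 z (\<Sum>k<n. f k))) \<le> (\<Sum>l<n. \<Sum>k<n. c2 * (?q k * ?q l))"
      unfolding R_sum[OF a fG] cinner.sum_left cinner.sum_right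
      by (rule order.trans[OF norm_sum sum_mono], rule order.trans[OF norm_sum sum_mono], rule pair)
    also have "\<dots> = c2 * (\<Sum>k<n. ?q k)\<^sup>2"
      unfolding power2_eq_square sum_product by (subst sum.swap) (simp add: sum_distrib_left)
    also have "\<dots> \<le> c2 * s\<^sup>2"
      using s[of n] c2 pN by (intro mult_left_mono power_mono) (auto intro!: sum_nonneg)
    finally show ?thesis .
  qed
  have "(\<lambda>n. cmod (cinner (\<Sum>k<n. f k) (R 0 z (\<Sum>k<n. f k)))) \<longlonglongrightarrow> cmod (cinner g (R 0 z g))"
    by (intro tendsto_norm tendsto_cinner lim R_tendsto[OF a lim] SG gG)
  then show ?thesis using part by (intro LIMSEQ_le_const2) auto
qed

end



section \<open>The completions\<close>

instance complex_banach \<subseteq> banach ..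

text \<open>All norms are expressed through \<open>K\<close>: as \<open>B\<close> is
  \<open>K\<^sup>2\<close>, the norm of \<open>f\<close> in \<open>\<B>\<close> and the dual norm of
  \<open>K (K f)\<close> are both \<open>norm (K f)\<close>. \<open>D0\<close> stands for the domain
  of \<open>A\<close> inside \<open>G\<close>.\<close>

locale conjugate_completion =
  fixes G D0 :: "'h::complex_hilbert set" and H K :: "'h \<Rightarrow> 'h" and U :: "real \<Rightarrow> 'h \<Rightarrow> 'h"
    and j :: "'h \<Rightarrow> 'b::complex_banach" and j' :: "'h \<Rightarrow> 'd::complex_banach" and e :: "'d \<Rightarrow> 'h"
    and B0 :: "'b \<Rightarrow> 'd" and V :: "real \<Rightarrow> 'b \<Rightarrow> 'b"
  assumes H: "bounded_selfadjoint H" and H_G: "\<And>f. f \<in> G \<Longrightarrow> H f \<in> G"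
    and K: "bounded_selfadjoint K" and G_def: "G = orth_complement {f. K f = 0}"
    and U_G: "\<And>t f. f \<in> G \<Longrightarrow> U t f \<in> G" and U_lin: "\<And>t. clinear_on G (U t)"
    and U_iso: "\<And>t f g. f \<in> G \<Longrightarrow> g \<in> G \<Longrightarrow> cinner (U t f) (U t g) = cinner f g"
    and U_0: "\<And>f. f \<in> G \<Longrightarrow> U 0 f = f"
    and U_add: "\<And>s t f. f \<in> G \<Longrightarrow> U (s + t) f = U s (U t f)"
    and U_cont: "\<And>f. f \<in> G \<Longrightarrow> continuous_on UNIV (\<lambda>t. U t f)"
    and H_deriv: "\<And>u. u \<in> G \<Longrightarrow> ((\<lambda>t. U (- t) (H (U t u))) has_vector_derivative K (K u)) (at 0)"
    and D0: "D0 \<subseteq> G" "G \<subseteq> closure D0"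
      "\<And>f. f \<in> D0 \<Longrightarrow> \<exists>g\<in>G. ((\<lambda>t. U t f) has_vector_derivative g) (at 0)"
    and j: "clinear_on G j" "\<And>f. f \<in> G \<Longrightarrow> norm (j f) = norm (K f)" "closure (j ` G) = UNIV"
    and j': "clinear_on ((\<lambda>f. K (K f)) ` G) j'" "\<And>f. f \<in> G \<Longrightarrow> norm (j' (K (K f))) = norm (K f)"
      "closure (j' ` (\<lambda>f. K (K f)) ` G) = UNIV"
    and e: "bounded_clinear e" "\<And>f. f \<in> G \<Longrightarrow> e (j' (K (K f))) = K (K f)"
    and B0: "bounded_clinear B0" "\<And>f. f \<in> G \<Longrightarrow> B0 (j f) = j' (K (K f))"
    and V: "C0_group V" "\<And>t f. f \<in> G \<Longrightarrow> V t (j f) = j (U t f)"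
    and C1: "strongly_differentiable (\<lambda>t. restrict_group e U (- t) \<circ> B0 \<circ> V t)"
begin

section \<open>The completion of the range of \<open>K\<^sup>2\<close> as a dual space\<close>

lemmas K_simps = bounded_selfadjointD[OF K]

lemma G: "csubspace_on G" "closed G"
  by (simp_all add: G_def orth_complement_csubspace orth_complement_closed)

lemmas G_simps = csubspace_onD[OF G(1)]

lemma K_range: "K f \<in> G"
  by (simp add: G_def orth_complement_def K_simps(3)[symmetric] cinner.zero_left)

lemma K_inj: "f \<in> G \<Longrightarrow> K f = 0 \<Longrightarrow> f = 0"
  by (auto simp: G_def orth_complement_def cinner_self)

lemmas j_simps = clinear_onD[OF j(1) G(1)]

lemma KKG: "csubspace_on ((\<lambda>f. K (K f)) ` G)"
  unfolding csubspace_on_def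
proof (intro conjI ballI allI)
  show "0 \<in> (\<lambda>f. K (K f)) ` G"
    by (rule image_eqI[of _ _ 0]) (simp_all add: K_simps(7) G_simps)
  fix x assume "x \<in> (\<lambda>f. K (K f)) ` G"
  then obtain f where f: "f \<in> G" "x = K (K f)" by blast
  show "c *\<^sub>C x \<in> (\<lambda>f. K (K f)) ` G" for c
    using f by (intro image_eqI[of _ _ "c *\<^sub>C f"]) (simp_all add: K_simps(6) G_simps)
  fix y assume "y \<in> (\<lambda>f. K (K f)) ` G"
  then obtain g where g: "g \<in> G" "y = K (K g)" by blast
  show "x + y \<in> (\<lambda>f. K (K f)) ` G"
    using f g by (intro image_eqI[of _ _ "f + g"]) (simp_all add: K_simps(4) G_simps)
qed

lemma j'_diff: "f \<in> G \<Longrightarrow> g \<in> G \<Longrightarrow> j' (K (K f)) - j' (K (K g)) = j' (K (K (f - g)))"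
  by (simp add: K_simps(5) clinear_onD(3)[OF j'(1) KKG])

sublocale e: bounded_linear e
  using e(1) by (rule bounded_clinearD)

lemma approx: obtains w where "\<And>n. w n \<in> G" "(\<lambda>n. j' (K (K (w n)))) \<longlonglongrightarrow> y"
proof -
  have "y \<in> closure (j' ` (\<lambda>f. K (K f)) ` G)" using j'(3) by simp
  then obtain v where v: "\<And>n. v n \<in> j' ` (\<lambda>f. K (K f)) ` G" "v \<longlonglongrightarrow> y"
    by (auto simp: closure_sequential)
  have "\<exists>w. w \<in> G \<and> v n = j' (K (K w))" for n using v(1)[of n] by blast
  then obtain w where w: "\<And>n. w n \<in> G" "\<And>n. v n = j' (K (K (w n)))" by metis
  have "v = (\<lambda>n. j' (K (K (w n))))" using w(2) by blast
  then show thesis using that w(1) v(2) by blast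
qed

lemma e_G: "e y \<in> G"
proof -
  obtain w where w: "\<And>n. w n \<in> G" "(\<lambda>n. j' (K (K (w n)))) \<longlonglongrightarrow> y" using approx[of y] by blast
  have "(\<lambda>n. K (K (w n))) \<longlonglongrightarrow> e y" using e.tendsto[OF w(2)] by (simp add: e(2) w(1))
  from closed_sequentially[OF G(2) K_range this] show ?thesis .
qed

lemma duality_le:
  assumes f: "f \<in> G"
  shows "cmod (cinner f (e y)) \<le> norm (K f) * norm y"
proof -
  obtain w where w: "\<And>n. w n \<in> G" "(\<lambda>n. j' (K (K (w n)))) \<longlonglongrightarrow> y" using approx[of y] by blast
  have "(\<lambda>n. K (K (w n))) \<longlonglongrightarrow> e y" using e.tendsto[OF w(2)] by (simp add: e(2) w(1))
  then have 1: "(\<lambda>n. cmod (cinner f (K (K (w n))))) \<longlonglongrightarrow> cmod (cinner f (e y))"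
    by (intro tendsto_intros)
  have 2: "(\<lambda>n. norm (K f) * norm (j' (K (K (w n))))) \<longlonglongrightarrow> norm (K f) * norm y"
    by (intro tendsto_intros w(2))
  have "cmod (cinner f (K (K (w n)))) \<le> norm (K f) * norm (j' (K (K (w n))))" for n
    using norm_cinner_le[of "K f" "K (w n)"] by (simp add: K_simps(3) j'(2) w(1))
  then show ?thesis by (intro LIMSEQ_le[OF 1 2]) auto
qed

text \<open>\<open>\<langle>w n, K\<^sup>2 (w n)\<rangle>\<close> is the squared norm of
  \<open>j' (K (K (w n)))\<close>, so testing with approximants of \<open>y\<close> recovers its
  norm. Together with \<open>duality_le\<close> this identifies the norm of \<open>'d\<close> as the
  dual norm; injectivity of \<open>e\<close> follows.\<close>

lemma norm_le_duality:
  assumes c: "c \<ge> 0" and le: "\<And>f. f \<in> G \<Longrightarrow> cmod (cinner f (e y)) \<le> c * norm (K f)"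
  shows "norm y \<le> c"
proof -
  obtain w where w: "\<And>n. w n \<in> G" "(\<lambda>n. j' (K (K (w n)))) \<longlonglongrightarrow> y" using approx[of y] by blast
  let ?v = "\<lambda>n. j' (K (K (w n)))"
  have nv: "(\<lambda>n. norm (?v n)) \<longlonglongrightarrow> norm y" by (intro tendsto_intros w(2))
  have "(norm (?v n))\<^sup>2 \<le> c * norm (?v n) + norm (?v n) * norm (?v n - y)" for n
  proof -
    have "(norm (?v n))\<^sup>2 = cmod (cinner (w n) (e (?v n)))"
      by (simp add: e(2) w(1) j'(2) K_simps(3)[symmetric] cinner_self norm_power)
    also have "e (?v n) = e y + e (?v n - y)" by (simp add: e.diff)
    also have "cmod (cinner (w n) \<dots>) \<le> cmod (cinner (w n) (e y)) + cmod (cinner (w n) (e (?v n - y)))"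
      unfolding cinner_add_right by (rule norm_triangle_ineq)
    also have "\<dots> \<le> c * norm (K (w n)) + norm (K (w n)) * norm (?v n - y)"
      by (intro add_mono le duality_le w(1))
    finally show ?thesis by (simp add: j'(2) w(1))
  qed
  moreover have "(\<lambda>n. c * norm (?v n) + norm (?v n) * norm (?v n - y)) \<longlonglongrightarrow>
      c * norm y + norm y * norm (y - y)"
    by (intro tendsto_intros w(2))
  ultimately have "(norm y)\<^sup>2 \<le> c * norm y + norm y * norm (y - y)"
    using LIMSEQ_le[OF tendsto_power[OF nv]] by blast
  then have "norm y * norm y \<le> norm y * c" by (simp add: power2_eq_square mult.commute)
  then show ?thesis using c by (cases "norm y = 0") auto
qed

lemma e_inj: "inj e"
proof (rule injI)
  fix x y assume "e x = e y"
  then have "norm (x - y) \<le> 0"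
    by (intro norm_le_duality) (simp_all add: e.diff cinner.zero_right)
  then show "x = y" by simp
qed

text \<open>This is the Riesz representation theorem in the completion of \<open>G\<close> with respect to \<open>norm (K f)\<close>.\<close>

lemma range_e:
  assumes h: "h \<in> G" and le: "\<And>f. f \<in> G \<Longrightarrow> cmod (cinner f h) \<le> c * norm (K f)"
  shows "h \<in> range e"
proof -
  obtain w k where w: "range w \<subseteq> G" "(\<lambda>n. K (w n)) \<longlonglongrightarrow> k"
    and k: "\<And>f. f \<in> G \<Longrightarrow> inner (K f) k = inner f h"
  proof (rule riesz_seminorm[of G K "\<lambda>f. inner f h" c])
    show "\<bar>inner f h\<bar> \<le> c * norm (K f)" if "f \<in> G" for f
      using le[OF that] abs_Re_le_cmod[of "cinner f h"] by (simp add: Re_cinner)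
  qed (use G_simps(7) in \<open>auto simp: K_simps(4) inner_add linear_scale[OF bounded_linear.linear[OF K_simps(1)]]\<close>)
  have wG: "w n \<in> G" for n using w(1) by auto
  have "Cauchy (\<lambda>n. j' (K (K (w n))))"
  proof (rule CauchyI)
    fix \<epsilon> :: real assume "\<epsilon> > 0"
    then obtain M where "\<forall>m\<ge>M. \<forall>n\<ge>M. norm (K (w m) - K (w n)) < \<epsilon>"
      using CauchyD[OF LIMSEQ_imp_Cauchy[OF w(2)]] by blast
    moreover have "norm (j' (K (K (w m))) - j' (K (K (w n)))) = norm (K (w m) - K (w n))" for m n
      using j'(2)[OF G_simps(4)[OF wG wG], of m n] by (simp add: j'_diff[OF wG wG] K_simps(5))
    ultimately show "\<exists>M. \<forall>m\<ge>M. \<forall>n\<ge>M. norm (j' (K (K (w m))) - j' (K (K (w n)))) < \<epsilon>"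
      by auto
  qed
  then obtain y where y: "(\<lambda>n. j' (K (K (w n)))) \<longlonglongrightarrow> y"
    using convergent_eq_Cauchy by blast
  have "(\<lambda>n. K (K (w n))) \<longlonglongrightarrow> e y" using e.tendsto[OF y] by (simp add: e(2) wG)
  moreover have "(\<lambda>n. K (K (w n))) \<longlonglongrightarrow> K k"
    by (rule bounded_linear.tendsto[OF K_simps(1) w(2)])
  ultimately have ey: "e y = K k" by (rule LIMSEQ_unique)
  have "inner f (K k - h) = 0" if f: "f \<in> G" for f
    using k[OF f] K_simps(3)[of f k] by (simp add: cinner.diff_right Re_cinner[symmetric])
  from this[of "K k - h"] have "K k = h" using h K_range by (simp add: G_simps)
  then show ?thesis using ey by (metis rangeI)
qed

section \<open>The groups on the two completions\<close>

lemma V_bounded: "bounded_linear (V t)"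
  using V(1) by (auto simp: C0_group_def bounded_clinear_def)

lemma norm_K_U: "f \<in> G \<Longrightarrow> norm (K (U t f)) \<le> onorm (V t) * norm (K f)"
  using onorm[OF V_bounded, of t "j f"] by (simp add: V(2) j(2) U_G)

lemma U_adj:
  assumes "f \<in> G" "g \<in> G"
  shows "cinner (U (- t) f) g = cinner f (U t g)"
  using U_iso[of "U (- t) f" g t] U_add[of f t "- t"] U_0 assms by (simp add: U_G)

abbreviation "V' \<equiv> restrict_group e U"

lemma cinner_U_e:
  assumes f: "f \<in> G"
  shows "cmod (cinner f (U t (e y))) \<le> (onorm (V (- t)) * norm y) * norm (K f)"
proof -
  have "cmod (cinner f (U t (e y))) \<le> norm (K (U (- t) f)) * norm y"
    using duality_le[OF U_G[OF f]] by (simp add: U_adj[OF f e_G, symmetric])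
  also have "\<dots> \<le> (onorm (V (- t)) * norm (K f)) * norm y"
    by (intro mult_right_mono norm_K_U f) simp
  finally show ?thesis by (simp add: algebra_simps)
qed

text \<open>The \<open>inv e\<close> in \<open>restrict_group\<close> has meaning on the range of
  \<open>e\<close> only. \<open>U t\<close> preserves this range because its adjoint
  \<open>U (- t)\<close> is bounded for \<open>norm (K f)\<close> through its extension
  \<open>V\<close>; by \<open>range_e\<close> a functional with such a bound is represented in the
  range.\<close>

lemma e_V': "e (V' t y) = U t (e y)"
  unfolding restrict_group_def
  by (rule f_inv_into_f[OF range_e[OF U_G[OF e_G] cinner_U_e]])

lemmas U_simps = clinear_onD[OF U_lin G(1)]

lemma V'_bounded: "bounded_linear (V' t)"
proof (rule bounded_linear_intro)
  show "V' t (x + y) = V' t x + V' t y" for x y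
    by (rule injD[OF e_inj]) (simp add: e_V' e.add U_simps e_G)
  show "V' t (r *\<^sub>R x) = r *\<^sub>R V' t x" for r x
    by (rule injD[OF e_inj]) (simp add: e_V' e.scaleR U_simps e_G)
  show "norm (V' t x) \<le> norm x * onorm (V (- t))" for x
    using norm_le_duality[of "onorm (V (- t)) * norm x" "V' t x"] cinner_U_e[of _ t x]
    by (simp add: e_V' onorm_pos_le[OF V_bounded] mult.commute)
qed

sublocale V': bounded_linear "V' t" for t by (rule V'_bounded)

section \<open>The second commutator between the completions\<close>

definition T :: "real \<Rightarrow> 'b \<Rightarrow> 'd" where "T t = V' (- t) \<circ> B0 \<circ> V t"

lemma T_bounded: "bounded_linear (T t)"
  unfolding T_def
  by (simp add: comp_def bounded_linear_compose[OF V'_bounded bounded_linear_compose[OF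
      bounded_clinearD(1)[OF B0(1)] V_bounded]])

sublocale T: bounded_linear "T t" for t by (rule T_bounded)

lemma e_T: "f \<in> G \<Longrightarrow> e (T t (j f)) = U (- t) (K (K (U t f)))"
  by (simp add: T_def e_V' V(2) B0(2) U_G e(2))

lemma T_differentiable: "(\<lambda>t. T t x) differentiable (at t)"
  using C1 by (simp add: strongly_differentiable_def T_def)

text \<open>Strong differentiability makes every \<open>T t x\<close> continuous in
  \<open>t\<close>, hence bounded on the compact interval; the uniform bound is what allows
  \<open>T t\<close> to act on a moving argument in \<open>B0_gen_dom\<close>.\<close>

lemma T_locally_bounded: "\<exists>M. \<forall>t\<in>{-1..1}. \<forall>x. norm (T t x) \<le> M * norm x"
proof -
  have "\<exists>M. \<forall>S\<in>T ` {-1..1}. \<forall>x. norm (S x) \<le> M * norm x"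
  proof (rule banach_steinhaus)
    fix x
    have "continuous_on {-1..1} (\<lambda>t. T t x)"
      by (intro continuous_at_imp_continuous_on ballI differentiable_imp_continuous_within T_differentiable)
    then have "bounded ((\<lambda>t. T t x) ` {-1..1})"
      by (intro compact_imp_bounded compact_continuous_image) auto
    then show "\<exists>M. \<forall>S\<in>T ` {-1..1}. norm (S x) \<le> M" by (auto simp: bounded_iff)
  qed (auto intro: T_bounded)
  then show ?thesis by auto
qed

definition T' :: "'b \<Rightarrow> 'd" where "T' x = vector_derivative (\<lambda>t. T t x) (at 0)"

lemma T_deriv: "((\<lambda>t. T t x) has_vector_derivative T' x) (at 0)"
  unfolding T'_def using T_differentiable by (simp add: vector_derivative_works)

text \<open>Strong differentiability asserts no bound on the derivative; applied to the difference
  quotients along \<open>1 / (n + 1)\<close>, Banach-Steinhaus supplies it. This bound becomes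
  \<open>\<kappa>\<close>.\<close>

lemma T'_bounded: "\<exists>M\<ge>0. \<forall>x. norm (T' x) \<le> M * norm x"
proof -
  define S where "S n x = (T (inverse (Suc n)) x - T 0 x) /\<^sub>R inverse (Suc n)" for n :: nat and x
  have lim: "(\<lambda>n. S n x) \<longlonglongrightarrow> T' x" for x
  proof -
    have 1: "((\<lambda>t. (T t x - T 0 x) /\<^sub>R t) \<longlongrightarrow> T' x) (at 0)"
      using T_deriv by (simp add: has_vector_derivative_0_iff)
    have "filterlim (\<lambda>n. inverse (real (Suc n))) (at 0) sequentially"
      using LIMSEQ_inverse_real_of_nat by (simp add: filterlim_at)
    from filterlim_compose[OF 1 this] show ?thesis by (simp add: S_def)
  qed
  have "\<exists>M. \<forall>R\<in>range S. \<forall>x. norm (R x) \<le> M * norm x"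
  proof (rule banach_steinhaus)
    show "bounded_linear R" if R: "R \<in> range S" for R
    proof -
      obtain n where "R = S n" using R by blast
      then show ?thesis unfolding S_def[abs_def]
        by (auto intro!: bounded_linear_intros T_bounded bounded_linear_sub
            bounded_linear_compose[OF bounded_linear_scaleR_right])
    qed
    show "\<exists>M. \<forall>R\<in>range S. norm (R x) \<le> M" for x
      using convergent_imp_Bseq[OF convergentI[OF lim[of x]]] by (auto simp: Bseq_def)
  qed
  then obtain M where M: "\<And>n x. norm (S n x) \<le> M * norm x" by auto
  have "norm (T' x) \<le> \<bar>M\<bar> * norm x" for x
  proof (rule LIMSEQ_le_const2[OF tendsto_norm[OF lim[of x]]])
    have "norm (S n x) \<le> \<bar>M\<bar> * norm x" for n
      by (rule order.trans[OF M mult_right_mono]) auto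
    then show "\<exists>N. \<forall>n\<ge>N. norm (S n x) \<le> \<bar>M\<bar> * norm x" by blast
  qed
  then show ?thesis by (intro exI[of _ "\<bar>M\<bar>"]) simp
qed

definition \<kappa> :: real where "\<kappa> = (SOME M. M \<ge> 0 \<and> (\<forall>x. norm (T' x) \<le> M * norm x))"

lemma \<kappa>: "\<kappa> \<ge> 0" "norm (T' x) \<le> \<kappa> * norm x"
  using someI_ex[OF T'_bounded[unfolded Bex_def]] unfolding \<kappa>_def by blast+

text \<open>The second commutator factors through the completions: \<open>T'\<close> maps
  \<open>\<B>\<close> to its dual, so \<open>duality_le\<close> turns its operator bound into the
  form bound \<open>C_bd\<close>.\<close>

sublocale weakly_conjugate G H K "\<lambda>u. e (T' (j u))" U \<kappa>
proof
  fix u assume u: "u \<in> G"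
  have "((\<lambda>t. e (T t (j u))) has_vector_derivative e (T' (j u))) (at 0)"
    by (rule bounded_linear.has_vector_derivative[OF e.bounded_linear_axioms T_deriv])
  then show "((\<lambda>t. U (- t) (K (K (U t u)))) has_vector_derivative e (T' (j u))) (at 0)"
    using u by (simp add: e_T)
  fix v assume v: "v \<in> G"
  have "cmod (cinner v (e (T' (j u)))) \<le> norm (K v) * norm (T' (j u))"
    by (rule duality_le[OF v])
  also have "\<dots> \<le> norm (K v) * (\<kappa> * norm (j u))" by (intro mult_left_mono \<kappa>) simp
  finally show "cmod (cinner v (e (T' (j u)))) \<le> \<kappa> * norm (K v) * norm (K u)"
    using u by (simp add: j(2) algebra_simps)
qed (use G H H_G K K_range U_G U_lin U_iso U_0 U_add U_cont H_deriv \<kappa> in auto)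

section \<open>The limiting absorption principle\<close>

lemma V'_deriv:
  "y \<in> gen_dom V' \<Longrightarrow> ((\<lambda>t. V' t y) has_vector_derivative vector_derivative (\<lambda>t. V' t y) (at 0)) (at 0)"
  by (simp add: gen_dom_def vector_derivative_works[symmetric])

lemma norm_generator: "norm (generator V' y) = norm (vector_derivative (\<lambda>t. V' t y) (at 0))"
  by (simp add: generator_def norm_scaleC)

text \<open>\<open>e\<close> carries orbits of \<open>V'\<close> to orbits of \<open>U\<close>, and
  by \<open>duality_le\<close> norms in \<open>'d\<close> become form bounds in
  \<open>G\<close>.\<close>

lemma datum_gen_dom:
  assumes y: "y \<in> gen_dom V'" "y \<noteq> 0"
  shows "datum (e y) (norm y) (graph_norm V' y)"
proof -
  let ?a = "vector_derivative (\<lambda>t. V' t y) (at 0)"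
  have "((\<lambda>t. e (V' t y)) has_vector_derivative e ?a) (at 0)"
    by (rule bounded_linear.has_vector_derivative[OF e.bounded_linear_axioms V'_deriv[OF y(1)]])
  then have der: "((\<lambda>t. U t (e y)) has_vector_derivative e ?a) (at 0)" by (simp add: e_V')
  have dual: "cmod (cinner (e x) u) \<le> norm x * norm (K u)" if "u \<in> G" for x u
    using duality_le[OF that, of x] by (subst cinner_commute) (simp add: mult.commute)
  have "cmod (cinner (e ?a) u) \<le> graph_norm V' y * norm (K u)" if "u \<in> G" for u
    using dual[OF that, of ?a] mult_right_mono[of "norm ?a" "graph_norm V' y" "norm (K u)"]
    by (simp add: graph_norm_def norm_generator)
  then show ?thesis
    using y der dual by (auto simp: datum_def e_G graph_norm_def)
qed

lemma gen_dom_subspace: "subspace (gen_dom V')"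
  unfolding subspace_def gen_dom_def by (auto simp: V'.zero V'.add V'.scaleR)

lemma graph_norm_diff:
  assumes "x \<in> gen_dom V'" "y \<in> gen_dom V'"
  shows "graph_norm V' (x - y) \<le> graph_norm V' x + graph_norm V' y"
proof -
  let ?d = "\<lambda>y. vector_derivative (\<lambda>t. V' t y) (at 0)"
  have "?d (x - y) = ?d x - ?d y"
    using has_vector_derivative_diff[OF V'_deriv[OF assms(1)] V'_deriv[OF assms(2)]]
    by (intro vector_derivative_at) (simp add: V'.diff)
  then show ?thesis
    using norm_triangle_ineq4[of x y] norm_triangle_ineq4[of "?d x" "?d y"]
    by (simp add: graph_norm_def norm_generator)
qed

lemma resolvent_on_eq: "resolvent_on G H = R 0"
proof -
  have "0 *\<^sub>C x = 0" for x :: 'h using scaleC_of_real[of 0 x] by simp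
  then show ?thesis by (simp add: fun_eq_iff resolvent_on_def R_def L_def[abs_def])
qed

lemma limiting_absorption:
  assumes x: "x \<in> interp_space (gen_dom V') (graph_norm V') UNIV norm (1/2) 1" and z: "Im z > 0"
  shows "cmod (cinner (e x) (resolvent_on G H z (e x))) \<le>
    c2 * (15 * interp_norm (gen_dom V') (graph_norm V') UNIV norm (1/2) 1 x)\<^sup>2"
proof -
  obtain d where d: "\<And>k. d k \<in> gen_dom V'" "(\<lambda>n. \<Sum>k<n. d k) \<longlonglongrightarrow> x"
    "\<And>n. (\<Sum>k<n. sqrt (norm (d k) * graph_norm V' (d k))) \<le>
      15 * interp_norm (gen_dom V') (graph_norm V') UNIV norm (1/2) 1 x"
    by (rule interp_dyadic_decomposition[OF gen_dom_subspace graph_norm_diff _ x])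
       (assumption+, simp add: graph_norm_def, rule that)
  show ?thesis
    unfolding resolvent_on_eq
  proof (rule resolvent_series_bound[OF z])
    show "e (d k) = 0 \<or> datum (e (d k)) (norm (d k)) (graph_norm V' (d k))" for k
      using datum_gen_dom[OF d(1)[of k]] by (cases "d k = 0") (auto simp: e.zero)
    show "0 \<le> norm (d k) * graph_norm V' (d k)" for k by (simp add: graph_norm_def)
    show "(\<lambda>n. \<Sum>k<n. e (d k)) \<longlonglongrightarrow> e x" using e.tendsto[OF d(2)] by (simp add: e.sum)
  qed (rule d(3))
qed

lemma resolvent_on_cnj:
  assumes "f \<in> G" "Im z > 0"
  shows "cmod (cinner f (resolvent_on G H (cnj z) f)) = cmod (cinner f (resolvent_on G H z f))"
  using R_adj[OF _ assms(1,1), of 0 z] assms(2)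
  by (simp add: resolvent_on_eq adm_def) (metis cinner_commute complex_mod_cnj)

text \<open>With \<open>x = j f\<close> one has \<open>V' t (B0 x) = T (- t) (V t x)\<close>, so that \<open>B0\<close> maps the domain of the
  generator of \<open>V\<close> into that of \<open>V'\<close>.\<close>

lemma B0_gen_dom:
  assumes f: "f \<in> D0"
  shows "j' (K (K f)) \<in> gen_dom V'"
proof -
  have fG: "f \<in> G" using f D0 by blast
  obtain g where g: "g \<in> G" and der: "((\<lambda>t. U t f) has_vector_derivative g) (at 0)"
    using D0(3)[OF f] by blast
  obtain M where M: "\<And>t x. t \<in> {-1..1} \<Longrightarrow> norm (T t x) \<le> M * norm x"
    using T_locally_bounded by blast
  define q where "q t = (U t f - f) /\<^sub>R t" for t
  have q: "(q \<longlongrightarrow> g) (at 0)" "q t \<in> G" for t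
    using der fG by (simp_all add: has_vector_derivative_0_iff q_def[abs_def] U_0 G_simps U_G)
  have minus: "filterlim uminus (at 0) (at (0::real))"
    unfolding filterlim_at using tendsto_minus[OF tendsto_ident_at[of 0 UNIV]]
    by (auto simp: eventually_at_filter)
  have Tcont: "((\<lambda>t. T (- t) x) \<longlongrightarrow> T 0 x) (at 0)" for x
  proof (rule filterlim_compose[OF _ minus, of "\<lambda>t. T t x"])
    show "((\<lambda>t. T t x) \<longlongrightarrow> T 0 x) (at 0)"
      using differentiable_imp_continuous_within[OF T_differentiable] by (simp add: continuous_within)
  qed
  \<comment> \<open>Product rule with a moving argument: the local uniform bound on \<open>T\<close>
    lets the quotient \<open>q t\<close> be replaced by its limit \<open>g\<close> under
    \<open>T (- t)\<close>.\<close>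
  have "((\<lambda>t. T (- t) (j (q t) - j g)) \<longlongrightarrow> 0) (at 0)"
  proof (rule Lim_null_comparison)
    show "\<forall>\<^sub>F t in at 0. norm (T (- t) (j (q t) - j g)) \<le> M * norm (K (q t - g))"
      unfolding eventually_at
    proof (intro exI[of _ 1] conjI ballI impI)
      fix t :: real assume "t \<noteq> 0 \<and> dist t 0 < 1"
      then have "norm (T (- t) (j (q t) - j g)) \<le> M * norm (j (q t) - j g)"
        by (intro M) auto
      then show "norm (T (- t) (j (q t) - j g)) \<le> M * norm (K (q t - g))"
        using q g by (simp add: j_simps(3)[symmetric] j(2) G_simps)
    qed simp
    show "((\<lambda>t. M * norm (K (q t - g))) \<longlongrightarrow> 0) (at 0)"
      using bounded_linear.tendsto_zero[OF K_simps(1) LIM_zero[OF q(1)]]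
      by (intro tendsto_mult_right_zero tendsto_norm_zero)
  qed
  then have 1: "((\<lambda>t. T (- t) (j (q t) - j g) + T (- t) (j g)) \<longlongrightarrow> 0 + T 0 (j g)) (at 0)"
    by (intro tendsto_add Tcont)
  have "((\<lambda>t. (T t (j f) - T 0 (j f)) /\<^sub>R t) \<longlongrightarrow> T' (j f)) (at 0)"
    using T_deriv by (simp add: has_vector_derivative_0_iff)
  then have "((\<lambda>t. (T (- t) (j f) - T 0 (j f)) /\<^sub>R (- t)) \<longlongrightarrow> T' (j f)) (at 0)"
    by (rule filterlim_compose[OF _ minus])
  from tendsto_diff[OF 1 this]
  have lim: "((\<lambda>t. T (- t) (j (q t) - j g) + T (- t) (j g) - (T (- t) (j f) - T 0 (j f)) /\<^sub>R (- t))
      \<longlongrightarrow> T 0 (j g) - T' (j f)) (at 0)" by simp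
  have V'T: "V' t (j' (K (K f))) = T (- t) (j (U t f))" for t
  proof -
    have "V (- t) (j (U t f)) = j f"
      using U_add[of f "- t" t] by (simp add: V(2) U_G fG U_0)
    then show ?thesis by (simp add: T_def B0(2) fG)
  qed
  have "((\<lambda>t. V' t (j' (K (K f)))) has_vector_derivative T 0 (j g) - T' (j f)) (at 0)"
    unfolding has_vector_derivative_0_iff
  proof (rule Lim_transform_eventually[OF lim])
    have "T (- t) (j (q t) - j g) + T (- t) (j g) - (T (- t) (j f) - T 0 (j f)) /\<^sub>R (- t) =
        (V' t (j' (K (K f))) - V' 0 (j' (K (K f)))) /\<^sub>R t" for t
    proof -
      have "j (q t) = (j (U t f) - j f) /\<^sub>R t"
        unfolding q_def using fG by (simp add: j_simps G_simps U_G)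
      then show ?thesis
        using fG by (simp add: V'T U_0 T.diff T.scaleR scaleR_diff_right)
    qed
    then show "\<forall>\<^sub>F t in at 0. T (- t) (j (q t) - j g) + T (- t) (j g) - (T (- t) (j f) - T 0 (j f)) /\<^sub>R (- t) =
        (V' t (j' (K (K f))) - V' 0 (j' (K (K f)))) /\<^sub>R t" by simp
  qed
  then show ?thesis unfolding gen_dom_def by (auto intro: differentiableI_vector)
qed

section \<open>Absolute continuity of the spectrum\<close>

lemma purely_absolutely_continuous: "purely_ac_spectrum_on G H"
  unfolding purely_ac_spectrum_on_def
proof (intro allI impI ballI)
  fix E f assume E: "spectral_measure_of G H E" and f: "f \<in> G"
  interpret E: spectral_measure G H E
    by unfold_locales (use G H H_G E in auto)
  have KKb: "bounded_linear (\<lambda>f. K (K f))"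
    by (rule bounded_linear_compose[OF K_simps(1) K_simps(1)])
  have "E X g = 0" if X: "X \<in> null_sets lborel" and g: "g \<in> G" for X g
  proof -
    have Xb: "X \<in> sets borel" using X by auto
    \<comment> \<open>For these vectors \<open>B0_gen_dom\<close> supplies a \<open>datum\<close>,
      so \<open>F_diagonal\<close> bounds the resolvent form by a constant free of \<open>a\<close>
      and \<open>h\<close>, as \<open>E_null\<close> requires.\<close>
    have D0_0: "E X (K (K f)) = 0" if f: "f \<in> D0" for f
    proof (cases "K (K f) = 0")
      case True
      then show ?thesis using E.E_simps(5)[OF Xb] by simp
    next
      case False
      let ?y = "j' (K (K f))"
      have fG: "f \<in> G" using f D0 by blast
      have ey: "e ?y = K (K f)" using fG by (rule e(2))
      then have "?y \<noteq> 0" using False by (auto simp: e.zero)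
      then have dat: "datum (K (K f)) (norm ?y) (graph_norm V' ?y)"
        using datum_gen_dom[OF B0_gen_dom[OF f]] ey by simp
      show ?thesis
      proof (rule E.E_null[OF K_range _ _ X])
        show "0 \<le> c1 * (norm ?y * graph_norm V' ?y)"
          using c1 by (simp add: graph_norm_def)
        fix a h :: real assume h: "h > 0"
        have a: "adm 0 (Complex a h)" using h by (simp add: adm_def)
        have z0: "0 *\<^sub>C x = 0" for x :: 'h using scaleC_of_real[of 0 x] by simp
        let ?u = "R 0 (Complex a h) (K (K f))"
        have "H ?u - Complex a h *\<^sub>C ?u = K (K f)"
          using L_R[OF a K_range[of "K f"]] by (simp add: L_def z0)
        moreover have "cmod (cinner (K (K f)) ?u) \<le> c1 * (norm ?y * graph_norm V' ?y)"
          using F_diagonal[OF _ _ dat, of "Complex a h" 0] h by simp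
        ultimately show "\<exists>u\<in>G. H u - Complex a h *\<^sub>C u = K (K f) \<and>
            cmod (cinner (K (K f)) u) \<le> c1 * (norm ?y * graph_norm V' ?y)"
          using R_G[OF a K_range] by blast
      qed
    qed
    have KK0: "E X (K (K f)) = 0" if f: "f \<in> G" for f
    proof -
      obtain w where w: "\<And>n. w n \<in> D0" "w \<longlonglongrightarrow> f"
        using subsetD[OF D0(2) f] unfolding closure_sequential by blast
      have wG: "w n \<in> G" for n using w(1) D0(1) by blast
      have "norm (E X (K (K f))) \<le> norm (K (K (f - w n)))" for n
      proof -
        have "E X (K (K f)) = E X (K (K (f - w n)))"
          using D0_0[OF w(1)[of n]] Xb by (simp add: K_simps(5) E.E_simps K_range)
        then show ?thesis using E.E_norm_le[OF Xb K_range] by simp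
      qed
      moreover have "(\<lambda>n. norm (K (K (f - w n)))) \<longlonglongrightarrow> norm (K (K (f - f)))"
        by (intro tendsto_norm bounded_linear.tendsto[OF KKb] tendsto_intros w(2))
      ultimately have "norm (E X (K (K f))) \<le> norm (K (K (f - f)))"
        by (intro LIMSEQ_le_const) auto
      then show ?thesis by (simp add: K_simps(7))
    qed
    \<comment> \<open>\<open>E X\<close> and \<open>K\<close> need not commute; moving
      \<open>E X\<close> by symmetry off the second factor gives
      \<open>(norm (K ?h))\<^sup>2 = \<langle>E X (K (K ?h)), g\<rangle>\<close>, which vanishes,
      and \<open>K\<close> is injective on \<open>G\<close>.\<close>
    let ?h = "E X g"
    have h: "?h \<in> G" using E.E_S[OF Xb g] .
    have "cinner (K ?h) (K ?h) = cinner (K (K ?h)) ?h" by (simp add: K_simps(3))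
    also have "\<dots> = cinner (E X (K (K ?h))) g" using E.E_sa[OF Xb K_range g] by simp
    also have "\<dots> = 0" using KK0[OF h] by (simp add: cinner.zero_left)
    finally show ?thesis using K_inj[OF h] by (simp add: cinner_self)
  qed
  then show "absolutely_continuous lborel (scalar_measure E f)"
    unfolding absolutely_continuous_def using f
    by (auto simp: null_sets_def E.emeasure_\<mu>)
qed

end

section \<open>Restriction of the unitary group\<close>

lemma exp_groupD:
  assumes "exp_group S D A W" and S: "csubspace_on S"
  shows "f \<in> S \<Longrightarrow> W t f \<in> S" "clinear_on S (W t)"
    "f \<in> S \<Longrightarrow> g \<in> S \<Longrightarrow> cinner (W t f) (W t g) = cinner f g" "f \<in> S \<Longrightarrow> W 0 f = f"
    "f \<in> S \<Longrightarrow> W (s + t) f = W s (W t f)" "f \<in> S \<Longrightarrow> continuous_on UNIV (\<lambda>t. W t f)"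
    "f \<in> S \<Longrightarrow> g \<in> S \<Longrightarrow> ((\<lambda>t. W t f) has_vector_derivative \<i> *\<^sub>C g) (at 0) \<longleftrightarrow> f \<in> D \<and> A f = g"
    "f \<in> S \<Longrightarrow> norm (W t f) = norm f"
proof -
  note W = assms(1)[unfolded exp_group_def]
  show "f \<in> S \<Longrightarrow> W t f \<in> S" "clinear_on S (W t)" "f \<in> S \<Longrightarrow> W 0 f = f"
    "f \<in> S \<Longrightarrow> W (s + t) f = W s (W t f)" "f \<in> S \<Longrightarrow> continuous_on UNIV (\<lambda>t. W t f)"
    "f \<in> S \<Longrightarrow> g \<in> S \<Longrightarrow> ((\<lambda>t. W t f) has_vector_derivative \<i> *\<^sub>C g) (at 0) \<longleftrightarrow> f \<in> D \<and> A f = g"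
    using W by (blast | auto)+
  show iso: "f \<in> S \<Longrightarrow> g \<in> S \<Longrightarrow> cinner (W t f) (W t g) = cinner f g" for f g
    using W by blast
  show "f \<in> S \<Longrightarrow> norm (W t f) = norm f"
    using arg_cong[OF iso[of f f], of Re] by (simp add: cinner_self)
qed

text \<open>For \<open>f\<close> in the domain, \<open>W (- t) (W0 t f)\<close> has vanishing derivative.\<close>

lemma exp_group_restrict:
  assumes W: "exp_group UNIV D A W" and W0: "exp_group G (D \<inter> G) A W0"
    and G: "csubspace_on G" and A_G: "\<And>f. f \<in> D \<inter> G \<Longrightarrow> A f \<in> G"
    and dense: "G \<subseteq> closure (D \<inter> G)" and f: "f \<in> G"
  shows "W t f = W0 t f"
proof -
  note W = exp_groupD[OF W csubspace_on_UNIV, simplified]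
  note W0 = exp_groupD[OF W0 G]
  note G_simps = csubspace_onD[OF G]
  note W_simps = clinear_onD[OF W(2) csubspace_on_UNIV, simplified]
  note W0_simps = clinear_onD[OF W0(2) G]
  have dom: "W t f = W0 t f" if f: "f \<in> D" "f \<in> G" for f t
  proof -
    have Af: "A f \<in> G" using A_G f by blast
    define \<phi> where "\<phi> t = W (- t) (W0 t f)" for t
    have "(\<phi> has_vector_derivative 0) (at t within UNIV)" for t
      unfolding has_vector_derivative_iff_quotient
    proof (rule tendsto_norm_zero_cancel)
      define k where "k = W0 t f"
      have k: "k \<in> G" using W0(1) f by (simp add: k_def)
      have "((\<lambda>h. (W0 h f - f) /\<^sub>R h) \<longlongrightarrow> \<i> *\<^sub>C A f) (at 0)"
        using W0(7)[OF f(2) Af] f W0(4)[OF f(2)] by (simp add: has_vector_derivative_0_iff)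
      then have "((\<lambda>h. norm ((W0 h f - f) /\<^sub>R h - \<i> *\<^sub>C A f)) \<longlongrightarrow> 0) (at 0)"
        by (intro tendsto_norm_zero LIM_zero)
      moreover have "norm ((W0 h f - f) /\<^sub>R h - \<i> *\<^sub>C A f) =
          norm ((W0 h k - k) /\<^sub>R h - \<i> *\<^sub>C W0 t (A f))" for h
      proof -
        have "(W0 h f - f) /\<^sub>R h - \<i> *\<^sub>C A f \<in> G"
          using f Af by (intro G_simps W0(1))
        then have "norm ((W0 h f - f) /\<^sub>R h - \<i> *\<^sub>C A f) = norm (W0 t ((W0 h f - f) /\<^sub>R h - \<i> *\<^sub>C A f))"
          by (simp add: W0(8))
        also have "W0 t ((W0 h f - f) /\<^sub>R h - \<i> *\<^sub>C A f) = (W0 t (W0 h f) - k) /\<^sub>R h - \<i> *\<^sub>C W0 t (A f)"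
          using f Af by (simp add: W0_simps G_simps W0(1) k_def)
        also have "W0 t (W0 h f) = W0 h k"
          using W0(5)[OF f(2), of t h] W0(5)[OF f(2), of h t] by (simp add: k_def add.commute)
        finally show ?thesis .
      qed
      ultimately have "((\<lambda>h. norm ((W0 h k - k) /\<^sub>R h - \<i> *\<^sub>C W0 t (A f))) \<longlongrightarrow> 0) (at 0)"
        by simp
      then have "((\<lambda>h. (W0 h k - k) /\<^sub>R h) \<longlongrightarrow> \<i> *\<^sub>C W0 t (A f)) (at 0)"
        by (rule LIM_zero_cancel[OF tendsto_norm_zero_cancel])
      then have der0: "((\<lambda>h. W0 h k) has_vector_derivative \<i> *\<^sub>C W0 t (A f)) (at 0)"
        using W0(4)[OF k] by (simp add: has_vector_derivative_0_iff)
      \<comment> \<open>The equality of domains in \<open>exp_group\<close> acts twice: for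
        \<open>W0\<close> it puts \<open>k\<close> into \<open>D\<close>, for \<open>W\<close> it
        turns this into differentiability with the same derivative.\<close>
      then have "k \<in> D" "A k = W0 t (A f)" using W0(7)[OF k W0(1)[OF Af]] by auto
      then have der: "((\<lambda>h. W h k) has_vector_derivative \<i> *\<^sub>C W0 t (A f)) (at 0)" using W(7) by simp
      have "((\<lambda>h. (W0 h k - W h k) /\<^sub>R h) \<longlongrightarrow> 0) (at 0)"
        using has_vector_derivative_diff[OF der0 der] W0(4)[OF k] W(4)
        by (simp add: has_vector_derivative_0_iff)
      then have "((\<lambda>h. norm ((W0 h k - W h k) /\<^sub>R h)) \<longlongrightarrow> 0) (at 0)" by (rule tendsto_norm_zero)
      \<comment> \<open>Both values are written with the same outer \<open>W (- (t + h))\<close>,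
        which is isometric and drops out of the norm; this replaces a product rule.\<close>
      moreover have "norm ((\<phi> (t + h) - \<phi> t) /\<^sub>R h) = norm ((W0 h k - W h k) /\<^sub>R h)" for h
      proof -
        have "\<phi> (t + h) = W (- (t + h)) (W0 h k)"
          using W0(5)[OF f(2), of h t] by (simp add: \<phi>_def k_def add.commute)
        moreover have "\<phi> t = W (- (t + h)) (W h k)"
          using W(5)[of "- (t + h)" h k] by (simp add: \<phi>_def k_def)
        ultimately have "\<phi> (t + h) - \<phi> t = W (- (t + h)) (W0 h k - W h k)"
          by (simp add: W_simps)
        then show ?thesis by (simp add: W(8))
      qed
      ultimately show "((\<lambda>h. norm ((\<phi> (t + h) - \<phi> t) /\<^sub>R h)) \<longlongrightarrow> 0) (at 0)" by (simp only:)
    qed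
    then obtain c where c: "\<And>t. \<phi> t = c"
      using has_vector_derivative_zero_constant[of UNIV \<phi>] by auto
    have "W (- t) (W0 t f) = f"
      using c[of t] c[of 0] W(4) W0(4)[OF f(2)] by (simp add: \<phi>_def)
    then have "W t (W (- t) (W0 t f)) = W t f" by simp
    then show ?thesis using W(5)[of t "- t" "W0 t f"] W(4) by simp
  qed
  obtain w where w: "\<And>n. w n \<in> D \<inter> G" "w \<longlonglongrightarrow> f"
    using subsetD[OF dense f] unfolding closure_sequential by blast
  have le: "norm (W t f - W0 t f) \<le> 2 * norm (f - w n)" for n
  proof -
    have wn: "w n \<in> D" "w n \<in> G" using w(1) by auto
    have "W t f - W0 t f = W t (f - w n) - W0 t (f - w n)"
      using dom[OF wn, of t] f wn by (simp add: W_simps W0_simps)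
    also have "norm \<dots> \<le> norm (W t (f - w n)) + norm (W0 t (f - w n))"
      by (rule norm_triangle_ineq4)
    finally show ?thesis using f wn by (simp add: W(8) W0(8) G_simps)
  qed
  have "(\<lambda>n. 2 * norm (f - w n)) \<longlonglongrightarrow> 2 * norm (f - f)" by (intro tendsto_intros w(2))
  then have "norm (W t f - W0 t f) \<le> 2 * norm (f - f)" using le
    by (rule LIMSEQ_le_const[OF _ exI, OF _ allI, OF _ impI])
  then show ?thesis by simp
qed

section \<open>Derivation of the theorem from the abstract setting\<close>

theorem theorem2p5:
  fixes H K A :: "'h::complex_hilbert \<Rightarrow> 'h"
    and D :: "'h set"
    and W W0 :: "real \<Rightarrow> 'h \<Rightarrow> 'h"
    and j :: "'h \<Rightarrow> 'b::complex_banach"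
    and j' :: "'h \<Rightarrow> 'd::complex_banach"
    and e :: "'d \<Rightarrow> 'h"
    and B0 :: "'b \<Rightarrow> 'd"
    and V :: "real \<Rightarrow> 'b \<Rightarrow> 'b"
  defines "B \<equiv> i_commutator W H"
    and "\<K> \<equiv> {f. K f = 0}"
    and "\<G> \<equiv> orth_complement {f. K f = 0}"
    and "V' \<equiv> restrict_group e W0"
    and "\<E> \<equiv> interp_space (gen_dom (restrict_group e W0)) (graph_norm (restrict_group e W0))
               UNIV norm (1/2) 1"
    and "norm_\<E> \<equiv> interp_norm (gen_dom (restrict_group e W0)) (graph_norm (restrict_group e W0))
               UNIV norm (1/2) 1"
  assumes H: "bounded_selfadjoint H"
    and A: "selfadjoint_op D A"
    and W: "exp_group UNIV D A W"
    and C1: "strongly_differentiable (\<lambda>t. W (- t) \<circ> H \<circ> W t)"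
    and K: "bounded_selfadjoint K"
    and B_eq: "B = K \<circ> K"
    and H_reduced: "reduced_by \<K> \<G> UNIV H"
    and A_reduced: "reduced_by \<K> \<G> D A"
    and W0: "exp_group \<G> (D \<inter> \<G>) A W0"
    \<comment> \<open>\<open>'b\<close> is the space \<open>\<B>\<close>, into which \<open>j\<close> embeds \<open>\<G>\<close>\<close>
    and space_B: "completion_of \<G> (\<lambda>f. sqrt (Re (cinner f (B f)))) j"
    \<comment> \<open>\<open>'d\<close> is the space \<open>\<B>\<close>*, and \<open>e\<close> its embedding into \<open>\<G>\<close>\<close>
    and space_B': "completion_of (B ` \<G>) (\<lambda>g. sqrt (Re (cinner g (inv_into \<G> B g)))) j'"
    and e: "bounded_clinear e" "\<And>g. g \<in> B ` \<G> \<Longrightarrow> e (j' g) = g"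
    \<comment> \<open>the extension of \<open>B\<close> restricted to \<open>\<G>\<close> to an operator from \<open>\<B>\<close> to \<open>\<B>\<close>*\<close>
    and B0: "bounded_clinear B0" "\<And>f. f \<in> \<G> \<Longrightarrow> B0 (j f) = j' (B f)"
    and V: "C0_group V" "\<And>t f. f \<in> \<G> \<Longrightarrow> V t (j f) = j (W0 t f)"
    and C1_B0: "strongly_differentiable (\<lambda>t. V' (- t) \<circ> B0 \<circ> V t)"
  shows "(\<exists>c>0. \<forall>x \<mu> f. \<mu> > 0 \<longrightarrow> f \<in> \<E> \<longrightarrow>
            cmod (cinner (e f) (resolvent_on \<G> H (Complex x \<mu>) (e f))) \<le> c * (norm_\<E> f)\<^sup>2 \<and>
            cmod (cinner (e f) (resolvent_on \<G> H (Complex x (- \<mu>)) (e f))) \<le> c * (norm_\<E> f)\<^sup>2)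
         \<and> purely_ac_spectrum_on \<G> H"
proof -
  note K_simps = bounded_selfadjointD[OF K]
  have B: "B f = K (K f)" for f using B_eq by simp
  have G: "csubspace_on \<G>"
    unfolding \<G>_def by (rule orth_complement_csubspace)
  note G_simps = csubspace_onD[OF G]
  have ker: "csubspace_on \<K>"
    unfolding csubspace_on_def \<K>_def by (auto simp: K_simps)
  have ker_closed: "closed \<K>"
    unfolding \<K>_def
    by (intro closed_Collect_eq continuous_on_const linear_continuous_on K_simps(1))
  have H_G: "H f \<in> \<G>" if "f \<in> \<G>" for f
    using H_reduced csubspace_onD(1)[OF ker] that unfolding reduced_by_def by auto
  have A_G: "A f \<in> \<G>" if "f \<in> D \<inter> \<G>" for f
    using A_reduced csubspace_onD(1)[OF ker] that unfolding reduced_by_def by force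

  \<comment> \<open>Being reduced means that the component in \<open>\<G>\<close> of a vector of
    \<open>D\<close> stays in \<open>D\<close>; projecting an approximating sequence onto
    \<open>\<G>\<close> can only shorten its distance to \<open>f\<close>.\<close>
  have dense: "\<G> \<subseteq> closure (D \<inter> \<G>)"
  proof
    fix f assume f: "f \<in> \<G>"
    have "f \<in> closure D" using A by (simp add: selfadjoint_op_def)
    then obtain d where d: "\<And>n. d n \<in> D" "d \<longlonglongrightarrow> f" unfolding closure_sequential by blast
    have "\<exists>y. y \<in> D \<inter> \<G> \<and> norm (y - f) \<le> norm (d n - f)" for n
    proof -
      obtain x where x: "x \<in> \<K>" "d n - x \<in> orth_complement \<K>"
        by (rule orth_decomposition[OF ker ker_closed])
      have y: "d n - x \<in> \<G>" using x(2) by (simp add: \<G>_def \<K>_def)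
      have "d n - x \<in> D"
        using A_reduced x(1) y d(1)[of n] unfolding reduced_by_def by (metis add.commute diff_add_cancel)
      moreover have "norm (d n - x - f) \<le> norm (d n - f)"
      proof -
        have "d n - x - f \<in> \<G>" using y f by (rule G_simps(4))
        then have 0: "inner x (d n - x - f) = 0"
          using x(1) by (simp add: \<G>_def \<K>_def orth_complement_def Re_cinner[symmetric])
        have "(norm (d n - f))\<^sup>2 = (norm (x + (d n - x - f)))\<^sup>2" by simp
        also have "\<dots> = (norm x)\<^sup>2 + (norm (d n - x - f))\<^sup>2"
          unfolding power2_norm_eq_inner inner_add inner_commute[of "d n - x - f" x] 0 by simp
        finally have "(norm (d n - x - f))\<^sup>2 \<le> (norm (d n - f))\<^sup>2" by simp
        then show ?thesis by (rule power2_le_imp_le) simp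
      qed
      ultimately show ?thesis using y by blast
    qed
    then obtain y where y: "\<And>n. y n \<in> D \<inter> \<G>" "\<And>n. norm (y n - f) \<le> norm (d n - f)" by metis
    have "(\<lambda>n. y n - f) \<longlonglongrightarrow> 0"
      by (rule Lim_null_comparison[OF _ tendsto_norm_zero[OF LIM_zero[OF d(2)]]]) (simp add: y(2))
    then show "f \<in> closure (D \<inter> \<G>)"
      unfolding closure_sequential using y(1) LIM_zero_cancel by blast
  qed

  \<comment> \<open>\<open>B\<close> is defined through \<open>W\<close> on the whole space, whereas
    the groups on the completions come from \<open>W0\<close>; identifying the two on
    \<open>\<G>\<close> makes \<open>K\<^sup>2\<close> the derivative along \<open>W0\<close> as
    well.\<close>
  have W_eq: "W t f = W0 t f" if "f \<in> \<G>" for t f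
    by (rule exp_group_restrict[OF W W0 G A_G dense that])
  note W0' = exp_groupD[OF W0 G]

  \<comment> \<open>With \<open>B\<close> injective on \<open>\<G>\<close>,
    \<open>inv_into \<G> B\<close> returns \<open>f\<close> at \<open>B f\<close>, so the dual norm
    there is \<open>norm (K f)\<close>.\<close>
  have inj: "inj_on B \<G>"
  proof (rule inj_onI)
    fix f g assume fg: "f \<in> \<G>" "g \<in> \<G>" "B f = B g"
    have "cinner (K (f - g)) (K (f - g)) = 0"
      using fg(3) by (simp add: K_simps(3)) (simp add: K_simps(5) B cinner.zero_right)
    then have "f - g \<in> {f. K f = 0}" by (simp add: cinner_self)
    moreover have "f - g \<in> \<G>" using fg by (intro G_simps)
    ultimately have "cinner (f - g) (f - g) = 0" unfolding \<G>_def orth_complement_def by blast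
    then show "f = g" by (simp add: cinner_self)
  qed
  have KK: "cinner f (K (K f)) = of_real ((norm (K f))\<^sup>2)" for f
    by (simp add: K_simps(3)[symmetric] cinner_self)
  have B_image: "(\<lambda>f. K (K f)) ` \<G> = B ` \<G>" by (simp add: B)

  interpret conjugate_completion \<G> "D \<inter> \<G>" H K W0 j j' e B0 V
  proof
    show "((\<lambda>t. W0 (- t) (H (W0 t u))) has_vector_derivative K (K u)) (at 0)" if u: "u \<in> \<G>" for u
    proof -
      have "((\<lambda>t. W (- t) (H (W t u))) has_vector_derivative i_commutator W H u) (at 0)"
        using C1 unfolding i_commutator_def strongly_differentiable_def
        by (simp add: vector_derivative_works)
      moreover have "i_commutator W H u = K (K u)" using B[of u] by (simp add: B_def)
      moreover have "W (- t) (H (W t u)) = W0 (- t) (H (W0 t u))" for t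
        using u by (simp add: W_eq H_G W0'(1))
      ultimately show ?thesis by simp
    qed
    show "\<exists>g\<in>\<G>. ((\<lambda>t. W0 t f) has_vector_derivative g) (at 0)" if f: "f \<in> D \<inter> \<G>" for f
      using W0'(7)[of f "A f"] A_G[OF f] f by (intro bexI[of _ "\<i> *\<^sub>C A f"]) (auto intro: G_simps)
    show "clinear_on \<G> j" "closure (j ` \<G>) = UNIV"
      using space_B by (simp_all add: completion_of_def)
    show "norm (j f) = norm (K f)" if "f \<in> \<G>" for f
      using space_B that by (simp add: completion_of_def B KK)
    show "clinear_on ((\<lambda>f. K (K f)) ` \<G>) j'" "closure (j' ` (\<lambda>f. K (K f)) ` \<G>) = UNIV"
      using space_B' by (simp_all add: completion_of_def B_image)
    show "norm (j' (K (K f))) = norm (K f)" if f: "f \<in> \<G>" for f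
    proof -
      have "norm (j' (B f)) = sqrt (Re (cinner (B f) f))"
        using space_B' f by (simp add: completion_of_def inv_into_f_f[OF inj])
      also have "cinner (B f) f = of_real ((norm (K f))\<^sup>2)"
        by (simp add: B K_simps(3) cinner_self)
      finally show ?thesis by (simp add: B)
    qed
    show "e (j' (K (K f))) = K (K f)" if "f \<in> \<G>" for f
      using e(2)[of "B f"] that by (simp add: B)
    show "B0 (j f) = j' (K (K f))" if "f \<in> \<G>" for f
      using B0(2) that by (simp add: B)
    show "strongly_differentiable (\<lambda>t. restrict_group e W0 (- t) \<circ> B0 \<circ> V t)"
      using C1_B0 by (simp add: V'_def)
    show "\<G> = orth_complement {f. K f = 0}" by (rule \<G>_def[THEN meta_eq_to_obj_eq])
    show "bounded_selfadjoint H" "bounded_selfadjoint K" by (rule H K)+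
    show "bounded_clinear e" "bounded_clinear B0" "C0_group V" by (rule e(1) B0(1) V(1))+
    show "\<G> \<subseteq> closure (D \<inter> \<G>)" by (rule dense)
  qed (simp_all add: H_G W0' V(2))

  show ?thesis
  \<comment> \<open>The constant is \<open>15\<^sup>2 * c2\<close>: the decomposition loses a factor
    15 per argument, and \<open>F_bilinear\<close> contributes \<open>c2\<close>.\<close>
  proof (intro conjI exI[of _ "225 * c2"] allI impI)
    show "225 * c2 > 0" using c2 by simp
    fix x \<mu> :: real and f assume \<mu>: "\<mu> > 0" and f: "f \<in> \<E>"
    have eq: "c2 * (15 * norm_\<E> f)\<^sup>2 = 225 * c2 * (norm_\<E> f)\<^sup>2" by (simp add: power_mult_distrib)
    show 1: "cmod (cinner (e f) (resolvent_on \<G> H (Complex x \<mu>) (e f))) \<le> 225 * c2 * (norm_\<E> f)\<^sup>2"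
      using limiting_absorption[of f "Complex x \<mu>"] f \<mu> unfolding \<E>_def eq[symmetric] norm_\<E>_def by simp
    have "Complex x (- \<mu>) = cnj (Complex x \<mu>)" by (rule complex_eqI) simp_all
    then show "cmod (cinner (e f) (resolvent_on \<G> H (Complex x (- \<mu>)) (e f))) \<le> 225 * c2 * (norm_\<E> f)\<^sup>2"
      using 1 resolvent_on_cnj[OF e_G, of "Complex x \<mu>" f] \<mu> by simp
  qed (rule purely_absolutely_continuous)
qed

end
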